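(* Let $S$ be a smooth surface locally parametrized by $\alpha(u,v)=(u,v,h(u,v))$ with flat umbilic point $p=\alpha(0,0)$ and $$h(u,v)=u^3-3uv^2+O(4),$$ where $O(4)$ denotes arbitrary smooth terms of order at least four. Let $A\,du^2+2B\,du\,dv+C\,dv^2=0$ be the extended equation of the affine asymptotic lines and $\delta=B^2-AC$. Then the discriminant set $\delta^{-1}(0)$ is locally the isolated point $(0,0)$. Moreover, near the origin the affine asymptotic lines form two transversal families in a punctured neighborhood of $(0,0)$, which are the orbits of two vector fields $Y_1$ and $Y_2$, both turning around the origin in the same sense, such that the origin is a stable topological focus of $Y_1$ and an unstable topological focus of $Y_2$ (so the curves of the two families spiral into the origin in opposite senses).
   Context: A flat umbilic point is a point where the Euclidean second fundamental form vanishes. Let $D=h_{uu}h_{vv}-h_{uv}^2$. Where $D\ne0$, the co-normal is $\nu=|D|^{-1/4}(\alpha_u\wedge\alpha_v)$, the affine normal $\xi$ is determined by $\langle\nu,\xi\rangle=1$, $\langle\xi,\nu_u\rangle=\langle\xi,\nu_v\rangle=0$, and $l=\langle\nu_u,\xi_u\rangle$, $m=\langle\nu_u,\xi_v\rangle$, $n=\langle\nu_v,\xi_v\rangle$. The affine asymptotic lines are the integral curves of $l\,du^2+2m\,du\,dv+n\,dv^2=0$. The functions $A=16D^2l$, $B=16D^2m$, $C=16D^2n$ are polynomials in the partial derivatives of $h$, hence extend smoothly to $\{D=0\}$; the equation of affine asymptotic lines is extended as $A\,du^2+2B\,du\,dv+C\,dv^2=0$. A topological focus is a singular point whose local phase portrait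 is topologically a focus: orbits tend to the point (in positive time if stable, in negative time if unstable) while their angle around it tends to infinity in absolute value. *)

theory Defs
  imports "HOL-Analysis.Analysis" "HOL-Library.Landau_Symbols"
begin

section \<open>Partial derivatives and smoothness on the parameter plane\<close>

definition pd_u :: "(real \<times> real \<Rightarrow> 'a::real_normed_vector) \<Rightarrow> real \<times> real \<Rightarrow> 'a" where
  "pd_u f p = vector_derivative (\<lambda>s. f (s, snd p)) (at (fst p))"

definition pd_v :: "(real \<times> real \<Rightarrow> 'a::real_normed_vector) \<Rightarrow> real \<times> real \<Rightarrow> 'a" where
  "pd_v f p = vector_derivative (\<lambda>s. f (fst p, s)) (at (snd p))"

text \<open>These notions of class \<open>C\<^sup>k\<close> and \<open>C\<^sup>\<infinity>\<close> are meant for open sets \<open>U\<close>.\<close>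

primrec Ck_on :: "nat \<Rightarrow> (real \<times> real) set \<Rightarrow> (real \<times> real \<Rightarrow> 'a::real_normed_vector) \<Rightarrow> bool" where
  "Ck_on 0 U f \<longleftrightarrow> continuous_on U f"
| "Ck_on (Suc k) U f \<longleftrightarrow> f differentiable_on U \<and> Ck_on k U (pd_u f) \<and> Ck_on k U (pd_v f)"

definition smooth_on :: "(real \<times> real) set \<Rightarrow> (real \<times> real \<Rightarrow> 'a::real_normed_vector) \<Rightarrow> bool" where
  "smooth_on U f \<longleftrightarrow> (\<forall>k. Ck_on k U f)"

section \<open>Euclidean and affine geometry of the graph of \<open>h\<close>\<close>

definition graph_param :: "(real \<times> real \<Rightarrow> real) \<Rightarrow> real \<times> real \<Rightarrow> real ^ 3" where
  "graph_param h p = vector [fst p, snd p, h p]"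

definition euclid_normal :: "(real \<times> real \<Rightarrow> real) \<Rightarrow> real \<times> real \<Rightarrow> real ^ 3" where
  "euclid_normal h p = sgn (cross3 (pd_u (graph_param h) p) (pd_v (graph_param h) p))"

text \<open>Vanishing of the three coefficients of the Euclidean second fundamental form.\<close>

definition flat_umbilic :: "(real \<times> real \<Rightarrow> real) \<Rightarrow> real \<times> real \<Rightarrow> bool" where
  "flat_umbilic h p \<longleftrightarrow>
     pd_u (pd_u (graph_param h)) p \<bullet> euclid_normal h p = 0 \<and>
     pd_v (pd_u (graph_param h)) p \<bullet> euclid_normal h p = 0 \<and>
     pd_v (pd_v (graph_param h)) p \<bullet> euclid_normal h p = 0"

definition hess_det :: "(real \<times> real \<Rightarrow> real) \<Rightarrow> real \<times> real \<Rightarrow> real" where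
  "hess_det h p = pd_u (pd_u h) p * pd_v (pd_v h) p - (pd_v (pd_u h) p)\<^sup>2"

definition conormal :: "(real \<times> real \<Rightarrow> real) \<Rightarrow> real \<times> real \<Rightarrow> real ^ 3" where
  "conormal h p = \<bar>hess_det h p\<bar> powr (- 1 / 4) *\<^sub>R
     cross3 (pd_u (graph_param h) p) (pd_v (graph_param h) p)"

text \<open>The next four definitions are meaningful at the points with \<open>hess_det h p \<noteq> 0\<close>.\<close>

definition affine_normal :: "(real \<times> real \<Rightarrow> real) \<Rightarrow> real \<times> real \<Rightarrow> real ^ 3" where
  "affine_normal h p = (THE x. conormal h p \<bullet> x = 1 \<and>
     x \<bullet> pd_u (conormal h) p = 0 \<and> x \<bullet> pd_v (conormal h) p = 0)"

definition aff_l :: "(real \<times> real \<Rightarrow> real) \<Rightarrow> real \<times> real \<Rightarrow> real" where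
  "aff_l h p = pd_u (conormal h) p \<bullet> pd_u (affine_normal h) p"

definition aff_m :: "(real \<times> real \<Rightarrow> real) \<Rightarrow> real \<times> real \<Rightarrow> real" where
  "aff_m h p = pd_u (conormal h) p \<bullet> pd_v (affine_normal h) p"

definition aff_n :: "(real \<times> real \<Rightarrow> real) \<Rightarrow> real \<times> real \<Rightarrow> real" where
  "aff_n h p = pd_v (conormal h) p \<bullet> pd_v (affine_normal h) p"

text \<open>The function \<open>16 D\<^sup>2 F\<close>, extended to the zero set of \<open>D = hess_det h\<close> by its limit along
  the points with \<open>D \<noteq> 0\<close>. Where \<open>{D \<noteq> 0}\<close> is dense (for the surfaces considered below, \<open>D\<close> has an
  isolated zero), this is the only possible continuous extension.\<close>

definition ext16 :: "(real \<times> real \<Rightarrow> real) \<Rightarrow> (real \<times> real \<Rightarrow> real) \<Rightarrow> real \<times> real \<Rightarrow> real" where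
  "ext16 h F p =
     (if hess_det h p \<noteq> 0 then 16 * (hess_det h p)\<^sup>2 * F p
      else Lim (at p within {q. hess_det h q \<noteq> 0}) (\<lambda>q. 16 * (hess_det h q)\<^sup>2 * F q))"

definition coeff_A :: "(real \<times> real \<Rightarrow> real) \<Rightarrow> real \<times> real \<Rightarrow> real" where
  "coeff_A h = ext16 h (aff_l h)"

definition coeff_B :: "(real \<times> real \<Rightarrow> real) \<Rightarrow> real \<times> real \<Rightarrow> real" where
  "coeff_B h = ext16 h (aff_m h)"

definition coeff_C :: "(real \<times> real \<Rightarrow> real) \<Rightarrow> real \<times> real \<Rightarrow> real" where
  "coeff_C h = ext16 h (aff_n h)"

definition discr :: "(real \<times> real \<Rightarrow> real) \<Rightarrow> real \<times> real \<Rightarrow> real" where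
  "discr h p = (coeff_B h p)\<^sup>2 - coeff_A h p * coeff_C h p"

text \<open>Regular \<open>C\<^sup>1\<close> integral curves, on an open interval \<open>I\<close>, of the extended equation
  \<open>A du\<^sup>2 + 2 B du dv + C dv\<^sup>2 = 0\<close>.\<close>

definition affine_asymptotic_line ::
  "(real \<times> real \<Rightarrow> real) \<Rightarrow> real set \<Rightarrow> (real \<Rightarrow> real \<times> real) \<Rightarrow> bool" where
  "affine_asymptotic_line h I c \<longleftrightarrow>
     (\<exists>c'. continuous_on I c' \<and>
       (\<forall>t\<in>I. (c has_vector_derivative c' t) (at t) \<and> c' t \<noteq> 0 \<and>
          coeff_A h (c t) * (fst (c' t))\<^sup>2 + 2 * coeff_B h (c t) * fst (c' t) * snd (c' t)
            + coeff_C h (c t) * (snd (c' t))\<^sup>2 = 0))"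

section \<open>Orbits of planar vector fields and topological foci\<close>

definition integral_curve ::
  "(real \<times> real \<Rightarrow> real \<times> real) \<Rightarrow> real set \<Rightarrow> (real \<Rightarrow> real \<times> real) \<Rightarrow> bool" where
  "integral_curve Y T x \<longleftrightarrow> (\<forall>t\<in>T. (x has_vector_derivative Y (x t)) (at t within T))"

text \<open>Up to a regular \<open>C\<^sup>1\<close> change of parameter \<open>\<phi>\<close>, of either direction, the curve \<open>c\<close> on the
  open interval \<open>I\<close> is an arc of an orbit of \<open>Y\<close>.\<close>

definition orbit_arc ::
  "(real \<times> real \<Rightarrow> real \<times> real) \<Rightarrow> real set \<Rightarrow> (real \<Rightarrow> real \<times> real) \<Rightarrow> bool" where
  "orbit_arc Y I c \<longleftrightarrow>
     (\<exists>\<phi> \<phi>' x. continuous_on I \<phi>' \<and>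
        (\<forall>t\<in>I. (\<phi> has_vector_derivative \<phi>' t) (at t) \<and> \<phi>' t \<noteq> 0) \<and>
        integral_curve Y (\<phi> ` I) x \<and> (\<forall>t\<in>I. c t = x (\<phi> t)))"

text \<open>\<open>\<theta>\<close> is a continuous determination of the angle of the curve \<open>x\<close> around \<open>p\<close>.\<close>

definition angle_along ::
  "real set \<Rightarrow> (real \<Rightarrow> real \<times> real) \<Rightarrow> real \<times> real \<Rightarrow> (real \<Rightarrow> real) \<Rightarrow> bool" where
  "angle_along T x p \<theta> \<longleftrightarrow> continuous_on T \<theta> \<and>
     (\<forall>t\<in>T. x t - p = norm (x t - p) *\<^sub>R (cos (\<theta> t), sin (\<theta> t)))"

text \<open>The orbits starting close to \<open>p\<close> stay close to \<open>p\<close>, tend to \<open>p\<close> in positive time without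
  reaching it, and wind infinitely often around it. The definition is meant for fields for which
  integral curves are unique away from \<open>p\<close>.\<close>

definition stable_topological_focus ::
  "(real \<times> real \<Rightarrow> real \<times> real) \<Rightarrow> real \<times> real \<Rightarrow> bool" where
  "stable_topological_focus Y p \<longleftrightarrow> Y p = 0 \<and>
     (\<forall>W. open W \<and> p \<in> W \<longrightarrow>
       (\<exists>V. open V \<and> p \<in> V \<and> V \<subseteq> W \<and>
         (\<forall>q\<in>V - {p}. \<exists>x \<theta>. x 0 = q \<and> integral_curve Y {0..} x \<and> x ` {0..} \<subseteq> W - {p} \<and>
            (x \<longlongrightarrow> p) at_top \<and> angle_along {0..} x p \<theta> \<and>
            filterlim (\<lambda>t. \<bar>\<theta> t\<bar>) at_top at_top)))"

text \<open>Reversing time amounts to replacing \<open>Y\<close> by \<open>- Y\<close>.\<close>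

definition unstable_topological_focus ::
  "(real \<times> real \<Rightarrow> real \<times> real) \<Rightarrow> real \<times> real \<Rightarrow> bool" where
  "unstable_topological_focus Y p \<longleftrightarrow> stable_topological_focus (\<lambda>q. - Y q) p"

text \<open>For an integral curve of \<open>Y\<close> this is the derivative of its angle around the origin.\<close>

definition angular_velocity :: "(real \<times> real \<Rightarrow> real \<times> real) \<Rightarrow> real \<times> real \<Rightarrow> real" where
  "angular_velocity Y p = (fst p * snd (Y p) - snd p * fst (Y p)) / (norm p)\<^sup>2"

text \<open>The orbits of \<open>Y\<close> in \<open>U\<close> which tend to the origin in positive time do so with an angle
  tending to \<open>+\<infinity>\<close> (for \<open>s = 1\<close>) or to \<open>-\<infinity>\<close> (for \<open>s = -1\<close>).\<close>

definition spirals_in_with_sense ::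
  "real \<Rightarrow> (real \<times> real) set \<Rightarrow> (real \<times> real \<Rightarrow> real \<times> real) \<Rightarrow> bool" where
  "spirals_in_with_sense s U Y \<longleftrightarrow>
     (\<forall>x \<theta>. integral_curve Y {0..} x \<and> x ` {0..} \<subseteq> U - {(0, 0)} \<and> (x \<longlongrightarrow> (0, 0)) at_top \<and>
        angle_along {0..} x (0, 0) \<theta> \<longrightarrow> filterlim (\<lambda>t. s * \<theta> t) at_top at_top)"

end

theory Submission
  imports Defs
begin

text \<open>Differentiating \<open>\<langle>\<nu>\<^sub>u, \<xi>\<rangle> = \<langle>\<nu>\<^sub>v, \<xi>\<rangle> = 0\<close> expresses \<open>A\<close>, \<open>B\<close>, \<open>C\<close> as polynomials in the derivatives of \<open>h\<close>,
  and for \<open>h = u\<^sup>3 - 3 u v\<^sup>2 + O(4)\<close> their leading terms are, with \<open>k = 5184\<close>,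
  \<open>k (- 3 u\<^sup>2 + 4 v\<^sup>2)\<close>, \<open>- 7 k u v\<close> and \<open>k (4 u\<^sup>2 - 3 v\<^sup>2)\<close>. In polar coordinates the leading part of the
  equation is \<open>k r\<^sup>2 (- 3 dr\<^sup>2 + 4 r\<^sup>2 d\<theta>\<^sup>2) = 0\<close>, with two families of logarithmic spirals as solutions
  and with discriminant \<open>12 k\<^sup>2 r\<^sup>4\<close>.

  The remainder is of higher order, so near the origin the equation still factors into two transversal
  line fields, spanned by \<open>- P + \<eta>\<^sub>1 P\<^sup>\<bottom>\<close> and \<open>P + \<eta>\<^sub>2 P\<^sup>\<bottom>\<close>, where \<open>P = (u, v)\<close>, \<open>P\<^sup>\<bottom> = (- v, u)\<close> and
  \<open>1/2 \<le> \<eta>\<^sub>i \<le> 2\<close>. With this normalization the radius along the orbits is exactly \<open>r\<^sub>0 exp (\<mp> t)\<close>, while the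
  angle has derivative \<open>\<eta>\<^sub>i\<close> and hence tends to infinity.\<close>

section \<open>Calculus of smooth functions in the plane\<close>

text \<open>The hypothesis bounds only the values of the remainder of \<open>h\<close>, while
  \<open>A\<close>, \<open>B\<close>, \<open>C\<close> contain derivatives of \<open>h\<close> up to
  order four. So it must first be shown that for a smooth function a partial derivative loses just
  one order of vanishing; interpolation along line segments gives this from the pointwise bound and
  a bound on a higher derivative.

  The factorization is carried out in the frame \<open>P\<close>, \<open>P'\<close> formed by the
  radial vector and its rotation, because in the \<open>(du, dv)\<close> frame both \<open>A\<close>
  and \<open>C\<close> change sign in every neighborhood of the origin and neither root is a global
  slope. In the radial frame the angular coefficient is positive off the origin, so both slopes are
  smooth functions on the whole punctured disc.

  The resulting fields are smooth only off the origin, whereas a focus requires orbits defined for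
  all positive time. The radial normalization removes this difficulty: the radius is known in
  advance, it never reaches 0, and what remains is a scalar equation for the angle with bounded
  right-hand side.\<close>

lemma differentiable_at_slices:
  assumes "f differentiable (at p)"
  shows "(\<lambda>s. f (s, snd p)) differentiable (at (fst p))"
    and "(\<lambda>s. f (fst p, s)) differentiable (at (snd p))"
proof -
  have 1: "(\<lambda>s. (s, snd p)) differentiable (at (fst p))" "(\<lambda>s. (fst p, s)) differentiable (at (snd p))"
    using has_derivative_Pair[OF has_derivative_ident has_derivative_const]
      has_derivative_Pair[OF has_derivative_const has_derivative_ident] unfolding differentiable_def by blast+
  show "(\<lambda>s. f (s, snd p)) differentiable (at (fst p))"
    using differentiable_chain_at[OF 1(1), of f] assms by (simp add: o_def)
  show "(\<lambda>s. f (fst p, s)) differentiable (at (snd p))"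
    using differentiable_chain_at[OF 1(2), of f] assms by (simp add: o_def)
qed

lemma has_pd:
  assumes "f differentiable (at p)"
  shows "((\<lambda>s. f (s, snd p)) has_vector_derivative pd_u f p) (at (fst p))"
    and "((\<lambda>s. f (fst p, s)) has_vector_derivative pd_v f p) (at (snd p))"
  using differentiable_at_slices[OF assms] unfolding pd_u_def pd_v_def
  by (auto simp: vector_derivative_works)

lemma has_real_pd:
  fixes f :: "real \<times> real \<Rightarrow> real"
  assumes "f differentiable (at (u, v))"
  shows "((\<lambda>s. f (s, v)) has_real_derivative pd_u f (u, v)) (at u)"
    and "((\<lambda>s. f (u, s)) has_real_derivative pd_v f (u, v)) (at v)"
  using has_pd[OF assms] by (auto simp: has_real_derivative_iff_has_vector_derivative)

lemma pd_u_eqI: "((\<lambda>s. f (s, snd p)) has_vector_derivative d) (at (fst p)) \<Longrightarrow> pd_u f p = d"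
  unfolding pd_u_def by (rule vector_derivative_at)

lemma pd_v_eqI: "((\<lambda>s. f (fst p, s)) has_vector_derivative d) (at (snd p)) \<Longrightarrow> pd_v f p = d"
  unfolding pd_v_def by (rule vector_derivative_at)

lemma pd_u_real_eqI:
  "((\<lambda>s. f (s, snd p)) has_real_derivative d) (at (fst p)) \<Longrightarrow> pd_u f p = d"
  by (auto intro!: pd_u_eqI simp: has_real_derivative_iff_has_vector_derivative)

lemma pd_v_real_eqI:
  "((\<lambda>s. f (fst p, s)) has_real_derivative d) (at (snd p)) \<Longrightarrow> pd_v f p = d"
  by (auto intro!: pd_v_eqI simp: has_real_derivative_iff_has_vector_derivative)

lemma pd_cong:
  assumes "open U" "p \<in> U" "\<And>q. q \<in> U \<Longrightarrow> f q = g q"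
  shows "pd_u f p = pd_u g p" "pd_v f p = pd_v g p"
proof -
  have ev: "eventually (\<lambda>q. f q = g q) (nhds p)"
    using assms eventually_nhds by blast
  have "((\<lambda>s. (s, snd p)) \<longlongrightarrow> (fst p, snd p)) (nhds (fst p))"
    "((\<lambda>s. (fst p, s)) \<longlongrightarrow> (fst p, snd p)) (nhds (snd p))"
    by (intro tendsto_intros filterlim_ident)+
  then have "eventually (\<lambda>s. f (s, snd p) = g (s, snd p)) (nhds (fst p))"
    "eventually (\<lambda>s. f (fst p, s) = g (fst p, s)) (nhds (snd p))"
    using ev by (auto simp: filterlim_iff)
  then show "pd_u f p = pd_u g p" "pd_v f p = pd_v g p"
    unfolding pd_u_def pd_v_def
    by (auto intro!: vector_derivative_cong_eq)
qed

lemma has_derivative_pd: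
  assumes "f differentiable (at p)"
  shows "(f has_derivative (\<lambda>h. fst h *\<^sub>R pd_u f p + snd h *\<^sub>R pd_v f p)) (at p)"
proof -
  obtain D where D: "(f has_derivative D) (at p)" using assms by (auto simp: differentiable_def)
  interpret D: bounded_linear D using D by (rule has_derivative_bounded_linear)
  have D': "(f has_derivative D) (at (fst p, snd p))" using D by simp
  have a: "((\<lambda>s. (s, snd p)) has_derivative (\<lambda>s. (s, 0))) (at (fst p))"
    "((\<lambda>s. (fst p, s)) has_derivative (\<lambda>s. (0, s))) (at (snd p))"
    by (rule has_derivative_Pair[OF has_derivative_ident has_derivative_const]
      has_derivative_Pair[OF has_derivative_const has_derivative_ident])+
  have "((\<lambda>s. f (s, snd p)) has_vector_derivative D (1, 0)) (at (fst p))"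
    using has_derivative_compose[OF a(1) D']
    by (simp add: has_vector_derivative_def flip: D.scaleR)
  then have 1: "pd_u f p = D (1, 0)" by (rule pd_u_eqI)
  have "((\<lambda>s. f (fst p, s)) has_vector_derivative D (0, 1)) (at (snd p))"
    using has_derivative_compose[OF a(2) D']
    by (simp add: has_vector_derivative_def flip: D.scaleR)
  then have 2: "pd_v f p = D (0, 1)" by (rule pd_v_eqI)
  have "D h = fst h *\<^sub>R pd_u f p + snd h *\<^sub>R pd_v f p" for h
  proof -
    have "D h = D (fst h *\<^sub>R (1, 0) + snd h *\<^sub>R (0, 1))" by simp
    also have "\<dots> = fst h *\<^sub>R D (1, 0) + snd h *\<^sub>R D (0, 1)" by (simp only: D.add D.scaleR)
    finally show ?thesis by (simp only: 1 2)
  qed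
  then have "D = (\<lambda>h. fst h *\<^sub>R pd_u f p + snd h *\<^sub>R pd_v f p)" by (rule ext)
  then show ?thesis using D by simp
qed

lemma differentiable_on_cong:
  assumes "open U" "\<And>q. q \<in> U \<Longrightarrow> f q = g q" "f differentiable_on U"
  shows "g differentiable_on U"
  using assms unfolding differentiable_on_def differentiable_def
  by (metis has_derivative_transform)

text \<open>Partial derivatives see only values near the point, so on an open set equality passes to
  partial derivatives of every order. This is what turns the product and power rules below, which
  hold only on \<open>U\<close>, into induction steps for \<open>Ck_on\<close>.\<close>

lemma Ck_on_cong:
  assumes "open U" "\<And>q. q \<in> U \<Longrightarrow> f q = g q" "Ck_on k U f"
  shows "Ck_on k U g"
  using assms(2,3)
proof (induction k arbitrary: f g)
  case 0
  then show ?case using continuous_on_cong[of U U f g] by simp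
next
  case (Suc k)
  have "pd_u f q = pd_u g q" "pd_v f q = pd_v g q" if "q \<in> U" for q
    using pd_cong[OF assms(1) that Suc.prems(1)] by auto
  moreover have "g differentiable_on U"
    using differentiable_on_cong[OF assms(1) Suc.prems(1)] Suc.prems(2) by auto
  ultimately show ?case
    using Suc.IH[of "pd_u f" "pd_u g"] Suc.IH[of "pd_v f" "pd_v g"] Suc.prems(2) by auto
qed

lemma Ck_on_subset:
  assumes "Ck_on k U f" "V \<subseteq> U"
  shows "Ck_on k V f"
  using assms
proof (induction k arbitrary: f)
  case 0 then show ?case by (auto intro: continuous_on_subset)
next
  case (Suc k) then show ?case by (auto intro: differentiable_on_subset)
qed

lemma Ck_on_Suc_imp: "Ck_on (Suc k) U f \<Longrightarrow> Ck_on k U f"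
proof (induction k arbitrary: f)
  case 0
  then show ?case by (simp add: differentiable_imp_continuous_on)
next
  case (Suc k)
  have "Ck_on (Suc k) U (pd_u f)" "Ck_on (Suc k) U (pd_v f)"
    using Suc.prems unfolding Ck_on.simps(2)[of "Suc k"] by blast+
  from this[THEN Suc.IH] show ?case using Suc.prems unfolding Ck_on.simps(2)[of "Suc k"] Ck_on.simps(2)[of k] by blast
qed

lemma smooth_on_pd:
  assumes "smooth_on U f"
  shows "smooth_on U (pd_u f)" "smooth_on U (pd_v f)"
  using assms unfolding smooth_on_def by (metis Ck_on.simps(2))+

lemma smooth_on_subset: "smooth_on U f \<Longrightarrow> V \<subseteq> U \<Longrightarrow> smooth_on V f"
  using Ck_on_subset unfolding smooth_on_def by blast

lemma smooth_on_cong: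
  "open U \<Longrightarrow> (\<And>q. q \<in> U \<Longrightarrow> f q = g q) \<Longrightarrow> smooth_on U f \<Longrightarrow> smooth_on U g"
  unfolding smooth_on_def using Ck_on_cong by metis

lemma smooth_on_continuous_on: "smooth_on U f \<Longrightarrow> continuous_on U f"
  unfolding smooth_on_def by (metis Ck_on.simps(1))

lemma smooth_on_differentiable_at:
  assumes "smooth_on U f" "open U" "p \<in> U"
  shows "f differentiable (at p)"
  using assms unfolding smooth_on_def
  by (metis Ck_on.simps(2) at_within_open differentiable_on_def)

section \<open>Closure of the class C^k under arithmetic operations and real powers\<close>

lemma Ck_on_const: "Ck_on k U (\<lambda>p. c)"
proof (induction k arbitrary: c)
  case (Suc k)
  have "pd_u (\<lambda>p. c) = (\<lambda>p. 0)" "pd_v (\<lambda>p. c) = (\<lambda>p. 0)"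
    by (auto intro!: ext pd_u_eqI pd_v_eqI)
  then show ?case using Suc by simp
qed simp

lemma Ck_on_fst: "Ck_on k U fst" and Ck_on_snd: "Ck_on k U snd"
proof -
  have "pd_u fst = (\<lambda>p. 1::real)" "pd_v fst = (\<lambda>p. 0::real)" "pd_u snd = (\<lambda>p. 0::real)" "pd_v snd = (\<lambda>p. 1::real)"
    by (auto intro!: ext pd_u_eqI pd_v_eqI derivative_eq_intros)
  then show "Ck_on k U fst" "Ck_on k U snd"
    by (cases k; auto simp: Ck_on_const intro!: continuous_intros bounded_linear_imp_differentiable_on bounded_linear_fst bounded_linear_snd)+
qed

lemma Ck_on_Suc_differentiable_at:
  "Ck_on (Suc k) U f \<Longrightarrow> open U \<Longrightarrow> p \<in> U \<Longrightarrow> f differentiable (at p)"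
  by (metis Ck_on.simps(2) at_within_open differentiable_on_def)

lemma pd_add:
  assumes "f differentiable (at p)" "g differentiable (at p)"
  shows "pd_u (\<lambda>q. f q + g q) p = pd_u f p + pd_u g p"
    "pd_v (\<lambda>q. f q + g q) p = pd_v f p + pd_v g p"
  using has_pd[OF assms(1)] has_pd[OF assms(2)]
  by (auto intro!: pd_u_eqI pd_v_eqI derivative_intros)

lemma pd_diff:
  assumes "f differentiable (at p)" "g differentiable (at p)"
  shows "pd_u (\<lambda>q. f q - g q) p = pd_u f p - pd_u g p"
    "pd_v (\<lambda>q. f q - g q) p = pd_v f p - pd_v g p"
  using has_pd[OF assms(1)] has_pd[OF assms(2)]
  by (auto intro!: pd_u_eqI pd_v_eqI derivative_intros)

lemma pd_mult:
  fixes f g :: "real \<times> real \<Rightarrow> real"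
  assumes "f differentiable (at p)" "g differentiable (at p)"
  shows "pd_u (\<lambda>q. f q * g q) p = pd_u f p * g p + f p * pd_u g p"
    "pd_v (\<lambda>q. f q * g q) p = pd_v f p * g p + f p * pd_v g p"
  using has_real_pd[of f "fst p" "snd p"] has_real_pd[of g "fst p" "snd p"] assms
  by (auto intro!: pd_u_real_eqI pd_v_real_eqI derivative_eq_intros)

lemma pd_powr:
  fixes f :: "real \<times> real \<Rightarrow> real"
  assumes "f differentiable (at p)" "f p > 0"
  shows "pd_u (\<lambda>q. f q powr a) p = a * f p powr (a - 1) * pd_u f p"
    "pd_v (\<lambda>q. f q powr a) p = a * f p powr (a - 1) * pd_v f p"
  using has_real_pd[of f "fst p" "snd p"] assms
  by (auto intro!: pd_u_real_eqI pd_v_real_eqI derivative_eq_intros simp: powr_diff)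

lemma Ck_on_add:
  assumes "open U" "Ck_on k U f" "Ck_on k U g"
  shows "Ck_on k U (\<lambda>p. f p + g p)"
  using assms(2,3)
proof (induction k arbitrary: f g)
  case 0 then show ?case by (auto intro!: continuous_intros)
next
  case (Suc k)
  note d = Ck_on_Suc_differentiable_at[OF Suc.prems(1) assms(1)] Ck_on_Suc_differentiable_at[OF Suc.prems(2) assms(1)]
  have "Ck_on k U (\<lambda>q. pd_u f q + pd_u g q)" "Ck_on k U (\<lambda>q. pd_v f q + pd_v g q)"
    using Suc.prems by (auto intro!: Suc.IH)
  note * = this
  have "Ck_on k U (pd_u (\<lambda>q. f q + g q))" by (rule Ck_on_cong[OF assms(1) _ *(1)]) (simp add: pd_add d)
  moreover have "Ck_on k U (pd_v (\<lambda>q. f q + g q))" by (rule Ck_on_cong[OF assms(1) _ *(2)]) (simp add: pd_add d)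
  ultimately show ?case
    using Suc.prems by (auto intro!: derivative_intros)
qed

lemma Ck_on_mult:
  fixes f g :: "real \<times> real \<Rightarrow> real"
  assumes "open U" "Ck_on k U f" "Ck_on k U g"
  shows "Ck_on k U (\<lambda>p. f p * g p)"
  using assms(2,3)
proof (induction k arbitrary: f g)
  case 0 then show ?case by (auto intro!: continuous_intros)
next
  case (Suc k)
  note d = Ck_on_Suc_differentiable_at[OF Suc.prems(1) assms(1)] Ck_on_Suc_differentiable_at[OF Suc.prems(2) assms(1)]
  have f: "Ck_on k U f" "Ck_on k U g" using Suc.prems Ck_on_Suc_imp by blast+
  have "Ck_on k U (\<lambda>q. pd_u f q * g q + f q * pd_u g q)" "Ck_on k U (\<lambda>q. pd_v f q * g q + f q * pd_v g q)"
    using Suc.prems f by (auto intro!: Ck_on_add assms(1) Suc.IH)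
  note * = this
  have "Ck_on k U (pd_u (\<lambda>q. f q * g q))" by (rule Ck_on_cong[OF assms(1) _ *(1)]) (simp add: pd_mult d)
  moreover have "Ck_on k U (pd_v (\<lambda>q. f q * g q))" by (rule Ck_on_cong[OF assms(1) _ *(2)]) (simp add: pd_mult d)
  ultimately show ?case
    using Suc.prems by (auto intro!: derivative_intros)
qed

text \<open>The exponent is generalized in the induction because differentiation lowers it to
  \<open>a - 1\<close>. Real powers provide the factor of the co-normal, square roots and
  reciprocals.\<close>

lemma Ck_on_powr:
  fixes f :: "real \<times> real \<Rightarrow> real"
  assumes "open U" "Ck_on k U f" "\<And>p. p \<in> U \<Longrightarrow> f p > 0"
  shows "Ck_on k U (\<lambda>p. f p powr a)"
  using assms(2)
proof (induction k arbitrary: a)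
  case 0 then show ?case using assms(3) by (force intro!: continuous_intros)
next
  case (Suc k)
  note d = Ck_on_Suc_differentiable_at[OF Suc.prems(1) assms(1)]
  have f: "Ck_on k U f" using Suc.prems Ck_on_Suc_imp by blast
  have "Ck_on k U (\<lambda>q. (a * f q powr (a - 1)) * pd_u f q)" "Ck_on k U (\<lambda>q. (a * f q powr (a - 1)) * pd_v f q)"
    using Suc.prems f by (auto intro!: Ck_on_mult assms(1) Suc.IH Ck_on_const)
  note * = this
  have "Ck_on k U (pd_u (\<lambda>q. f q powr a))" by (rule Ck_on_cong[OF assms(1) _ *(1)]) (simp add: pd_powr d assms(3))
  moreover have "Ck_on k U (pd_v (\<lambda>q. f q powr a))" by (rule Ck_on_cong[OF assms(1) _ *(2)]) (simp add: pd_powr d assms(3))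
  moreover have "(\<lambda>q. f q powr a) differentiable_on U"
  proof -
    have "((\<lambda>q. f q powr a) has_derivative (\<lambda>h. (a * f p powr (a - 1)) * (fst h *\<^sub>R pd_u f p + snd h *\<^sub>R pd_v f p))) (at p)"
      if "p \<in> U" for p
      using has_derivative_compose[OF has_derivative_pd[OF d[OF that]], of "\<lambda>x. x powr a" "\<lambda>h. (a * f p powr (a - 1)) * h"]
        has_real_derivative_powr[of "f p" a] assms(3)[OF that]
      by (auto simp: has_field_derivative_def)
    then show ?thesis unfolding differentiable_on_def differentiable_def
      using has_derivative_at_withinI by blast
  qed
  ultimately show ?case by simp
qed

lemma Ck_on_Pair:
  fixes f g :: "real \<times> real \<Rightarrow> real"
  assumes "open U" "Ck_on k U f" "Ck_on k U g"
  shows "Ck_on k U (\<lambda>p. (f p, g p))"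
  using assms(2,3)
proof (induction k arbitrary: f g)
  case 0 then show ?case by (auto intro!: continuous_intros)
next
  case (Suc k)
  note d = Ck_on_Suc_differentiable_at[OF Suc.prems(1) assms(1)] Ck_on_Suc_differentiable_at[OF Suc.prems(2) assms(1)]
  have e: "pd_u (\<lambda>q. (f q, g q)) p = (pd_u f p, pd_u g p)" "pd_v (\<lambda>q. (f q, g q)) p = (pd_v f p, pd_v g p)" if "p \<in> U" for p
    using has_pd[OF d(1)[OF that]] has_pd[OF d(2)[OF that]]
    by (auto intro!: pd_u_eqI pd_v_eqI has_vector_derivative_Pair)
  have "Ck_on k U (\<lambda>q. (pd_u f q, pd_u g q))" "Ck_on k U (\<lambda>q. (pd_v f q, pd_v g q))"
    using Suc.prems by (auto intro!: Suc.IH)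
  note * = this
  have "Ck_on k U (pd_u (\<lambda>q. (f q, g q)))" by (rule Ck_on_cong[OF assms(1) _ *(1)]) (simp add: e)
  moreover have "Ck_on k U (pd_v (\<lambda>q. (f q, g q)))" by (rule Ck_on_cong[OF assms(1) _ *(2)]) (simp add: e)
  moreover have "(\<lambda>p. (f p, g p)) differentiable_on U"
    using Suc.prems unfolding differentiable_on_def differentiable_def Ck_on.simps
    by (blast intro: has_derivative_Pair)
  ultimately show ?case by simp
qed

named_theorems smooth_intros

lemma smooth_on_const [smooth_intros]: "smooth_on U (\<lambda>p. c)"
  and smooth_on_fst [smooth_intros]: "smooth_on U fst"
  and smooth_on_snd [smooth_intros]: "smooth_on U snd"
  by (auto simp: smooth_on_def Ck_on_const Ck_on_fst Ck_on_snd)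

lemma smooth_on_add [smooth_intros]:
  "open U \<Longrightarrow> smooth_on U f \<Longrightarrow> smooth_on U g \<Longrightarrow> smooth_on U (\<lambda>p. f p + g p)"
  by (auto simp: smooth_on_def Ck_on_add)

lemma smooth_on_mult [smooth_intros]:
  fixes f g :: "real \<times> real \<Rightarrow> real"
  shows "open U \<Longrightarrow> smooth_on U f \<Longrightarrow> smooth_on U g \<Longrightarrow> smooth_on U (\<lambda>p. f p * g p)"
  by (auto simp: smooth_on_def Ck_on_mult)

lemma smooth_on_Pair [smooth_intros]:
  fixes f g :: "real \<times> real \<Rightarrow> real"
  shows "open U \<Longrightarrow> smooth_on U f \<Longrightarrow> smooth_on U g \<Longrightarrow> smooth_on U (\<lambda>p. (f p, g p))"
  by (auto simp: smooth_on_def Ck_on_Pair)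

lemma smooth_on_powr [smooth_intros]:
  fixes f :: "real \<times> real \<Rightarrow> real"
  shows "open U \<Longrightarrow> smooth_on U f \<Longrightarrow> (\<And>p. p \<in> U \<Longrightarrow> f p > 0) \<Longrightarrow> smooth_on U (\<lambda>p. f p powr a)"
  by (auto simp: smooth_on_def Ck_on_powr)

lemma smooth_on_minus [smooth_intros]:
  fixes f :: "real \<times> real \<Rightarrow> real"
  shows "open U \<Longrightarrow> smooth_on U f \<Longrightarrow> smooth_on U (\<lambda>p. - f p)"
  using smooth_on_mult[of U "\<lambda>p. -1" f] smooth_on_const[of U "-1::real"] by simp

lemma smooth_on_diff [smooth_intros]:
  fixes f g :: "real \<times> real \<Rightarrow> real"
  shows "open U \<Longrightarrow> smooth_on U f \<Longrightarrow> smooth_on U g \<Longrightarrow> smooth_on U (\<lambda>p. f p - g p)"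
  using smooth_on_add[of U f "\<lambda>p. - g p"] smooth_on_minus[of U g] by simp

lemma smooth_on_power [smooth_intros]:
  fixes f :: "real \<times> real \<Rightarrow> real"
  shows "open U \<Longrightarrow> smooth_on U f \<Longrightarrow> smooth_on U (\<lambda>p. f p ^ n)"
  by (induction n) (auto intro: smooth_intros)

lemma smooth_on_sqrt [smooth_intros]:
  fixes f :: "real \<times> real \<Rightarrow> real"
  assumes "open U" "smooth_on U f" "\<And>p. p \<in> U \<Longrightarrow> f p > 0"
  shows "smooth_on U (\<lambda>p. sqrt (f p))"
  using smooth_on_powr[OF assms, of "1/2"]
  by (rule smooth_on_cong[OF assms(1), rotated]) (auto intro!: powr_half_sqrt less_imp_le assms(3))

lemma smooth_on_inverse:
  fixes f :: "real \<times> real \<Rightarrow> real"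
  assumes "open U" "smooth_on U f" "\<And>p. p \<in> U \<Longrightarrow> f p \<noteq> 0"
  shows "smooth_on U (\<lambda>p. inverse (f p))"
proof -
  \<comment> \<open>\<open>f\<close> may be negative, so the real power is applied to its square:
    \<open>1 / f = f / f^2\<close>.\<close>
  have "smooth_on U (\<lambda>p. f p * ((f p)^2) powr (-1))"
    using assms by (intro smooth_intros) auto
  then show ?thesis
    by (rule smooth_on_cong[OF assms(1), rotated])
      (use assms(3) in \<open>simp add: powr_minus power2_eq_square\<close>)
qed

lemma smooth_on_divide [smooth_intros]:
  fixes f g :: "real \<times> real \<Rightarrow> real"
  assumes "open U" "smooth_on U f" "smooth_on U g" "\<And>p. p \<in> U \<Longrightarrow> g p \<noteq> 0"
  shows "smooth_on U (\<lambda>p. f p / g p)"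
  unfolding divide_inverse by (intro smooth_on_mult smooth_on_inverse assms)

text \<open>Both mixed partial derivatives are limits of the same second difference quotient.\<close>

lemma pd_commute:
  fixes f :: "real \<times> real \<Rightarrow> real"
  assumes U: "open U" "p \<in> U" and f: "smooth_on U f"
  shows "pd_u (pd_v f) p = pd_v (pd_u f) p"
proof (rule ccontr)
  define a where "a = pd_u (pd_v f)"
  define b where "b = pd_v (pd_u f)"
  assume "pd_u (pd_v f) p \<noteq> pd_v (pd_u f) p"
  then have e: "\<bar>a p - b p\<bar> / 2 > 0" by (simp add: a_def b_def)
  have sm: "smooth_on U a" "smooth_on U b" using f by (auto simp: a_def b_def intro!: smooth_on_pd)
  then have "isCont a p" "isCont b p" 
    using U smooth_on_continuous_on continuous_on_eq_continuous_at by blast+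
  then have "(a \<longlongrightarrow> a p) (nhds p)" "(b \<longlongrightarrow> b p) (nhds p)"
    by (auto simp: isCont_def tendsto_at_iff_tendsto_nhds)
  then have "eventually (\<lambda>q. dist (a q) (a p) < \<bar>a p - b p\<bar> / 2 \<and> dist (b q) (b p) < \<bar>a p - b p\<bar> / 2 \<and> q \<in> U) (nhds p)"
    using e U by (intro eventually_conj tendstoD eventually_nhds_in_open)
  then obtain d where d: "d > 0" "\<And>q. dist q p < d \<Longrightarrow> dist (a q) (a p) < \<bar>a p - b p\<bar> / 2 \<and> dist (b q) (b p) < \<bar>a p - b p\<bar> / 2 \<and> q \<in> U"
    unfolding eventually_nhds_metric by blast
  obtain u v where p: "p = (u, v)" by force
  \<comment> \<open>A square of side \<open>d / 2\<close> has diagonal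
    \<open>sqrt 2 * d / 2 < d\<close>, so it stays inside the ball where both mixed derivatives are
    within half the gap of their values at \<open>p\<close>.\<close>
  define r where "r = d / 2"
  have r: "r > 0" using d by (simp add: r_def)
  have near: "dist (s, t) p < d" if "u \<le> s" "s \<le> u + r" "v \<le> t" "t \<le> v + r" for s t
  proof -
    have "dist (s, t) p \<le> sqrt (r^2 + r^2)"
      unfolding p dist_Pair_Pair using that
      by (intro real_sqrt_le_mono add_mono power_mono) (auto simp: dist_real_def)
    also have "\<dots> = sqrt 2 * r" using r by (simp add: real_sqrt_mult flip: mult_2)
    also have "\<dots> < 2 * r" using r sqrt2_less_2 by simp
    finally show ?thesis by (simp add: r_def)
  qed
  have df: "f differentiable (at q)" "pd_u f differentiable (at q)" "pd_v f differentiable (at q)" if "dist q p < d" for q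
    using d(2)[OF that] f U smooth_on_differentiable_at smooth_on_pd by blast+
  define \<Delta> where "\<Delta> = f (u + r, v + r) - f (u + r, v) - f (u, v + r) + f (u, v)"
  have "\<exists>x. u < x \<and> x < u + r \<and> (f (u + r, v + r) - f (u + r, v)) - (f (u, v + r) - f (u, v)) = (u + r - u) * (pd_u f (x, v + r) - pd_u f (x, v))"
    using r near by (intro MVT2[where f="\<lambda>s. f (s, v + r) - f (s, v)"]) (auto intro!: derivative_intros has_real_pd df)
  then obtain x where x: "u < x" "x < u + r" "\<Delta> = r * (pd_u f (x, v + r) - pd_u f (x, v))"
    by (auto simp: \<Delta>_def algebra_simps)
  have "\<exists>y. v < y \<and> y < v + r \<and> pd_u f (x, v + r) - pd_u f (x, v) = (v + r - v) * b (x, y)"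
    unfolding b_def using r near x by (intro MVT2[where f="\<lambda>s. pd_u f (x, s)"]) (auto intro!: derivative_intros has_real_pd df)
  then obtain y where y: "v < y" "y < v + r" "\<Delta> = r * (r * b (x, y))" using x(3) by auto
  have "\<exists>y. v < y \<and> y < v + r \<and> (f (u + r, v + r) - f (u, v + r)) - (f (u + r, v) - f (u, v)) = (v + r - v) * (pd_v f (u + r, y) - pd_v f (u, y))"
    using r near by (intro MVT2[where f="\<lambda>s. f (u + r, s) - f (u, s)"]) (auto intro!: derivative_intros has_real_pd df)
  then obtain z where z: "v < z" "z < v + r" "\<Delta> = r * (pd_v f (u + r, z) - pd_v f (u, z))"
    by (auto simp: \<Delta>_def algebra_simps)
  have "\<exists>y. u < y \<and> y < u + r \<and> pd_v f (u + r, z) - pd_v f (u, z) = (u + r - u) * a (y, z)"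
    unfolding a_def using r near z by (intro MVT2[where f="\<lambda>s. pd_v f (s, z)"]) (auto intro!: derivative_intros has_real_pd df)
  then obtain w where w: "u < w" "w < u + r" "\<Delta> = r * (r * a (w, z))" using z(3) by auto
  have "a (w, z) = b (x, y)" using w(3) y(3) r by simp
  moreover have "dist (a (w, z)) (a p) < \<bar>a p - b p\<bar> / 2" "dist (b (x, y)) (b p) < \<bar>a p - b p\<bar> / 2"
    using d(2)[OF near[of w z]] d(2)[OF near[of x y]] w x y z by linarith+
  ultimately show False unfolding dist_real_def by argo
qed

section \<open>Order of vanishing at the origin\<close>

text \<open>An interpolation inequality: bounds on a function and its \<open>n\<close>-th derivative
  control the first derivative. By Maclaurin's formula the function is a polynomial \<open>T\<close>
  of degree below \<open>n\<close> up to an error \<open>M * \<bar>x\<bar> ^ n\<close>, and the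
  slope of \<open>T\<close> at 0 is recovered from its values at \<open>r\<close>,
  \<open>- r\<close>, \<open>2 * r\<close>, \<open>- (2 * r)\<close>. That four-point formula is
  exact for cubics, which covers all \<open>n\<close> up to the order four of the given
  remainder.\<close>

lemma central_slope_bound:
  fixes d :: "nat \<Rightarrow> real \<Rightarrow> real"
  assumes n: "n \<in> {2, 3, 4}" and r: "r > 0"
    and der: "\<And>m t. m < n \<Longrightarrow> \<bar>t\<bar> \<le> 2 * r \<Longrightarrow> (d m has_real_derivative d (Suc m) t) (at t)"
    and C: "\<And>t. \<bar>t\<bar> \<le> 2 * r \<Longrightarrow> \<bar>d 0 t\<bar> \<le> C * r ^ n"
    and M: "\<And>t. \<bar>t\<bar> \<le> 2 * r \<Longrightarrow> \<bar>d n t\<bar> \<le> M"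
  shows "\<bar>d 1 0\<bar> \<le> (2 * C + 4 * M) * r ^ (n - 1)"
proof -
  define T where "T x = (\<Sum>m<n. d m 0 / fact m * x ^ m)" for x
  have T: "\<bar>d 0 x - T x\<bar> \<le> M * \<bar>x\<bar> ^ n" if "\<bar>x\<bar> \<le> 2 * r" for x
  proof -
    have "\<exists>t. \<bar>t\<bar> \<le> \<bar>x\<bar> \<and> d 0 x = (\<Sum>m<n. d m 0 / fact m * x ^ m) + d n t / fact n * x ^ n"
      using that by (intro Maclaurin_bi_le) (auto intro!: der)
    then obtain t where t: "\<bar>t\<bar> \<le> \<bar>x\<bar>" "d 0 x = T x + d n t / fact n * x ^ n"
      unfolding T_def by blast
    have "\<bar>d n t / fact n\<bar> \<le> \<bar>d n t\<bar> / 1"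
      unfolding abs_divide by (intro divide_left_mono) (auto simp: fact_ge_1)
    then have "\<bar>d n t / fact n\<bar> \<le> M" using M[of t] t(1) that by simp
    then have "\<bar>d n t / fact n\<bar> * \<bar>x ^ n\<bar> \<le> M * \<bar>x ^ n\<bar>" by (rule mult_right_mono) simp
    then show ?thesis unfolding t(2) by (simp only: add_diff_cancel_left' abs_mult power_abs)
  qed
  have M0: "M \<ge> 0" using M[of 0] r by auto
  have C0: "C * r ^ n \<ge> 0" using C[of 0] r by auto
  txt \<open>This combination of values annihilates the constant, quadratic and cubic terms.\<close>
  have T12: "8 * (T r - T (- r)) - (T (2 * r) - T (- (2 * r))) = 12 * (d 1 0 * r)"
    using n unfolding T_def
    by (elim insertE emptyE; simp add: eval_nat_numeral lessThan_Suc; simp add: algebra_simps)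
  have tri: "\<bar>T x\<bar> \<le> C * r ^ n + K" if "\<bar>x\<bar> \<le> 2 * r" "M * \<bar>x\<bar> ^ n \<le> K" for x K
    using T[OF that(1)] C[OF that(1)] that(2) by linarith
  have "(2 * r) ^ n \<le> 16 * r ^ n"
    using n r by (auto simp: power_mult_distrib)
  then have "M * (2 * r) ^ n \<le> 16 * (M * r ^ n)"
    using M0 mult_left_mono[of "(2 * r) ^ n" "16 * r ^ n" M] by (simp add: mult_ac)
  then have "\<bar>T (2 * r)\<bar> \<le> C * r ^ n + 16 * (M * r ^ n)" "\<bar>T (- (2 * r))\<bar> \<le> C * r ^ n + 16 * (M * r ^ n)"
    using r by (auto intro!: tri simp del: minus_mult_right)
  moreover have "\<bar>T r\<bar> \<le> C * r ^ n + M * r ^ n" "\<bar>T (- r)\<bar> \<le> C * r ^ n + M * r ^ n"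
    using r by (auto intro!: tri)
  \<comment> \<open>\<open>18 = 8 + 8 + 1 + 1\<close> and \<open>48 = 8 + 8 + 16 + 16\<close>.
    Division by 12 then gives \<open>3 / 2\<close> and \<open>4\<close>, and \<open>3 / 2\<close> is
    rounded up to \<open>2\<close>.\<close>
  moreover have "\<bar>8 * (a - b) - (c - e)\<bar> \<le> 18 * x + 48 * y"
    if "\<bar>a\<bar> \<le> x + y" "\<bar>b\<bar> \<le> x + y" "\<bar>c\<bar> \<le> x + 16 * y" "\<bar>e\<bar> \<le> x + 16 * y" for a b c e x y :: real
    using that unfolding abs_le_iff by auto
  ultimately have "\<bar>8 * (T r - T (- r)) - (T (2 * r) - T (- (2 * r)))\<bar> \<le> 18 * (C * r ^ n) + 48 * (M * r ^ n)"
    by blast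
  then have "\<bar>12 * (d 1 0 * r)\<bar> \<le> 18 * (C * r ^ n) + 48 * (M * r ^ n)"
    unfolding T12 .
  then have "12 * \<bar>d 1 0 * r\<bar> \<le> 18 * (C * r ^ n) + 48 * (M * r ^ n)"
    by (simp only: abs_mult abs_numeral)
  then have "\<bar>d 1 0\<bar> * r \<le> (2 * C + 4 * M) * r ^ n"
    using C0 r by (simp add: abs_mult algebra_simps)
  also have "r ^ n = r ^ (n - 1) * r" using n by (cases n) auto
  finally show ?thesis using r by (simp add: mult.assoc[symmetric])
qed

text \<open>With \<open>nhds 0\<close> in place of \<open>at 0\<close> the estimate includes the
  origin itself, so for \<open>n > 0\<close> it also says that the value there is 0.\<close>

abbreviation vanishing :: "nat \<Rightarrow> (real \<times> real \<Rightarrow> real) \<Rightarrow> bool" where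
  "vanishing n f \<equiv> f \<in> O[nhds 0](\<lambda>p. norm p ^ n)"

text \<open>Both sides of the estimate are continuous at the origin, so the inequality on a
  punctured neighborhood passes to the limit.\<close>

lemma vanishingI_at:
  assumes "isCont f 0" "f \<in> O[at 0](\<lambda>p. norm p ^ n)"
  shows "vanishing n f"
proof -
  obtain C where C: "\<forall>\<^sub>F p in at 0. norm (f p) \<le> C * norm (norm p ^ n)"
    using assms(2) by (auto elim: landau_o.bigE)
  have "((\<lambda>p. norm (f p)) \<longlongrightarrow> norm (f 0)) (at 0)"
    using assms(1) by (auto simp: isCont_def intro: tendsto_intros)
  moreover have "((\<lambda>p::real \<times> real. C * norm (norm p ^ n)) \<longlongrightarrow> C * norm (norm (0::real \<times> real) ^ n)) (at 0)"
    by (intro tendsto_intros)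
  ultimately have "norm (f 0) \<le> C * norm (norm (0::real \<times> real) ^ n)"
    using C by (intro tendsto_le[OF _ _ _ C]) auto
  then have "\<forall>\<^sub>F p in nhds 0. norm (f p) \<le> C * norm (norm p ^ n)"
    using C unfolding eventually_nhds_conv_at by blast
  then show ?thesis by (rule bigoI)
qed

lemma vanishing_mono: "vanishing n f \<Longrightarrow> m \<le> n \<Longrightarrow> vanishing m f"
proof (rule landau_o.big_trans, assumption)
  assume "m \<le> n"
  have "\<forall>\<^sub>F p::real \<times> real in nhds 0. norm p < 1"
    using eventually_nhds_ball[of 1 "0::real \<times> real"] by simp
  then have "\<forall>\<^sub>F p::real \<times> real in nhds 0. norm (norm p ^ n) \<le> 1 * norm (norm p ^ m)"
    by eventually_elim (use \<open>m \<le> n\<close> in \<open>auto intro: power_decreasing\<close>)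
  then show "vanishing m (\<lambda>p. norm p ^ n)" by (rule bigoI)
qed

lemma vanishing_mult: "vanishing m f \<Longrightarrow> vanishing n g \<Longrightarrow> vanishing (m + n) (\<lambda>p. f p * g p)"
  unfolding power_add by (rule landau_o.big.mult)

lemma vanishing_0: "isCont f 0 \<Longrightarrow> vanishing 0 f"
proof -
  assume "isCont f 0"
  then have "((\<lambda>p. \<bar>f p\<bar>) \<longlongrightarrow> \<bar>f 0\<bar>) (nhds 0)"
    by (auto simp: isCont_def tendsto_at_iff_tendsto_nhds intro: tendsto_intros)
  then have "\<forall>\<^sub>F p in nhds 0. \<bar>f p\<bar> < \<bar>f 0\<bar> + 1"
    by (rule order_tendstoD) simp
  then show "vanishing 0 f"
    by (intro bigoI[of _ "\<bar>f 0\<bar> + 1"]) (auto elim: eventually_mono)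
qed

text \<open>Here \<open>g m\<close> is the \<open>m\<close>-th derivative in the direction
  \<open>e\<close>. For \<open>n > 1\<close>, \<open>central_slope_bound\<close> is applied on the
  segment through \<open>p\<close> with \<open>r = norm p\<close>. For
  \<open>\<bar>t\<bar> \<le> 2 * norm p\<close> the points \<open>p + t e\<close> have norm at most
  \<open>3 * norm p\<close>, which explains the factor \<open>3 ^ n\<close> and the radius
  \<open>\<epsilon> / 3\<close>. For \<open>n = 1\<close> continuity is enough.\<close>

lemma vanishing_directional_derivative:
  fixes g :: "nat \<Rightarrow> real \<times> real \<Rightarrow> real"
  assumes n: "1 \<le> n" "n \<le> 4" and e: "norm e = 1" and \<delta>: "\<delta> > 0"
    and der: "\<And>m p. m < n \<Longrightarrow> norm p < \<delta> \<Longrightarrow> ((\<lambda>s. g m (p + s *\<^sub>R e)) has_real_derivative g (Suc m) p) (at 0)"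
    and cont: "isCont (g 1) 0" "isCont (g n) 0"
    and van: "vanishing n (g 0)"
  shows "vanishing (n - 1) (g 1)"
proof (cases "n = 1")
  case True
  then show ?thesis using vanishing_0[OF cont(1)] by simp
next
  case False
  then have n: "n \<in> {2, 3, 4}" using n by auto
  obtain C where C: "C > 0" "\<forall>\<^sub>F p in nhds 0. norm (g 0 p) \<le> C * norm (norm p ^ n)"
    using van by (auto elim: landau_o.bigE)
  obtain M where M: "M > 0" "\<forall>\<^sub>F p in nhds 0. norm (g n p) \<le> M * norm (norm p ^ 0)"
    using vanishing_0[OF cont(2)] by (auto elim: landau_o.bigE)
  have "\<forall>\<^sub>F p in nhds 0. norm (g 0 p) \<le> C * norm (norm p ^ n) \<and> norm (g n p) \<le> M * norm (norm p ^ 0) \<and> norm p < \<delta>"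
    using C M eventually_nhds_ball[OF \<delta>, of "0::real \<times> real"] by (intro eventually_conj) auto
  then obtain \<epsilon> where \<epsilon>: "\<epsilon> > 0" "\<And>p. norm p < \<epsilon> \<Longrightarrow> \<bar>g 0 p\<bar> \<le> C * norm p ^ n \<and> \<bar>g n p\<bar> \<le> M \<and> norm p < \<delta>"
    unfolding eventually_nhds_metric by auto
  have "\<bar>g 1 p\<bar> \<le> (2 * (C * 3 ^ n) + 4 * M) * norm p ^ (n - 1)" if p: "p \<noteq> 0" "norm p < \<epsilon> / 3" for p
  proof -
    define d where "d m t = g m (p + t *\<^sub>R e)" for m t
    have near: "norm (p + t *\<^sub>R e) \<le> 3 * norm p" if "\<bar>t\<bar> \<le> 2 * norm p" for t
      using norm_triangle_ineq[of p "t *\<^sub>R e"] that e by simp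
    have "\<bar>d 1 0\<bar> \<le> (2 * (C * 3 ^ n) + 4 * M) * norm p ^ (n - 1)"
    proof (rule central_slope_bound[OF n])
      show "norm p > 0" using p by simp
      fix t assume t: "\<bar>t\<bar> \<le> 2 * norm p"
      have lt: "norm (p + t *\<^sub>R e) < \<epsilon>" using near[OF t] p by simp
      have "\<bar>d 0 t\<bar> \<le> C * norm (p + t *\<^sub>R e) ^ n" unfolding d_def using \<epsilon>(2)[OF lt] by simp
      also have "\<dots> \<le> C * (3 * norm p) ^ n" using near[OF t] C by (intro mult_left_mono power_mono) auto
      finally show "\<bar>d 0 t\<bar> \<le> (C * 3 ^ n) * norm p ^ n" by (simp add: power_mult_distrib)
      show "\<bar>d n t\<bar> \<le> M" unfolding d_def using \<epsilon>(2)[OF lt] by simp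
      fix m assume m: "m < n"
      have "((\<lambda>s. g m ((p + t *\<^sub>R e) + s *\<^sub>R e)) has_real_derivative g (Suc m) (p + t *\<^sub>R e)) (at 0)"
        using der[OF m] \<epsilon>(2)[OF lt] by blast
      then show "(d m has_real_derivative d (Suc m) t) (at t)"
        using DERIV_shift[of "d m" "d (Suc m) t" 0 t] by (simp add: d_def algebra_simps)
    qed
    then show ?thesis by (simp add: d_def)
  qed
  then have "\<forall>\<^sub>F p in at 0. norm (g 1 p) \<le> (2 * (C * 3 ^ n) + 4 * M) * norm (norm p ^ (n - 1))"
    unfolding eventually_at using \<epsilon>(1) by (intro exI[of _ "\<epsilon> / 3"]) auto
  then have "g 1 \<in> O[at 0](\<lambda>p. norm p ^ (n - 1))" by (rule bigoI)
  then show ?thesis by (rule vanishingI_at[OF cont(1)])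
qed

lemma smooth_on_isCont: "smooth_on U f \<Longrightarrow> open U \<Longrightarrow> p \<in> U \<Longrightarrow> isCont f p"
  using smooth_on_continuous_on continuous_on_eq_continuous_at by blast

text \<open>A partial derivative is a directional derivative along an axis, so only the pure
  iterates of \<open>pd_u\<close>, or of \<open>pd_v\<close>, enter; mixed derivatives are reached
  by applying the lemma again.\<close>

lemma vanishing_pd:
  assumes W: "open W" "0 \<in> W" and f: "smooth_on W f"
    and n: "1 \<le> n" "n \<le> 4" and van: "vanishing n f"
  shows "vanishing (n - 1) (pd_u f)" "vanishing (n - 1) (pd_v f)"
proof -
  obtain \<delta> where \<delta>: "\<delta> > 0" "\<And>p. norm p < \<delta> \<Longrightarrow> p \<in> W"
    using W unfolding open_dist by (metis dist_0_norm dist_commute)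
  have su: "smooth_on W ((pd_u ^^ m) f)" for m by (induction m) (auto intro: f smooth_on_pd)
  have sv: "smooth_on W ((pd_v ^^ m) f)" for m by (induction m) (auto intro: f smooth_on_pd)
  have "vanishing (n - 1) ((pd_u ^^ 1) f)"
  proof (rule vanishing_directional_derivative[OF n _ \<delta>(1), of "(1, 0)"])
    fix m and p :: "real \<times> real" assume "norm p < \<delta>"
    then have "((pd_u ^^ m) f) differentiable (at (fst p, snd p))"
      using smooth_on_differentiable_at[OF su W(1)] \<delta>(2) by auto
    from has_real_pd(1)[OF this] 
    show "((\<lambda>s. (pd_u ^^ m) f (p + s *\<^sub>R (1, 0))) has_real_derivative (pd_u ^^ Suc m) f p) (at 0)"
      using DERIV_shift[of "\<lambda>s. (pd_u ^^ m) f (s, snd p)" "pd_u ((pd_u ^^ m) f) p" 0 "fst p"]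
      by (simp add: plus_prod_def add.commute)
  qed (use smooth_on_isCont[OF su W, of 1] smooth_on_isCont[OF su W] van in auto)
  then show "vanishing (n - 1) (pd_u f)" by simp
  have "vanishing (n - 1) ((pd_v ^^ 1) f)"
  proof (rule vanishing_directional_derivative[OF n _ \<delta>(1), of "(0, 1)"])
    fix m and p :: "real \<times> real" assume "norm p < \<delta>"
    then have "((pd_v ^^ m) f) differentiable (at (fst p, snd p))"
      using smooth_on_differentiable_at[OF sv W(1)] \<delta>(2) by auto
    from has_real_pd(2)[OF this] 
    show "((\<lambda>s. (pd_v ^^ m) f (p + s *\<^sub>R (0, 1))) has_real_derivative (pd_v ^^ Suc m) f p) (at 0)"
      using DERIV_shift[of "\<lambda>s. (pd_v ^^ m) f (fst p, s)" "pd_v ((pd_v ^^ m) f) p" 0 "snd p"]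
      by (simp add: plus_prod_def add.commute)
  qed (use smooth_on_isCont[OF sv W, of 1] smooth_on_isCont[OF sv W] van in auto)
  then show "vanishing (n - 1) (pd_v f)" by simp
qed

section \<open>Functions with a prescribed leading part\<close>

text \<open>Only sizes are compared: \<open>f0\<close> may vanish to higher order than
  \<open>n\<close> or be identically 0, as happens for the mixed coefficient in the radial frame.
  This keeps the notion stable under sums in which leading terms cancel.\<close>

definition leading :: "nat \<Rightarrow> (real \<times> real \<Rightarrow> real) \<Rightarrow> (real \<times> real \<Rightarrow> real) \<Rightarrow> bool" where
  "leading n f f0 \<longleftrightarrow> vanishing n f0 \<and> vanishing (Suc n) (\<lambda>p. f p - f0 p)"

named_theorems leading_intros

lemma leading_add [leading_intros]:
  "leading n f f0 \<Longrightarrow> leading n g g0 \<Longrightarrow> leading n (\<lambda>p. f p + g p) (\<lambda>p. f0 p + g0 p)"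
  unfolding leading_def by (auto simp: add_diff_add intro: sum_in_bigo)

lemma leading_mult [leading_intros]:
  assumes "leading m f f0" "leading n g g0"
  shows "leading (m + n) (\<lambda>p. f p * g p) (\<lambda>p. f0 p * g0 p)"
proof -
  have f: "vanishing m f0" "vanishing (Suc m) (\<lambda>p. f p - f0 p)"
    and g: "vanishing n g0" "vanishing (Suc n) (\<lambda>p. g p - g0 p)"
    using assms by (auto simp: leading_def)
  have "vanishing n (\<lambda>p. (g p - g0 p) + g0 p)"
    by (rule sum_in_bigo(1)[OF vanishing_mono[OF g(2)] g(1)]) simp
  then have "vanishing (Suc m + n) (\<lambda>p. (f p - f0 p) * g p)"
    using vanishing_mult[OF f(2)] by simp
  moreover have "vanishing (m + Suc n) (\<lambda>p. f0 p * (g p - g0 p))"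
    using vanishing_mult[OF f(1) g(2)] .
  ultimately have "vanishing (Suc (m + n)) (\<lambda>p. (f p - f0 p) * g p + f0 p * (g p - g0 p))"
    by (intro sum_in_bigo) auto
  moreover have "(\<lambda>p. (f p - f0 p) * g p + f0 p * (g p - g0 p)) = (\<lambda>p. f p * g p - f0 p * g0 p)"
    by (auto simp: algebra_simps)
  ultimately show ?thesis
    using vanishing_mult[OF f(1) g(1)] by (simp add: leading_def)
qed

lemma leading_const [leading_intros]: "leading 0 (\<lambda>p. c) (\<lambda>p. c)"
  by (auto simp: leading_def intro: vanishing_0)

lemma leading_fst [leading_intros]: "leading 1 fst fst"
  and leading_snd [leading_intros]: "leading 1 snd snd"
proof -
  have "\<bar>fst p\<bar> \<le> norm p" "\<bar>snd p\<bar> \<le> norm p" for p :: "real \<times> real"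
    using norm_fst_le[of "fst p" "snd p"] norm_snd_le[of "snd p" "fst p"] by simp_all
  then show "leading 1 fst fst" "leading 1 snd snd"
    by (auto simp: leading_def intro!: bigoI[of _ 1] always_eventually)
qed

lemma leading_cmult [leading_intros]: "leading n f f0 \<Longrightarrow> leading n (\<lambda>p. c * f p) (\<lambda>p. c * f0 p)"
  using leading_mult[OF leading_const, of n f f0 c] by simp

lemma leading_diff [leading_intros]:
  "leading n f f0 \<Longrightarrow> leading n g g0 \<Longrightarrow> leading n (\<lambda>p. f p - g p) (\<lambda>p. f0 p - g0 p)"
  using leading_add[OF _ leading_cmult, of n f f0 g g0 "-1"] by simp

lemma leading_cong: "leading n f f0 \<Longrightarrow> f0 = f1 \<Longrightarrow> leading n f f1"
  by simp

text \<open>The remainder \<open>f - f0\<close> has order \<open>Suc n\<close>, so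
  \<open>n \<le> 3\<close> is the range in which \<open>vanishing_pd\<close> applies to it. The
  cubic part of \<open>h\<close> is the extreme case.\<close>

lemma leading_pd:
  assumes W: "open W" "0 \<in> W" and f: "smooth_on W f" "smooth_on W f0"
    and n: "1 \<le> n" "n \<le> 3" and l: "leading n f f0"
  shows "leading (n - 1) (pd_u f) (pd_u f0)" "leading (n - 1) (pd_v f) (pd_v f0)"
proof -
  have s: "smooth_on W (\<lambda>p. f p - f0 p)" using W f by (intro smooth_intros)
  have e: "eventually (\<lambda>p. p \<in> W) (nhds 0)" using W by (rule eventually_nhds_in_open)
  have eq: "\<And>p. p \<in> W \<Longrightarrow> pd_u (\<lambda>p. f p - f0 p) p = pd_u f p - pd_u f0 p"
     "\<And>p. p \<in> W \<Longrightarrow> pd_v (\<lambda>p. f p - f0 p) p = pd_v f p - pd_v f0 p"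
    using pd_diff smooth_on_differentiable_at[OF _ W(1)] f by blast+
  have "vanishing (Suc n - 1) (pd_u (\<lambda>p. f p - f0 p))" "vanishing (Suc n - 1) (pd_v (\<lambda>p. f p - f0 p))"
    using vanishing_pd[OF W s, of "Suc n"] n l unfolding leading_def by (simp_all del: power_Suc)
  then have "vanishing (Suc n - 1) (\<lambda>p. pd_u f p - pd_u f0 p)" "vanishing (Suc n - 1) (\<lambda>p. pd_v f p - pd_v f0 p)"
    using landau_o.big.in_cong[OF eventually_mono[OF e eq(1)]] landau_o.big.in_cong[OF eventually_mono[OF e eq(2)]] by auto
  then show "leading (n - 1) (pd_u f) (pd_u f0)" "leading (n - 1) (pd_v f) (pd_v f0)"
    using vanishing_pd[OF W f(2), of n] n l by (auto simp: leading_def)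
qed

section \<open>Polynomial expressions for the extended coefficients and their leading parts\<close>

text \<open>Since \<open>\<langle>\<nu>\<^sub>i, \<xi>\<rangle> = 0\<close>, the coefficient \<open>\<langle>\<nu>\<^sub>i, \<xi>\<^sub>j\<rangle>\<close> equals \<open>- \<langle>\<nu>\<^sub>i\<^sub>j, \<xi>\<rangle>\<close>, which involves only one
  more derivative of the co-normal and no derivative of \<open>\<xi>\<close>. Multiplied by \<open>16 D\<^sup>2\<close> it becomes the
  polynomial below, where \<open>(x, y) = (h\<^sub>u\<^sub>i\<^sub>j, h\<^sub>v\<^sub>i\<^sub>j)\<close>.\<close>

definition affine_poly ::
  "(real \<times> real \<Rightarrow> real) \<Rightarrow> (real \<times> real \<Rightarrow> real) \<Rightarrow> (real \<times> real \<Rightarrow> real) \<Rightarrow> (real \<times> real \<Rightarrow> real) \<Rightarrow>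
   (real \<times> real \<Rightarrow> real) \<Rightarrow> (real \<times> real \<Rightarrow> real) \<Rightarrow> real \<times> real \<Rightarrow> real" where
  "affine_poly h Dij Di Dj x y p =
     4 * (hess_det h p * Dij p) - 3 * (Di p * Dj p)
     - 4 * ((x p * pd_v (pd_v h) p - y p * pd_v (pd_u h) p) * pd_u (hess_det h) p
       + (y p * pd_u (pd_u h) p - x p * pd_v (pd_u h) p) * pd_v (hess_det h) p)"

text \<open>In this and the next two definitions the innermost mixed derivative of \<open>h\<close>
  is always written \<open>pd_v (pd_u h)\<close>; \<open>pd_commute\<close> brings the other order
  to this form.\<close>

definition poly_A :: "(real \<times> real \<Rightarrow> real) \<Rightarrow> real \<times> real \<Rightarrow> real" where
  "poly_A h = affine_poly h (pd_u (pd_u (hess_det h))) (pd_u (hess_det h)) (pd_u (hess_det h))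
     (pd_u (pd_u (pd_u h))) (pd_u (pd_v (pd_u h)))"

definition poly_B :: "(real \<times> real \<Rightarrow> real) \<Rightarrow> real \<times> real \<Rightarrow> real" where
  "poly_B h = affine_poly h (pd_v (pd_u (hess_det h))) (pd_u (hess_det h)) (pd_v (hess_det h))
     (pd_v (pd_u (pd_u h))) (pd_v (pd_v (pd_u h)))"

definition poly_C :: "(real \<times> real \<Rightarrow> real) \<Rightarrow> real \<times> real \<Rightarrow> real" where
  "poly_C h = affine_poly h (pd_v (pd_v (hess_det h))) (pd_v (hess_det h)) (pd_v (hess_det h))
     (pd_v (pd_v (pd_u h))) (pd_v (pd_v (pd_v h)))"

lemma smooth_on_hess_det:
  assumes "open W" "smooth_on W h"
  shows "smooth_on W (hess_det h)"
  unfolding hess_det_def[abs_def] using assms by (intro smooth_intros smooth_on_pd)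

lemma smooth_on_affine_polys:
  assumes "open W" "smooth_on W h"
  shows "smooth_on W (poly_A h)" "smooth_on W (poly_B h)" "smooth_on W (poly_C h)"
  unfolding poly_A_def poly_B_def poly_C_def affine_poly_def[abs_def]
  by (intro smooth_intros smooth_on_pd smooth_on_hess_det assms)+

text \<open>Leading parts propagate from \<open>h\<close> to its derivatives up to order three and
  then to \<open>D = hess_det h\<close>. The derivatives of \<open>D\<close> are read off from the
  leading part \<open>- 36 (u^2 + v^2)\<close> of \<open>D\<close> itself, so the fourth derivatives
  of \<open>h\<close> inside them are never expanded. The constant 5184 is \<open>72^2\<close>,
  where \<open>- 72 u\<close> and \<open>- 72 v\<close> are the leading parts of the first
  derivatives of \<open>D\<close>.\<close>

lemma leading_affine_polys:
  assumes W: "open W" "0 \<in> W" and h: "smooth_on W h"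
    and cubic: "leading 3 h (\<lambda>p. fst p ^ 3 - 3 * fst p * snd p ^ 2)"
  shows "leading 2 (hess_det h) (\<lambda>p. - 36 * (fst p ^ 2 + snd p ^ 2))"
    and "leading 2 (poly_A h) (\<lambda>p. 5184 * (- 3 * fst p ^ 2 + 4 * snd p ^ 2))"
    and "leading 2 (poly_B h) (\<lambda>p. 5184 * (- 7 * fst p * snd p))"
    and "leading 2 (poly_C h) (\<lambda>p. 5184 * (4 * fst p ^ 2 - 3 * snd p ^ 2))"
proof -
  let ?u = "fst :: real \<times> real \<Rightarrow> real" and ?v = "snd :: real \<times> real \<Rightarrow> real"
  note pds = ext pd_u_real_eqI pd_v_real_eqI derivative_eq_intros
  have c: "pd_u (\<lambda>p. ?u p ^ 3 - 3 * ?u p * ?v p ^ 2) = (\<lambda>p. 3 * ?u p ^ 2 - 3 * ?v p ^ 2)"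
    "pd_v (\<lambda>p. ?u p ^ 3 - 3 * ?u p * ?v p ^ 2) = (\<lambda>p. - 6 * ?u p * ?v p)"
    "pd_u (\<lambda>p. 3 * ?u p ^ 2 - 3 * ?v p ^ 2) = (\<lambda>p. 6 * ?u p)"
    "pd_v (\<lambda>p. 3 * ?u p ^ 2 - 3 * ?v p ^ 2) = (\<lambda>p. - 6 * ?v p)"
    "pd_v (\<lambda>p. - 6 * ?u p * ?v p) = (\<lambda>p. - 6 * ?u p)"
    "pd_u (\<lambda>p. 6 * ?u p) = (\<lambda>p. 6)"
    "pd_v (\<lambda>p. 6 * ?u p) = (\<lambda>p. 0)"
    "pd_u (\<lambda>p. - 6 * ?v p) = (\<lambda>p. 0)"
    "pd_v (\<lambda>p. - 6 * ?v p) = (\<lambda>p. - 6)"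
    "pd_v (\<lambda>p. - 6 * ?u p) = (\<lambda>p. 0)"
    "pd_u (\<lambda>p. - 36 * (?u p ^ 2 + ?v p ^ 2)) = (\<lambda>p. - 72 * ?u p)"
    "pd_v (\<lambda>p. - 36 * (?u p ^ 2 + ?v p ^ 2)) = (\<lambda>p. - 72 * ?v p)"
    "pd_u (\<lambda>p. - 72 * ?u p) = (\<lambda>p. - 72)"
    "pd_v (\<lambda>p. - 72 * ?u p) = (\<lambda>p. 0)"
    "pd_v (\<lambda>p. - 72 * ?v p) = (\<lambda>p. - 72)"
    by (auto intro!: pds)
  note sm = W(1) smooth_intros smooth_on_pd h smooth_on_hess_det
  note sD = smooth_on_hess_det[OF W(1) h]
  have sp: "smooth_on W (\<lambda>p. ?u p ^ 3 - 3 * ?u p * ?v p ^ 2)" "smooth_on W (\<lambda>p. 3 * ?u p ^ 2 - 3 * ?v p ^ 2)"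
    "smooth_on W (\<lambda>p. a * ?u p * ?v p)" "smooth_on W (\<lambda>p. a * ?u p)" "smooth_on W (\<lambda>p. a * ?v p)"
    "smooth_on W (\<lambda>p. a * (?u p ^ 2 + ?v p ^ 2))" for a by (intro sm)+
  have l1: "leading 2 (pd_u h) (\<lambda>p. 3 * ?u p ^ 2 - 3 * ?v p ^ 2)"
    "leading 2 (pd_v h) (\<lambda>p. - 6 * ?u p * ?v p)"
    using leading_pd[OF W h sp(1) _ _ cubic] unfolding c by simp_all
  have l2: "leading 1 (pd_u (pd_u h)) (\<lambda>p. 6 * ?u p)" "leading 1 (pd_v (pd_u h)) (\<lambda>p. - 6 * ?v p)"
    using leading_pd[OF W _ _ _ _ l1(1), OF smooth_on_pd(1)[OF h] sp(2)] unfolding c by simp_all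
  have l2': "leading 1 (pd_v (pd_v h)) (\<lambda>p. - 6 * ?u p)"
    using leading_pd[OF W _ _ _ _ l1(2), OF smooth_on_pd(2)[OF h] sp(3)] unfolding c by simp_all
  have l3: "leading 0 (pd_u (pd_u (pd_u h))) (\<lambda>p. 6)" "leading 0 (pd_v (pd_u (pd_u h))) (\<lambda>p. 0)"
    using leading_pd[OF W _ _ _ _ l2(1), OF smooth_on_pd(1)[OF smooth_on_pd(1)[OF h]] sp(4)] unfolding c by simp_all
  have l3': "leading 0 (pd_u (pd_v (pd_u h))) (\<lambda>p. 0)" "leading 0 (pd_v (pd_v (pd_u h))) (\<lambda>p. - 6)"
    using leading_pd[OF W _ _ _ _ l2(2), OF smooth_on_pd(2)[OF smooth_on_pd(1)[OF h]] sp(5)] unfolding c by simp_all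
  have l3'': "leading 0 (pd_v (pd_v (pd_v h))) (\<lambda>p. 0)"
    using leading_pd[OF W _ _ _ _ l2', OF smooth_on_pd(2)[OF smooth_on_pd(2)[OF h]] sp(4)] unfolding c by simp_all
  have "leading (1 + 1) (hess_det h) (\<lambda>p. 6 * ?u p * (- 6 * ?u p) - (- 6 * ?v p) * (- 6 * ?v p))"
    unfolding hess_det_def[abs_def] power2_eq_square by (intro leading_intros l2 l2')
  then show d: "leading 2 (hess_det h) (\<lambda>p. - 36 * (?u p ^ 2 + ?v p ^ 2))"
    unfolding one_add_one by (rule leading_cong) (auto simp: power2_eq_square algebra_simps)
  have d1: "leading 1 (pd_u (hess_det h)) (\<lambda>p. - 72 * ?u p)" "leading 1 (pd_v (hess_det h)) (\<lambda>p. - 72 * ?v p)"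
    using leading_pd[OF W _ _ _ _ d, OF sD sp(6)] unfolding c by simp_all
  have d2: "leading 0 (pd_u (pd_u (hess_det h))) (\<lambda>p. - 72)" "leading 0 (pd_v (pd_u (hess_det h))) (\<lambda>p. 0)"
    using leading_pd[OF W _ _ _ _ d1(1), OF smooth_on_pd(1)[OF sD] sp(4)] unfolding c by simp_all
  have d2': "leading 0 (pd_v (pd_v (hess_det h))) (\<lambda>p. - 72)"
    using leading_pd[OF W _ _ _ _ d1(2), OF smooth_on_pd(2)[OF sD] sp(5)] unfolding c by simp_all
  have *: "leading 2 (affine_poly h Dij Di Dj x y) (\<lambda>p. 4 * ((- 36 * (?u p ^ 2 + ?v p ^ 2)) * dij) - 3 * (di p * dj p)
     - 4 * ((x0 * (- 6 * ?u p) - y0 * (- 6 * ?v p)) * (- 72 * ?u p)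
       + (y0 * (6 * ?u p) - x0 * (- 6 * ?v p)) * (- 72 * ?v p)))"
    if "leading 0 Dij (\<lambda>p. dij)" "leading 1 Di di" "leading 1 Dj dj" "leading 0 x (\<lambda>p. x0)" "leading 0 y (\<lambda>p. y0)" for Dij Di Dj x y dij di dj x0 y0
  proof -
    have 1: "leading 1 (\<lambda>p. f p * g p) (\<lambda>p. c * g0 p)" if "leading 0 f (\<lambda>p. c)" "leading 1 g g0" for f g g0 c
      using leading_mult[OF that] by simp
    have 2: "leading 2 (\<lambda>p. f p * g p) (\<lambda>p. f0 p * g0 p)" if "leading 1 f f0" "leading 1 g g0" for f g f0 g0
      using leading_mult[OF that] unfolding one_add_one .
    have 3: "leading 2 (\<lambda>p. f p * g p) (\<lambda>p. f0 p * c)" if "leading 2 f f0" "leading 0 g (\<lambda>p. c)" for f g f0 c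
      using leading_mult[OF that] by simp
    show ?thesis unfolding affine_poly_def[abs_def]
      by (intro leading_diff leading_add leading_cmult 1 2 3 that l2 l2' d d1)
  qed
  show "leading 2 (poly_A h) (\<lambda>p. 5184 * (- 3 * fst p ^ 2 + 4 * snd p ^ 2))"
    unfolding poly_A_def by (rule leading_cong[OF *[OF d2(1) d1(1) d1(1) l3(1) l3'(1)]]) (auto simp: power2_eq_square algebra_simps)
  show "leading 2 (poly_B h) (\<lambda>p. 5184 * (- 7 * fst p * snd p))"
    unfolding poly_B_def by (rule leading_cong[OF *[OF d2(2) d1(1) d1(2) l3(2) l3'(2)]]) (auto simp: power2_eq_square algebra_simps)
  show "leading 2 (poly_C h) (\<lambda>p. 5184 * (4 * fst p ^ 2 - 3 * snd p ^ 2))"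
    unfolding poly_C_def by (rule leading_cong[OF *[OF d2' d1(2) d1(2) l3'(2) l3'']]) (auto simp: power2_eq_square algebra_simps)
qed

section \<open>The affine second fundamental form\<close>

lemma vector_3_axis: "(vector [a, b, c] :: real ^ 3) = a *\<^sub>R axis 1 1 + b *\<^sub>R axis 2 1 + c *\<^sub>R axis 3 1"
  by (simp add: vec_eq_iff forall_3 vector_3 axis_def)

lemma inner_vector_3: "(vector [a, b, c] :: real ^ 3) \<bullet> vector [a', b', c'] = a * a' + b * b' + c * c'"
  by (simp add: inner_vec_def sum_3)

lemma has_vector_derivative_vector_3:
  assumes "(f has_real_derivative f') F" "(g has_real_derivative g') F" "(k has_real_derivative k') F"
  shows "((\<lambda>s. vector [f s, g s, k s] :: real ^ 3) has_vector_derivative vector [f', g', k']) F"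
  unfolding vector_3_axis
  by (intro has_vector_derivative_add bounded_linear.has_vector_derivative[OF bounded_linear_scaleR_left]
      assms[unfolded has_real_derivative_iff_has_vector_derivative])

lemma pd_vector_3:
  fixes f g k :: "real \<times> real \<Rightarrow> real"
  assumes "f differentiable (at p)" "g differentiable (at p)" "k differentiable (at p)"
  shows "pd_u (\<lambda>q. vector [f q, g q, k q] :: real ^ 3) p = vector [pd_u f p, pd_u g p, pd_u k p]"
    and "pd_v (\<lambda>q. vector [f q, g q, k q] :: real ^ 3) p = vector [pd_v f p, pd_v g p, pd_v k p]"
  using has_real_pd[of f "fst p" "snd p"] has_real_pd[of g "fst p" "snd p"] has_real_pd[of k "fst p" "snd p"] assms
  by (auto intro!: pd_u_eqI pd_v_eqI has_vector_derivative_vector_3)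

lemma cross_graph_param:
  assumes "h differentiable (at p)"
  shows "cross3 (pd_u (graph_param h) p) (pd_v (graph_param h) p) = vector [- pd_u h p, - pd_v h p, 1]"
proof -
  have d: "fst differentiable (at p)" "snd differentiable (at p)" for p :: "real \<times> real"
    using smooth_on_differentiable_at[OF smooth_on_fst, of UNIV p] smooth_on_differentiable_at[OF smooth_on_snd, of UNIV p] by auto
  have "pd_u fst = (\<lambda>p. 1::real)" "pd_v fst = (\<lambda>p. 0::real)" "pd_u snd = (\<lambda>p. 0::real)" "pd_v snd = (\<lambda>p. 1::real)"
    by (auto intro!: ext pd_u_eqI pd_v_eqI derivative_eq_intros)
  then have "pd_u (graph_param h) p = vector [1, 0, pd_u h p]" "pd_v (graph_param h) p = vector [0, 1, pd_v h p]"
    unfolding graph_param_def[abs_def] pd_vector_3[OF d assms] by simp_all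
  then show ?thesis by (simp add: cross3_def)
qed

lemma pd_minus:
  fixes f :: "real \<times> real \<Rightarrow> real"
  assumes "f differentiable (at p)"
  shows "pd_u (\<lambda>q. - f q) p = - pd_u f p" "pd_v (\<lambda>q. - f q) p = - pd_v f p"
  using has_real_pd[of f "fst p" "snd p"] assms
  by (auto intro!: pd_u_real_eqI pd_v_real_eqI derivative_eq_intros)

text \<open>Here \<open>F\<close> stands for \<open>(- D) powr (- 1 / 4)\<close>, known only through
  \<open>4 D F_i = - D_i F\<close> and the derivative of this relation, which makes the claim a
  matter of field arithmetic. One gets \<open>F_i / F = - D_i / (4 D)\<close> and
  \<open>F_ij / F = 5 D_i D_j / (16 D^2) - D_ij / (4 D)\<close>, so \<open>F\<close> cancels. The
  coefficient \<open>- 3\<close> arises as \<open>2 - 5\<close>.\<close>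

lemma affine_coefficient_algebra:
  fixes F D :: real
  assumes nz: "F \<noteq> 0" "D \<noteq> 0"
    and X: "X1 = (hvv * Fu - huv * Fv) / (D * F\<^sup>2)" "X2 = (huu * Fv - huv * Fu) / (D * F\<^sup>2)"
    and Fuv: "4 * (D * Fu) = - (Du * F)" "4 * (D * Fv) = - (Dv * F)"
    and Fi: "4 * (D * Fi) = - (Di * F)" and Fj: "4 * (D * Fj) = - (Dj * F)"
    and Fij: "4 * (Dj * Fi + D * Fij) = - (Dij * F + Di * Fj)"
  shows "16 * D\<^sup>2 * (2 * Fi * Fj / F\<^sup>2 + F * (x * X1 + y * X2) - Fij / F) =
    4 * (D * Dij) - 3 * (Di * Dj) - 4 * ((x * hvv - y * huv) * Du + (y * huu - x * huv) * Dv)"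
proof -
  have e: "Fu = - (Du * F) / (4 * D)" "Fv = - (Dv * F) / (4 * D)" "Fi = - (Di * F) / (4 * D)" "Fj = - (Dj * F) / (4 * D)"
    using Fuv Fi Fj nz by (auto simp: field_simps)
  have "Fij = (- (Dij * F + Di * Fj) / 4 - Dj * Fi) / D"
    using Fij nz by (auto simp: field_simps)
  also have "\<dots> = F * (5 * Di * Dj / (16 * D\<^sup>2) - Dij / (4 * D))"
    unfolding e using nz by (simp add: field_simps power2_eq_square)
  finally have 1: "Fij / F = 5 * Di * Dj / (16 * D\<^sup>2) - Dij / (4 * D)" using nz by simp
  have 2: "F * X1 = - (hvv * Du - huv * Dv) / (4 * D\<^sup>2)" "F * X2 = - (huu * Dv - huv * Du) / (4 * D\<^sup>2)"
    unfolding X e using nz by (simp_all add: field_simps power2_eq_square)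
  have 3: "Fi * Fj / F\<^sup>2 = Di * Dj / (16 * D\<^sup>2)"
    unfolding e using nz by (simp add: field_simps power2_eq_square)
  have "2 * Fi * Fj / F\<^sup>2 + F * (x * X1 + y * X2) - Fij / F = 2 * (Fi * Fj / F\<^sup>2) + x * (F * X1) + y * (F * X2) - Fij / F"
    by (simp add: algebra_simps)
  also have "16 * D\<^sup>2 * \<dots> = 4 * (D * Dij) - 3 * (Di * Dj) - 4 * ((x * hvv - y * huv) * Du + (y * huu - x * huv) * Dv)"
    unfolding 1 2 3 using nz by (simp add: field_simps power2_eq_square)
  finally show ?thesis .
qed

text \<open>Since \<open>D < 0\<close>, the co-normal is \<open>F (- h_u, - h_v, 1)\<close> with
  \<open>F = (- D) powr (- 1 / 4)\<close> smooth. The affine normal then solves an explicit linear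
  system, and differentiating its orthogonality relations replaces
  \<open>\<langle>\<nu>_i, \<xi>_j\<rangle>\<close> by minus
  \<open>\<langle>\<nu>_ij, \<xi>\<rangle>\<close>.\<close>

lemma affine_coefficients:
  fixes h :: "real \<times> real \<Rightarrow> real"
  assumes \<Omega>: "open \<Omega>" and h: "smooth_on \<Omega> h" and neg: "\<And>q. q \<in> \<Omega> \<Longrightarrow> hess_det h q < 0" and p: "p \<in> \<Omega>"
  shows "16 * (hess_det h p)\<^sup>2 * aff_l h p = poly_A h p"
    and "16 * (hess_det h p)\<^sup>2 * aff_m h p = poly_B h p"
    and "16 * (hess_det h p)\<^sup>2 * aff_n h p = poly_C h p"
proof -
  define D where "D = hess_det h"
  define F where "F = (\<lambda>q. (- D q) powr (- 1 / 4))"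
  define n1 where "n1 = (\<lambda>q. - (F q * pd_u h q))"
  define n2 where "n2 = (\<lambda>q. - (F q * pd_v h q))"
  \<comment> \<open>The orthogonality conditions reduce to the system with the Hessian matrix of
    \<open>h\<close>, unknowns \<open>(X1, X2)\<close> and right-hand side
    \<open>(F_u, F_v) / F^2\<close>. \<open>X1\<close> and \<open>X2\<close> come from Cramer's
    rule, and \<open>X3\<close> from the normalization
    \<open>\<langle>\<nu>, \<xi>\<rangle> = 1\<close>.\<close>
  define X1 where "X1 = (\<lambda>q. (pd_v (pd_v h) q * pd_u F q - pd_v (pd_u h) q * pd_v F q) / (D q * (F q)\<^sup>2))"
  define X2 where "X2 = (\<lambda>q. (pd_u (pd_u h) q * pd_v F q - pd_v (pd_u h) q * pd_u F q) / (D q * (F q)\<^sup>2))"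
  define X3 where "X3 = (\<lambda>q. 1 / F q + pd_u h q * X1 q + pd_v h q * X2 q)"
  note neg = neg[folded D_def]
  have Fpos: "F q > 0" if "q \<in> \<Omega>" for q using neg[OF that] by (simp add: F_def)
  have smD: "smooth_on \<Omega> D" unfolding D_def by (rule smooth_on_hess_det[OF \<Omega> h])
  have smF: "smooth_on \<Omega> F" unfolding F_def using neg by (intro smooth_intros \<Omega> smD) auto
  have nz: "D q * (F q)\<^sup>2 \<noteq> 0" "F q \<noteq> 0" "D q \<noteq> 0" if "q \<in> \<Omega>" for q
    using neg[OF that] Fpos[OF that] by auto
  have smn: "smooth_on \<Omega> n1" "smooth_on \<Omega> n2"
    unfolding n1_def n2_def by (intro smooth_intros smooth_on_pd \<Omega> smF h)+
  have smX: "smooth_on \<Omega> X1" "smooth_on \<Omega> X2"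
    unfolding X1_def X2_def by (intro smooth_intros smooth_on_pd \<Omega> smF smD h nz; assumption)+
  have smX3: "smooth_on \<Omega> X3"
    unfolding X3_def by (intro smooth_intros smooth_on_pd \<Omega> smF h smX nz; assumption)
  note sm = smD smF smn smX smX3 h
  note diff = smooth_on_differentiable_at[OF _ \<Omega>]
  \<comment> \<open>With both differentiation operators in one set, the coefficients
    \<open>l\<close>, \<open>m\<close>, \<open>n\<close> become instances of a single computation
    with \<open>i, j \<in> PD\<close>.\<close>
  define PD where "PD = {pd_u, pd_v :: (real \<times> real \<Rightarrow> real) \<Rightarrow> real \<times> real \<Rightarrow> real}"
  have u: "pd_u \<in> PD" "pd_v \<in> PD" by (auto simp: PD_def)
  have smPD: "smooth_on \<Omega> (d f)" if "d \<in> PD" "smooth_on \<Omega> f" for d f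
    using that by (auto simp: PD_def smooth_on_pd)
  have Dmult: "d (\<lambda>q. f q * g q) q = d f q * g q + f q * d g q"
    if "d \<in> PD" "q \<in> \<Omega>" "smooth_on \<Omega> f" "smooth_on \<Omega> g" for d f g q
    using that(1) pd_mult[OF diff[OF that(3,2)] diff[OF that(4,2)]] by (auto simp: PD_def)
  have Dadd: "d (\<lambda>q. f q + g q) q = d f q + d g q"
    if "d \<in> PD" "q \<in> \<Omega>" "smooth_on \<Omega> f" "smooth_on \<Omega> g" for d f g q
    using that(1) pd_add[OF diff[OF that(3,2)] diff[OF that(4,2)]] by (auto simp: PD_def)
  have Dminus: "d (\<lambda>q. - f q) q = - d f q"
    if "d \<in> PD" "q \<in> \<Omega>" "smooth_on \<Omega> f" for d f q
    using that(1) pd_minus[OF diff[OF that(3,2)]] by (auto simp: PD_def)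
  have Dcmult: "d (\<lambda>q. c * f q) q = c * d f q"
    if "d \<in> PD" "q \<in> \<Omega>" "smooth_on \<Omega> f" for d f q c
  proof -
    have "d (\<lambda>q. c) q = 0" using that by (auto simp: PD_def intro!: pd_u_eqI pd_v_eqI)
    then show ?thesis using Dmult[OF that(1,2) smooth_on_const that(3)] by simp
  qed
  have Dcong: "d f q = d g q" if "d \<in> PD" "q \<in> \<Omega>" "\<And>q. q \<in> \<Omega> \<Longrightarrow> f q = g q" for d f g q
    using that pd_cong[OF \<Omega> that(2), of f g] by (auto simp: PD_def)
  have comm: "pd_u (pd_v h) q = pd_v (pd_u h) q" if "q \<in> \<Omega>" for q
    by (rule pd_commute[OF \<Omega> that h])
  have N: "conormal h q = vector [n1 q, n2 q, F q]" if "q \<in> \<Omega>" for q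
  proof -
    have "\<bar>hess_det h q\<bar> = - D q" using neg[OF that] by (simp add: D_def)
    then show ?thesis
      unfolding conormal_def cross_graph_param[OF diff[OF h that]]
      by (simp add: vec_eq_iff forall_3 n1_def n2_def F_def)
  qed
  have Nd: "pd_u (conormal h) q = vector [pd_u n1 q, pd_u n2 q, pd_u F q]"
    "pd_v (conormal h) q = vector [pd_v n1 q, pd_v n2 q, pd_v F q]" if "q \<in> \<Omega>" for q
    using pd_cong[OF \<Omega> that, of "conormal h", OF N]
      pd_vector_3[OF diff[OF smn(1) that] diff[OF smn(2) that] diff[OF smF that]] by auto
  have nd: "d n1 q = - (d F q * pd_u h q + F q * d (pd_u h) q)"
    "d n2 q = - (d F q * pd_v h q + F q * d (pd_v h) q)" if "d \<in> PD" "q \<in> \<Omega>" for d q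
    unfolding n1_def n2_def using that
    by (simp_all add: Dminus[OF that] Dmult[OF that] sm \<Omega> smooth_on_mult smooth_on_pd)
  have lin: "d (pd_u h) q * X1 q + d (pd_v h) q * X2 q = d F q / (F q)\<^sup>2" if "d \<in> PD" "q \<in> \<Omega>" for d q
  proof -
    have "pd_u (pd_u h) q * X1 q + pd_v (pd_u h) q * X2 q = pd_u F q * D q / (D q * (F q)\<^sup>2)"
      "pd_v (pd_u h) q * X1 q + pd_v (pd_v h) q * X2 q = pd_v F q * D q / (D q * (F q)\<^sup>2)"
      unfolding X1_def X2_def times_divide_eq_right add_divide_distrib[symmetric]
      by (simp_all add: D_def hess_det_def algebra_simps power2_eq_square)
    then show ?thesis using that nz[OF that(2)] comm[OF that(2)] by (auto simp: PD_def)
  qed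
  have orth: "d n1 q * X1 q + d n2 q * X2 q + d F q * X3 q = 0" if "d \<in> PD" "q \<in> \<Omega>" for d q
  proof -
    have "d n1 q * X1 q + d n2 q * X2 q + d F q * X3 q =
        d F q / F q - F q * (d (pd_u h) q * X1 q + d (pd_v h) q * X2 q)"
      unfolding nd[OF that] X3_def by (simp add: algebra_simps)
    then show ?thesis unfolding lin[OF that] using nz[OF that(2)] by (simp add: power2_eq_square)
  qed
  have norm1: "n1 q * X1 q + n2 q * X2 q + F q * X3 q = 1" if "q \<in> \<Omega>" for q
    using nz[OF that] by (simp add: n1_def n2_def X3_def field_simps)
  have X: "affine_normal h q = vector [X1 q, X2 q, X3 q]" if q: "q \<in> \<Omega>" for q
    unfolding affine_normal_def N[OF q] Nd[OF q]
  proof (rule the_equality)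
    show "vector [n1 q, n2 q, F q] \<bullet> (vector [X1 q, X2 q, X3 q] :: real ^ 3) = 1 \<and>
      vector [X1 q, X2 q, X3 q] \<bullet> (vector [pd_u n1 q, pd_u n2 q, pd_u F q] :: real ^ 3) = 0 \<and>
      vector [X1 q, X2 q, X3 q] \<bullet> (vector [pd_v n1 q, pd_v n2 q, pd_v F q] :: real ^ 3) = 0"
      unfolding inner_vector_3 using norm1[OF q] orth[OF u(1) q] orth[OF u(2) q]
      by (simp add: mult.commute)
  next
    fix x :: "real ^ 3"
    assume x: "vector [n1 q, n2 q, F q] \<bullet> x = 1 \<and> x \<bullet> vector [pd_u n1 q, pd_u n2 q, pd_u F q] = 0 \<and>
      x \<bullet> vector [pd_v n1 q, pd_v n2 q, pd_v F q] = 0"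
    \<comment> \<open>The difference of two solutions satisfies the homogeneous system. Its first
      equation eliminates \<open>c\<close>, and what is left says that \<open>(a, b)\<close> lies in
      the kernel of the Hessian matrix, which is trivial because
      \<open>D \<noteq> 0\<close>.\<close>
    define a b c where "a = x $ 1 - X1 q" and "b = x $ 2 - X2 q" and "c = x $ 3 - X3 q"
    have xe: "x = vector [x $ 1, x $ 2, x $ 3]" by (simp add: vec_eq_iff forall_3)
    have "n1 q * x $ 1 + n2 q * x $ 2 + F q * x $ 3 = 1"
      "pd_u n1 q * x $ 1 + pd_u n2 q * x $ 2 + pd_u F q * x $ 3 = 0"
      "pd_v n1 q * x $ 1 + pd_v n2 q * x $ 2 + pd_v F q * x $ 3 = 0"
      using x by (subst (asm) (1 2 3) xe, simp add: inner_vector_3 mult.commute)+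
    then have e: "n1 q * a + n2 q * b + F q * c = 0"
      "pd_u n1 q * a + pd_u n2 q * b + pd_u F q * c = 0"
      "pd_v n1 q * a + pd_v n2 q * b + pd_v F q * c = 0"
      using norm1[OF q] orth[OF u(1) q] orth[OF u(2) q]
      by (simp_all add: a_def b_def c_def algebra_simps)
    have c: "c = pd_u h q * a + pd_v h q * b"
    proof -
      have "F q * (c - (pd_u h q * a + pd_v h q * b)) = n1 q * a + n2 q * b + F q * c"
        by (simp add: n1_def n2_def algebra_simps)
      then show ?thesis using e(1) nz(2)[OF q] by simp
    qed
    have "F q * (pd_u (pd_u h) q * a + pd_v (pd_u h) q * b) = 0"
      "F q * (pd_v (pd_u h) q * a + pd_v (pd_v h) q * b) = 0"
      using e(2,3) unfolding c nd[OF u(1) q] nd[OF u(2) q] comm[OF q] by (simp_all add: algebra_simps)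
    then have ab: "pd_u (pd_u h) q * a + pd_v (pd_u h) q * b = 0"
      "pd_v (pd_u h) q * a + pd_v (pd_v h) q * b = 0"
      using nz(2)[OF q] by simp_all
    have "D q * a = pd_v (pd_v h) q * (pd_u (pd_u h) q * a + pd_v (pd_u h) q * b)
        - pd_v (pd_u h) q * (pd_v (pd_u h) q * a + pd_v (pd_v h) q * b)"
      "D q * b = pd_u (pd_u h) q * (pd_v (pd_u h) q * a + pd_v (pd_v h) q * b)
        - pd_v (pd_u h) q * (pd_u (pd_u h) q * a + pd_v (pd_u h) q * b)"
      by (simp_all add: D_def hess_det_def algebra_simps power2_eq_square)
    then have "a = 0" "b = 0" using nz(3)[OF q] unfolding ab by simp_all
    then have "x $ 1 = X1 q" "x $ 2 = X2 q" "x $ 3 = X3 q" using c by (simp_all add: a_def b_def c_def)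
    then show "x = vector [X1 q, X2 q, X3 q]" using xe by simp
  qed
  have Xd: "pd_u (affine_normal h) p = vector [pd_u X1 p, pd_u X2 p, pd_u X3 p]"
    "pd_v (affine_normal h) p = vector [pd_v X1 p, pd_v X2 p, pd_v X3 p]"
    using pd_cong[OF \<Omega> p, of "affine_normal h", OF X]
      pd_vector_3[OF diff[OF smX(1) p] diff[OF smX(2) p] diff[OF smX3 p]] by auto
  have FD: "4 * (D q * d F q) = - (d D q * F q)" if "d \<in> PD" "q \<in> \<Omega>" for d q
  proof -
    have "d F q = - 1 / 4 * (- D q) powr (- 1 / 4 - 1) * d (\<lambda>q. - D q) q"
      unfolding F_def using that pd_powr[OF diff[OF smooth_on_minus[OF \<Omega> smD] that(2)], of "- 1 / 4"] neg[OF that(2)]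
      by (auto simp: PD_def)
    also have "d (\<lambda>q. - D q) q = - d D q" by (rule Dminus[OF that smD])
    also have "(- D q) powr (- 1 / 4 - 1) = F q / (- D q)"
      using neg[OF that(2)] by (simp only: powr_diff F_def) simp
    finally show ?thesis using nz(3)[OF that(2)] by (simp add: field_simps)
  qed
  have main: "16 * (D p)\<^sup>2 * (i n1 p * j X1 p + i n2 p * j X2 p + i F p * j X3 p) =
      affine_poly h (j (i D)) (i D) (j D) (j (i (pd_u h))) (j (i (pd_v h))) p"
    if i: "i \<in> PD" and j: "j \<in> PD" for i j
  proof -
    note smi = sm smPD[OF i] smPD[OF j] smooth_on_pd \<Omega>
    \<comment> \<open>The orthogonality relation holds on all of \<open>\<Omega>\<close>, so it can
      be differentiated. The zero function is written \<open>0 * F q\<close> in order to get its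
      derivative from \<open>Dcmult\<close>.\<close>
    have "j (\<lambda>q. (i n1 q * X1 q + i n2 q * X2 q) + i F q * X3 q) p = j (\<lambda>q. 0 * F q) p"
      using orth[OF i] by (intro Dcong[OF j p]) auto
    also have "\<dots> = 0" by (subst Dcmult[OF j p smF]) simp
    finally have "(j (i n1) p * X1 p + i n1 p * j X1 p + (j (i n2) p * X2 p + i n2 p * j X2 p)) + (j (i F) p * X3 p + i F p * j X3 p) = 0"
      by (simp add: Dadd[OF j p] Dmult[OF j p] smi smooth_on_add smooth_on_mult)
    then have "i n1 p * j X1 p + i n2 p * j X2 p + i F p * j X3 p = - (j (i n1) p * X1 p + j (i n2) p * X2 p + j (i F) p * X3 p)"
      by (simp add: algebra_simps)
    moreover have "j (i n1) p = - (j (i F) p * pd_u h p + i F p * j (pd_u h) p + (j F p * i (pd_u h) p + F p * j (i (pd_u h)) p))"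
    proof -
      have "j (i n1) p = j (\<lambda>q. - (i F q * pd_u h q + F q * i (pd_u h) q)) p"
        by (intro Dcong[OF j p] nd[OF i])
      then show ?thesis
        by (simp add: Dminus[OF j p] Dadd[OF j p] Dmult[OF j p] smi smooth_on_add smooth_on_mult
            del: minus_add_distrib)
    qed
    moreover have "j (i n2) p = - (j (i F) p * pd_v h p + i F p * j (pd_v h) p + (j F p * i (pd_v h) p + F p * j (i (pd_v h)) p))"
    proof -
      have "j (i n2) p = j (\<lambda>q. - (i F q * pd_v h q + F q * i (pd_v h) q)) p"
        by (intro Dcong[OF j p] nd[OF i])
      then show ?thesis
        by (simp add: Dminus[OF j p] Dadd[OF j p] Dmult[OF j p] smi smooth_on_add smooth_on_mult
            del: minus_add_distrib)
    qed
    \<comment> \<open>Inserting \<open>X3 = 1 / F + h_u X1 + h_v X2\<close> cancels all terms that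
      contain \<open>h_u\<close> or \<open>h_v\<close> undifferentiated.\<close>
    ultimately have "i n1 p * j X1 p + i n2 p * j X2 p + i F p * j X3 p =
        i F p * (j (pd_u h) p * X1 p + j (pd_v h) p * X2 p) + j F p * (i (pd_u h) p * X1 p + i (pd_v h) p * X2 p)
        + F p * (j (i (pd_u h)) p * X1 p + j (i (pd_v h)) p * X2 p) - j (i F) p * (1 / F p)"
      by (simp add: X3_def algebra_simps)
    also have "\<dots> = 2 * i F p * j F p / (F p)\<^sup>2 + F p * (j (i (pd_u h)) p * X1 p + j (i (pd_v h)) p * X2 p) - j (i F) p / F p"
      unfolding lin[OF i p] lin[OF j p] by simp
    finally have *: "i n1 p * j X1 p + i n2 p * j X2 p + i F p * j X3 p = \<dots>" .
    have "j (\<lambda>q. 4 * (D q * i F q)) p = j (\<lambda>q. - (i D q * F q)) p"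
      by (intro Dcong[OF j p] FD[OF i])
    then have Fij: "4 * (j D p * i F p + D p * j (i F) p) = - (j (i D) p * F p + i D p * j F p)"
      by (simp add: Dminus[OF j p] Dcmult[OF j p] Dmult[OF j p] smi smooth_on_mult)
    show ?thesis
      unfolding * affine_poly_def D_def[symmetric]
      by (rule affine_coefficient_algebra[OF nz(2,3)[OF p] _ _ FD[OF u(1) p] FD[OF u(2) p] FD[OF i p] FD[OF j p] Fij])
        (simp_all add: X1_def X2_def)
  qed
  have comm': "pd_u (pd_u (pd_v h)) p = pd_u (pd_v (pd_u h)) p" "pd_v (pd_u (pd_v h)) p = pd_v (pd_v (pd_u h)) p"
    by (rule Dcong[OF u(1) p comm] Dcong[OF u(2) p comm], assumption)+
  show "16 * (hess_det h p)\<^sup>2 * aff_l h p = poly_A h p"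
    using main[OF u(1) u(1)] comm'
    by (simp add: aff_l_def Nd[OF p] Xd inner_vector_3 poly_A_def D_def affine_poly_def)
  show "16 * (hess_det h p)\<^sup>2 * aff_m h p = poly_B h p"
    using main[OF u(1) u(2)] comm'
    by (simp add: aff_m_def Nd[OF p] Xd inner_vector_3 poly_B_def D_def affine_poly_def)
  show "16 * (hess_det h p)\<^sup>2 * aff_n h p = poly_C h p"
    using main[OF u(2) u(2)] comm'
    by (simp add: aff_n_def Nd[OF p] Xd inner_vector_3 poly_C_def D_def affine_poly_def)
qed

text \<open>As \<open>D\<close> has no zero in the punctured ball, the filter in the definition of
  \<open>ext16\<close> is the full \<open>at 0\<close>. The limit taken there is therefore the value
  of the continuous function \<open>P\<close>.\<close>

lemma ext16_eq:
  assumes "\<rho> > 0" and p: "norm p < \<rho>" and cont: "isCont P 0"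
    and D: "\<And>q. q \<noteq> 0 \<Longrightarrow> norm q < \<rho> \<Longrightarrow> hess_det h q \<noteq> 0"
    and eq: "\<And>q. q \<noteq> 0 \<Longrightarrow> norm q < \<rho> \<Longrightarrow> 16 * (hess_det h q)\<^sup>2 * F q = P q"
    and zero: "hess_det h 0 = 0"
  shows "ext16 h F p = P p"
proof (cases "p = 0")
  case False
  then show ?thesis using D eq p by (simp add: ext16_def)
next
  case True
  have "at (0 :: real \<times> real) within {q. hess_det h q \<noteq> 0} = at 0 within UNIV"
    by (rule at_within_nhd[of _ "ball 0 \<rho>"]) (use D \<open>\<rho> > 0\<close> in auto)
  moreover have "((\<lambda>q. 16 * (hess_det h q)\<^sup>2 * F q) \<longlongrightarrow> P 0) (at 0)"
  proof (rule Lim_transform_eventually)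
    show "(P \<longlongrightarrow> P 0) (at 0)" using cont by (simp add: isCont_def)
    show "\<forall>\<^sub>F q in at 0. P q = 16 * (hess_det h q)\<^sup>2 * F q"
      unfolding eventually_at using eq \<open>\<rho> > 0\<close> by (intro exI[of _ \<rho>]) auto
  qed
  ultimately show ?thesis
    using True zero by (simp add: ext16_def tendsto_Lim)
qed

section \<open>Spiralling vector fields\<close>

lemma at_within_Icc_eq_atLeast:
  fixes t T :: real
  assumes "t < T"
  shows "at t within {0..T} = at t within {0..}"
  by (rule at_within_nhd[of _ "{..<T}"]) (use assms in auto)

lemma integral_atLeast_has_real_derivative:
  fixes g :: "real \<Rightarrow> real"
  assumes "continuous_on {0..} g" "t \<ge> 0"
  shows "((\<lambda>t. integral {0..t} g) has_real_derivative g t) (at t within {0..})"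
proof -
  have "continuous_on {0..t + 1} g" using assms(1) by (rule continuous_on_subset) auto
  then have "((\<lambda>t. integral {0..t} g) has_real_derivative g t) (at t within {0..t + 1})"
    by (rule integral_has_real_derivative) (use assms in auto)
  then show ?thesis using at_within_Icc_eq_atLeast[of t "t + 1"] by simp
qed

lemma has_real_derivative_imp_continuous_on:
  fixes f :: "real \<Rightarrow> real"
  assumes "\<And>t. t \<in> S \<Longrightarrow> (f has_real_derivative f' t) (at t within S)"
  shows "continuous_on S f"
  using assms DERIV_continuous_on by blast

text \<open>The Picard iterates are defined on the whole half-line, so no local solutions have to be
  glued. The bound \<open>M\<close> starts the estimate \<open>M L^n t^(n+1) / (n+1)!\<close> of
  successive differences, and the Lipschitz constant may depend on \<open>T\<close>: in the
  application it is taken on annuli that approach the origin as \<open>T\<close> grows.\<close>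

lemma picard_global:
  fixes G :: "real \<Rightarrow> real \<Rightarrow> real"
  assumes cont: "continuous_on ({0..} \<times> UNIV) (\<lambda>p. G (fst p) (snd p))"
    and M: "\<And>t x. 0 \<le> t \<Longrightarrow> \<bar>G t x\<bar> \<le> M"
    and lip: "\<And>T. T \<ge> 0 \<Longrightarrow> \<exists>L. \<forall>t\<in>{0..T}. \<forall>x y. \<bar>G t x - G t y\<bar> \<le> L * \<bar>x - y\<bar>"
  shows "\<exists>\<theta>. \<theta> 0 = \<theta>0 \<and> (\<forall>t\<ge>0. (\<theta> has_real_derivative G t (\<theta> t)) (at t within {0..}))"
proof -
  define X where "X = rec_nat (\<lambda>t. \<theta>0) (\<lambda>n x t. \<theta>0 + integral {0..t} (\<lambda>s. G s (x s)))"
  have X0: "X 0 = (\<lambda>t. \<theta>0)" and XS: "\<And>n t. X (Suc n) t = \<theta>0 + integral {0..t} (\<lambda>s. G s (X n s))"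
    by (auto simp: X_def)
  have contG: "continuous_on S (\<lambda>s. G s (x s))" if "continuous_on S x" "S \<subseteq> {0..}" for x :: "real \<Rightarrow> real" and S
  proof -
    have "continuous_on S (\<lambda>s. (s, x s))" using that by (intro continuous_intros)
    from continuous_on_compose2[OF cont this] that(2) show ?thesis by auto
  qed
  have Xc: "continuous_on {0..} (X n)" for n
  proof (induction n)
    case (Suc n)
    have "(X (Suc n) has_real_derivative G t (X n t)) (at t within {0..})" if "t \<in> {0..}" for t
      unfolding XS using that
      by (auto intro!: derivative_eq_intros integral_atLeast_has_real_derivative contG Suc)
    then show ?case by (rule has_real_derivative_imp_continuous_on)
  qed (simp add: X0)
  have Xc': "continuous_on {0..t} (X n)" for n t by (rule continuous_on_subset[OF Xc]) auto
  have M0: "M \<ge> 0" using M[of 0 0] by simp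
  have pow: "((\<lambda>s. c * s ^ k) has_integral c * t ^ Suc k / real (Suc k)) {0..t}" if "t \<ge> 0" for c t :: real and k
  proof -
    have "((\<lambda>s. c * s ^ k) has_integral c * t ^ Suc k / real (Suc k) - c * 0 ^ Suc k / real (Suc k)) {0..t}"
      by (rule fundamental_theorem_of_calculus[OF that])
        (auto intro!: derivative_eq_intros simp flip: has_real_derivative_iff_has_vector_derivative simp del: power_Suc of_nat_Suc)
    then show ?thesis by simp
  qed
  \<comment> \<open>The limit of the iterates as a telescoping series. Its definition does not
    mention \<open>T\<close>, so the uniform limits on all intervals \<open>{0..T}\<close> are the
    same function.\<close>
  define x where "x t = \<theta>0 + (\<Sum>i. X (Suc i) t - X i t)" for t
  have lim: "uniform_limit {0..T} X x sequentially" and fix_x: "x T = \<theta>0 + integral {0..T} (\<lambda>s. G s (x s))"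
    if T: "T \<ge> 0" for T
  proof -
    obtain L0 where L0: "\<forall>t\<in>{0..T}. \<forall>x y. \<bar>G t x - G t y\<bar> \<le> L0 * \<bar>x - y\<bar>" using lip[OF T] by blast
    define L where "L = \<bar>L0\<bar>"
    have L: "L \<ge> 0" "\<And>t x y. t \<in> {0..T} \<Longrightarrow> \<bar>G t x - G t y\<bar> \<le> L * \<bar>x - y\<bar>"
    proof -
      show "L \<ge> 0" by (simp add: L_def)
      fix t x y assume "t \<in> {0..T}"
      then have "\<bar>G t x - G t y\<bar> \<le> L0 * \<bar>x - y\<bar>" using L0 by blast
      also have "\<dots> \<le> L * \<bar>x - y\<bar>" by (rule mult_right_mono) (auto simp: L_def)
      finally show "\<bar>G t x - G t y\<bar> \<le> L * \<bar>x - y\<bar>" .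
    qed
    have bound: "\<bar>X (Suc n) t - X n t\<bar> \<le> M * L ^ n * t ^ Suc n / fact (Suc n)" if "t \<in> {0..T}" for n t
      using that
    proof (induction n arbitrary: t)
      case 0
      then have "\<bar>integral {0..t} (\<lambda>s. G s \<theta>0)\<bar> \<le> integral {0..t} (\<lambda>s. M)"
        by (intro integral_norm_bound_integral[where 'a=real, unfolded real_norm_def])
          (auto intro!: integrable_continuous_real contG M)
      also have "\<dots> = M * t" using 0 by simp
      finally show ?case by (simp add: XS X0)
    next
      case (Suc n)
      have c: "continuous_on {0..t} (\<lambda>s. G s (X k s))" for k by (intro contG Xc') auto
      have "X (Suc (Suc n)) t - X (Suc n) t = integral {0..t} (\<lambda>s. G s (X (Suc n) s) - G s (X n s))"
        unfolding XS[of "Suc n"] XS[of n t]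
        by (subst integral_diff) (auto intro!: integrable_continuous_real c)
      also have "\<bar>\<dots>\<bar> \<le> integral {0..t} (\<lambda>s. (M * L ^ Suc n / fact (Suc n)) * s ^ Suc n)"
      proof (rule integral_norm_bound_integral[where 'a=real, unfolded real_norm_def])
        show "(\<lambda>s. G s (X (Suc n) s) - G s (X n s)) integrable_on {0..t}"
          by (intro integrable_continuous_real continuous_intros c)
        show "(\<lambda>s. M * L ^ Suc n / fact (Suc n) * s ^ Suc n) integrable_on {0..t}"
          by (intro integrable_continuous_real continuous_intros)
        fix s assume s: "s \<in> {0..t}"
        then have sT: "s \<in> {0..T}" using Suc.prems by auto
        have "\<bar>G s (X (Suc n) s) - G s (X n s)\<bar> \<le> L * \<bar>X (Suc n) s - X n s\<bar>" by (rule L(2)[OF sT])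
        also have "\<dots> \<le> L * (M * L ^ n * s ^ Suc n / fact (Suc n))"
          by (rule mult_left_mono[OF Suc.IH[OF sT] L(1)])
        finally show "\<bar>G s (X (Suc n) s) - G s (X n s)\<bar> \<le> M * L ^ Suc n / fact (Suc n) * s ^ Suc n"
          by (simp add: mult_ac)
      qed
      also have "\<dots> = M * L ^ Suc n / fact (Suc n) * t ^ Suc (Suc n) / real (Suc (Suc n))"
        using pow[of t "M * L ^ Suc n / fact (Suc n)" "Suc n"] Suc.prems by (intro integral_unique) auto
      also have "\<dots> = M * L ^ Suc n * t ^ Suc (Suc n) / fact (Suc (Suc n))"
        by (simp only: fact_Suc[of "Suc n"] times_divide_eq_left divide_divide_eq_left) (simp only: mult.commute of_nat_mult of_nat_id)
      finally show ?case .
    qed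
    have "uniform_limit {0..T} (\<lambda>n t. \<Sum>i<n. X (Suc i) t - X i t) (\<lambda>t. \<Sum>i. X (Suc i) t - X i t) sequentially"
    proof (rule Weierstrass_m_test)
      show "summable (\<lambda>n. M * T * (inverse (fact n) * (L * T) ^ n))"
        by (intro summable_mult summable_exp)
      fix n t assume t: "t \<in> {0..T}"
      have "M * L ^ n * t ^ Suc n / fact (Suc n) \<le> M * L ^ n * T ^ Suc n / fact n"
        using t M0 L(1) by (intro frac_le mult_left_mono power_mono mult_nonneg_nonneg zero_le_power fact_mono) auto
      also have "\<dots> = M * T * (inverse (fact n) * (L * T) ^ n)"
        by (simp add: field_simps power_mult_distrib)
      finally show "norm (X (Suc n) t - X n t) \<le> M * T * (inverse (fact n) * (L * T) ^ n)"
        using bound[OF t, of n] by simp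
    qed
    then have "uniform_limit {0..T} (\<lambda>n t. X n t - \<theta>0) (\<lambda>t. \<Sum>i. X (Suc i) t - X i t) sequentially"
      unfolding sum_lessThan_telescope[of "\<lambda>i. X i _"] X0 .
    from uniform_limit_add[OF uniform_limit_const[where c="\<lambda>_. \<theta>0"] this]
    show lim: "uniform_limit {0..T} X x sequentially"
      by (simp add: x_def[abs_def])
    have "uniform_limit {0..T} (\<lambda>n s. G s (X n s)) (\<lambda>s. G s (x s)) sequentially"
    proof (rule uniform_limitI)
      fix e :: real assume "e > 0"
      \<comment> \<open>\<open>L\<close> may be 0; dividing by \<open>L + 1\<close> avoids a
        separate case.\<close>
      then have "e / (L + 1) > 0" using L(1) by simp
      then have "\<forall>\<^sub>F n in sequentially. \<forall>s\<in>{0..T}. dist (X n s) (x s) < e / (L + 1)"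
        using uniform_limitD[OF lim] by blast
      then show "\<forall>\<^sub>F n in sequentially. \<forall>s\<in>{0..T}. dist (G s (X n s)) (G s (x s)) < e"
      proof eventually_elim
        case (elim n)
        show ?case
        proof
          fix s assume s: "s \<in> {0..T}"
          have "\<bar>G s (X n s) - G s (x s)\<bar> \<le> (L + 1) * \<bar>X n s - x s\<bar>"
            using L(2)[OF s, of "X n s" "x s"] by (simp add: algebra_simps)
          also have "\<dots> < (L + 1) * (e / (L + 1))"
            using elim s L(1) by (intro mult_strict_left_mono) (auto simp: dist_real_def)
          finally show "dist (G s (X n s)) (G s (x s)) < e" using L(1) by (simp add: dist_real_def)
        qed
      qed
    qed
    then obtain I J where IJ: "\<And>n. ((\<lambda>s. G s (X n s)) has_integral I n) {0..T}" "((\<lambda>s. G s (x s)) has_integral J) {0..T}" "I \<longlonglongrightarrow> J"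
      by (rule uniform_limit_integral) (auto intro!: contG Xc')
    have "(\<lambda>n. X (Suc n) T) \<longlonglongrightarrow> \<theta>0 + J"
      unfolding XS integral_unique[OF IJ(1)] by (intro tendsto_intros IJ)
    moreover have "(\<lambda>n. X (Suc n) T) \<longlonglongrightarrow> x T"
      using tendsto_uniform_limitI[OF lim, of T] T by (intro LIMSEQ_Suc) auto
    ultimately show "x T = \<theta>0 + integral {0..T} (\<lambda>s. G s (x s))"
      using LIMSEQ_unique integral_unique[OF IJ(2)] by auto
  qed
  have xT: "continuous_on {0..T} x" if "T \<ge> 0" for T
    by (rule uniform_limit_theorem[OF _ lim[OF that]]) (simp_all add: Xc')
  have xc: "continuous_on {0..} x"
    unfolding continuous_on_eq_continuous_within
  proof
    fix t :: real assume "t \<in> {0..}"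
    \<comment> \<open>The interval \<open>{0..t + 1}\<close> is used so that \<open>t\<close> is not
      its right endpoint, and continuity within it agrees with continuity within
      \<open>{0..}\<close>.\<close>
    then show "continuous (at t within {0..}) x"
      using xT[of "t + 1", unfolded continuous_on_eq_continuous_within, rule_format, of t]
        at_within_Icc_eq_atLeast[of t "t + 1"] by simp
  qed
  have "(x has_real_derivative G t (x t)) (at t within {0..})" if "t \<ge> 0" for t
  proof (rule has_field_derivative_transform_within[of _ _ _ _ 1])
    show "((\<lambda>t. \<theta>0 + integral {0..t} (\<lambda>s. G s (x s))) has_real_derivative G t (x t)) (at t within {0..})"
      using that by (auto intro!: derivative_eq_intros integral_atLeast_has_real_derivative contG xc)
  qed (use that fix_x in auto)
  moreover have "x 0 = \<theta>0" using fix_x[of 0] by simp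
  ultimately show ?thesis by blast
qed

lemma linear_growth_filterlim:
  fixes \<theta> :: "real \<Rightarrow> real"
  assumes der: "\<And>t. t \<ge> 0 \<Longrightarrow> (\<theta> has_real_derivative d t) (at t within {0..})"
    and d: "\<And>t. t \<ge> 0 \<Longrightarrow> s * d t \<ge> m" and m: "m > 0"
  shows "filterlim (\<lambda>t. s * \<theta> t) at_top at_top"
proof (rule filterlim_at_top_mono)
  show "filterlim (\<lambda>t. s * \<theta> 0 + m * t) at_top at_top"
    by (intro filterlim_tendsto_add_at_top[OF tendsto_const] filterlim_tendsto_pos_mult_at_top[OF tendsto_const m] filterlim_ident)
  show "\<forall>\<^sub>F t in at_top. s * \<theta> 0 + m * t \<le> s * \<theta> t"
    using eventually_ge_at_top[of 0]
  proof eventually_elim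
    case (elim t)
    have "((\<lambda>t. s * \<theta> t) has_derivative (\<lambda>h. h * (s * d x))) (at x within {0..t})" if "0 \<le> x" "x \<le> t" for x
    proof -
      have "((\<lambda>t. s * \<theta> t) has_real_derivative s * d x) (at x within {0..})"
        using DERIV_cmult[OF der[OF that(1)]] .
      then have "((\<lambda>t. s * \<theta> t) has_real_derivative s * d x) (at x within {0..t})"
        by (rule has_field_derivative_subset) auto
      then show ?thesis unfolding has_field_derivative_def
        by (rule has_derivative_eq_rhs) (simp add: fun_eq_iff)
    qed
    from mvt_very_simple[OF elim this] obtain x where x: "x \<in> {0..t}" "s * \<theta> t - s * \<theta> 0 = (t - 0) * (s * d x)"
      by blast
    have "m * t \<le> (s * d x) * t" using d[of x] x(1) elim by (intro mult_right_mono) auto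
    then show ?case using x(2) by (simp add: mult_ac)
  qed
qed

section \<open>Fields with prescribed radial speed, and their orbits in polar form\<close>

definition spiral_field :: "real \<Rightarrow> (real \<times> real \<Rightarrow> real) \<Rightarrow> real \<times> real \<Rightarrow> real \<times> real" where
  "spiral_field \<sigma> \<eta> p = (\<sigma> * fst p - \<eta> p * snd p, \<sigma> * snd p + \<eta> p * fst p)"

lemma has_vector_derivative_fst_snd:
  fixes x :: "real \<Rightarrow> real \<times> real"
  assumes "(x has_vector_derivative d) F"
  shows "((\<lambda>t. fst (x t)) has_real_derivative fst d) F" "((\<lambda>t. snd (x t)) has_real_derivative snd d) F"
  using bounded_linear.has_vector_derivative[OF bounded_linear_fst assms]
    bounded_linear.has_vector_derivative[OF bounded_linear_snd assms]
  by (simp_all add: has_real_derivative_iff_has_vector_derivative)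

lemma norm_Pair_squared: "(norm p)\<^sup>2 = (fst p)\<^sup>2 + (snd p)\<^sup>2" for p :: "real \<times> real"
  by (cases p) (simp add: norm_Pair)

text \<open>\<open>\<theta>\<close> is only assumed continuous. The quotient \<open>f\<close> of the
  cross product and the dot product of \<open>x t0\<close> with \<open>x t\<close> is the tangent of
  \<open>\<theta> t - \<theta> t0\<close>, and near \<open>t0\<close> continuity keeps this
  difference in the range of \<open>arctan\<close>. So \<open>\<theta>\<close> agrees locally with
  \<open>\<theta> t0 + arctan (f t)\<close>, which is differentiable.\<close>

lemma angle_along_derivative:
  fixes x :: "real \<Rightarrow> real \<times> real"
  assumes ic: "integral_curve (spiral_field \<sigma> \<eta>) {0..} x" and nz: "\<And>t. t \<ge> 0 \<Longrightarrow> x t \<noteq> 0"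
    and ang: "angle_along {0..} x 0 \<theta>" and t0: "t0 \<ge> 0"
  shows "(\<theta> has_real_derivative \<eta> (x t0)) (at t0 within {0..})"
proof -
  define a b where "a = fst (x t0)" and "b = snd (x t0)"
  define f where "f t = (a * snd (x t) - b * fst (x t)) / (a * fst (x t) + b * snd (x t))" for t
  have polar: "fst (x t) = norm (x t) * cos (\<theta> t)" "snd (x t) = norm (x t) * sin (\<theta> t)" if "t \<ge> 0" for t
  proof -
    have "x t = norm (x t) *\<^sub>R (cos (\<theta> t), sin (\<theta> t))" using ang that by (auto simp: angle_along_def)
    from arg_cong[OF this, of fst] arg_cong[OF this, of snd]
    show "fst (x t) = norm (x t) * cos (\<theta> t)" "snd (x t) = norm (x t) * sin (\<theta> t)" by simp_all
  qed
  have npos: "norm (x t) > 0" if "t \<ge> 0" for t using nz[OF that] by simp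
  have ab: "a\<^sup>2 + b\<^sup>2 > 0" using npos[OF t0] norm_Pair_squared[of "x t0"] by (metis a_def b_def zero_less_power)
  have f_eq: "f t = tan (\<theta> t - \<theta> t0)" if "t \<ge> 0" for t
  proof -
    have "a * snd (x t) - b * fst (x t) = (norm (x t0) * norm (x t)) * sin (\<theta> t - \<theta> t0)"
      "a * fst (x t) + b * snd (x t) = (norm (x t0) * norm (x t)) * cos (\<theta> t - \<theta> t0)"
      unfolding a_def b_def polar[OF that] polar[OF t0] by (simp_all add: sin_diff cos_diff algebra_simps)
    then show ?thesis using npos[OF that] npos[OF t0] by (simp add: f_def tan_def)
  qed
  have "continuous (at t0 within {0..}) \<theta>"
    using ang t0 by (auto simp: angle_along_def continuous_on_eq_continuous_within)
  then obtain e where e: "e > 0" "\<And>t. t \<ge> 0 \<Longrightarrow> dist t t0 < e \<Longrightarrow> \<bar>\<theta> t - \<theta> t0\<bar> < pi / 2"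
    unfolding continuous_within_eps_delta using pi_half_gt_zero
    by (metis atLeast_iff dist_real_def)
  have xd: "((\<lambda>t. fst (x t)) has_real_derivative \<sigma> * a - \<eta> (x t0) * b) (at t0 within {0..})"
    "((\<lambda>t. snd (x t)) has_real_derivative \<sigma> * b + \<eta> (x t0) * a) (at t0 within {0..})"
    using has_vector_derivative_fst_snd[of x "spiral_field \<sigma> \<eta> (x t0)"] ic t0
    by (auto simp: integral_curve_def spiral_field_def a_def b_def)
  have "a * a + b * b \<noteq> 0" using ab unfolding power2_eq_square by linarith
  moreover have "(f has_real_derivative
      ((a * (\<sigma> * b + \<eta> (x t0) * a) - b * (\<sigma> * a - \<eta> (x t0) * b)) * (a * a + b * b)
        - (a * b - b * a) * (a * (\<sigma> * a - \<eta> (x t0) * b) + b * (\<sigma> * b + \<eta> (x t0) * a)))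
      / ((a * a + b * b) * (a * a + b * b))) (at t0 within {0..})"
    if "a * a + b * b \<noteq> 0"
    using that DERIV_divide[OF DERIV_diff[OF DERIV_cmult[OF xd(2), of a] DERIV_cmult[OF xd(1), of b]]
        DERIV_add[OF DERIV_cmult[OF xd(1), of a] DERIV_cmult[OF xd(2), of b]]]
    unfolding f_def[abs_def] a_def[symmetric] b_def[symmetric] by blast
  moreover have "(a * (\<sigma> * b + \<eta> (x t0) * a) - b * (\<sigma> * a - \<eta> (x t0) * b)) * (a * a + b * b)
        - (a * b - b * a) * (a * (\<sigma> * a - \<eta> (x t0) * b) + b * (\<sigma> * b + \<eta> (x t0) * a))
      = \<eta> (x t0) * ((a * a + b * b) * (a * a + b * b))"
    by (simp add: algebra_simps)
  ultimately have "(f has_real_derivative \<eta> (x t0)) (at t0 within {0..})"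
    by (metis mult_eq_0_iff nonzero_mult_div_cancel_right)
  moreover have "f t0 = 0" using f_eq[OF t0] by simp
  ultimately have "((\<lambda>t. \<theta> t0 + arctan (f t)) has_real_derivative \<eta> (x t0)) (at t0 within {0..})"
    by (auto intro!: derivative_eq_intros)
  then show ?thesis
  proof (rule has_field_derivative_transform_within[OF _ e(1)])
    fix t :: real assume t: "t \<in> {0..}" "dist t t0 < e"
    then have "\<bar>\<theta> t - \<theta> t0\<bar> < pi / 2" using e(2) by simp
    then have "arctan (tan (\<theta> t - \<theta> t0)) = \<theta> t - \<theta> t0"
      unfolding abs_less_iff by (intro arctan_tan) linarith+
    then have "arctan (f t) = \<theta> t - \<theta> t0" using f_eq t by simp
    then show "\<theta> t0 + arctan (f t) = \<theta> t" by simp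
  qed (use t0 in simp)
qed

text \<open>The orbit and the determination of its angle are arbitrary here, but
  \<open>angle_along_derivative\<close> forces the angular speed to be \<open>\<eta>\<close> along
  the orbit. The lower bound \<open>m\<close> then gives linear growth.\<close>

lemma spirals_in_with_sense_spiral_field:
  assumes "\<And>p. p \<in> U - {0} \<Longrightarrow> s * \<eta> p \<ge> m" "m > 0"
  shows "spirals_in_with_sense s U (spiral_field \<sigma> \<eta>)"
  unfolding spirals_in_with_sense_def
proof (intro allI impI, elim conjE)
  fix x \<theta>
  assume *: "integral_curve (spiral_field \<sigma> \<eta>) {0..} x" "x ` {0..} \<subseteq> U - {(0, 0)}" "angle_along {0..} x (0, 0) \<theta>"
  then have U: "x t \<in> U - {0}" if "t \<ge> 0" for t using that by (auto simp: zero_prod_def)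
  show "filterlim (\<lambda>t. s * \<theta> t) at_top at_top"
  proof (rule linear_growth_filterlim)
    show "(\<theta> has_real_derivative \<eta> (x t)) (at t within {0..})" if "t \<ge> 0" for t
      using angle_along_derivative[OF *(1) _ _ that] U *(3) by (auto simp: zero_prod_def)
    show "m \<le> s * \<eta> (x t)" if "t \<ge> 0" for t using assms(1) U[OF that] .
  qed (rule assms(2))
qed

lemma norm_polar: "r \<ge> 0 \<Longrightarrow> norm (r * cos t, r * sin t) = r"
  by (simp add: norm_Pair power_mult_distrib flip: distrib_left)

text \<open>The derivatives of \<open>\<eta>\<close> need not be bounded near the origin, but they
  are bounded by some \<open>B1\<close>, \<open>B2\<close> on the compact annulus
  \<open>r1 \<le> norm p \<le> r2\<close>. Along a circle of radius \<open>r\<close> the chain rule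
  contributes a factor at most \<open>r2\<close>.\<close>

lemma lipschitz_along_circles:
  assumes \<eta>: "smooth_on (ball 0 \<rho> - {0}) \<eta>" and r: "0 < r1" "r2 < \<rho>"
  shows "\<exists>L. \<forall>r\<in>{r1..r2}. \<forall>x y. \<bar>\<eta> (r * cos x, r * sin x) - \<eta> (r * cos y, r * sin y)\<bar> \<le> L * \<bar>x - y\<bar>"
proof -
  let ?\<Omega> = "ball 0 \<rho> - {0 :: real \<times> real}"
  define K where "K = {p :: real \<times> real. norm p \<in> {r1..r2}}"
  have "K = norm -` {r1..r2}" by (auto simp: K_def)
  then have "closed K" by (auto intro!: closed_vimage continuous_intros)
  moreover have "bounded K" unfolding bounded_iff K_def by auto
  ultimately have K: "compact K" by (simp add: compact_eq_bounded_closed)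
  have sub: "K \<subseteq> ?\<Omega>" using r by (auto simp: K_def)
  have op: "open ?\<Omega>" by auto
  have "continuous_on K (pd_u \<eta>)" "continuous_on K (pd_v \<eta>)"
    using smooth_on_continuous_on smooth_on_pd[OF \<eta>] continuous_on_subset sub by blast+
  then have "bounded (pd_u \<eta> ` K)" "bounded (pd_v \<eta> ` K)"
    using K compact_continuous_image compact_imp_bounded by blast+
  then obtain B1 B2 where B: "\<And>p. p \<in> K \<Longrightarrow> \<bar>pd_u \<eta> p\<bar> \<le> B1" "\<And>p. p \<in> K \<Longrightarrow> \<bar>pd_v \<eta> p\<bar> \<le> B2"
    unfolding bounded_iff by auto
  have "\<bar>\<eta> (r * cos x, r * sin x) - \<eta> (r * cos y, r * sin y)\<bar> \<le> (r2 * B1 + r2 * B2) * \<bar>x - y\<bar>"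
    if r': "r \<in> {r1..r2}" for r x y
  proof -
    define c where "c t = (r * cos t, r * sin t)" for t
    have cK: "c t \<in> K" for t
      using norm_polar[of r t] r r' by (simp add: K_def c_def)
    have "((\<lambda>t. \<eta> (c t)) has_real_derivative pd_u \<eta> (c t) * (- r * sin t) + pd_v \<eta> (c t) * (r * cos t)) (at t)" for t
    proof -
      have "(c has_derivative (\<lambda>h. (h * (- r * sin t), h * (r * cos t)))) (at t)"
        unfolding c_def by (auto intro!: derivative_eq_intros simp: algebra_simps)
      moreover have "(\<eta> has_derivative (\<lambda>h. fst h *\<^sub>R pd_u \<eta> (c t) + snd h *\<^sub>R pd_v \<eta> (c t))) (at (c t))"
        using cK sub by (intro has_derivative_pd smooth_on_differentiable_at[OF \<eta> op]) blast
      ultimately have "((\<lambda>t. \<eta> (c t)) has_derivative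
          (\<lambda>h. fst (h * (- r * sin t), h * (r * cos t)) *\<^sub>R pd_u \<eta> (c t) + snd (h * (- r * sin t), h * (r * cos t)) *\<^sub>R pd_v \<eta> (c t))) (at t)"
        by (rule has_derivative_compose)
      then show ?thesis unfolding has_field_derivative_def
        by (rule has_derivative_eq_rhs) (simp add: fun_eq_iff algebra_simps)
    qed
    moreover have "norm (pd_u \<eta> (c t) * (- r * sin t) + pd_v \<eta> (c t) * (r * cos t)) \<le> r2 * B1 + r2 * B2" for t
    proof -
      have "\<bar>pd_u \<eta> (c t)\<bar> * (r * \<bar>sin t\<bar>) \<le> B1 * (r2 * 1)" "\<bar>pd_v \<eta> (c t)\<bar> * (r * \<bar>cos t\<bar>) \<le> B2 * (r2 * 1)"
        using r r' B[OF cK[of t]] by (intro mult_mono; force)+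
      then show ?thesis
        using r r' abs_triangle_ineq[of "pd_u \<eta> (c t) * (- r * sin t)" "pd_v \<eta> (c t) * (r * cos t)"]
        by (simp add: abs_mult mult.commute)
    qed
    ultimately show ?thesis
      using field_differentiable_bound[of UNIV "\<lambda>t. \<eta> (c t)"
          "\<lambda>t. pd_u \<eta> (c t) * (- r * sin t) + pd_v \<eta> (c t) * (r * cos t)" "r2 * B1 + r2 * B2" x y]
      by (simp add: c_def)
  qed
  then show ?thesis by blast
qed

lemma polar_exists:
  fixes q :: "real \<times> real"
  obtains t where "q = (norm q * cos t, norm q * sin t)"
proof (cases "q = 0")
  case True then show ?thesis using that by (simp add: zero_prod_def)
next
  case False
  then have "(fst q / norm q)\<^sup>2 + (snd q / norm q)\<^sup>2 = 1"
    by (simp only: power_divide add_divide_distrib[symmetric] norm_Pair_squared[symmetric]) simp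
  then obtain t where t: "fst q / norm q = cos t" "snd q / norm q = sin t" by (rule sincos_total_2pi)
  have "q = (norm q * cos t, norm q * sin t)" unfolding t[symmetric] using False by simp
  then show ?thesis by (rule that)
qed

text \<open>Along the orbits of \<open>spiral_field (- 1) \<eta>\<close> the radius is an explicit function of time,
  so only the scalar equation for the angle has to be solved.\<close>

lemma stable_topological_focus_spiral_field:
  assumes \<rho>: "\<rho> > 0" and \<eta>: "smooth_on (ball 0 \<rho> - {0}) \<eta>" and s: "\<bar>s\<bar> = 1"
    and lo: "\<And>p. p \<in> ball 0 \<rho> - {0} \<Longrightarrow> s * \<eta> p \<ge> m" and m: "m > 0"
    and hi: "\<And>p. p \<in> ball 0 \<rho> - {0} \<Longrightarrow> \<bar>\<eta> p\<bar> \<le> M"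
  shows "stable_topological_focus (spiral_field (- 1) \<eta>) 0"
  unfolding stable_topological_focus_def
proof (intro conjI allI impI)
  show "spiral_field (- 1) \<eta> 0 = 0" by (simp add: spiral_field_def zero_prod_def)
  fix W :: "(real \<times> real) set" assume "open W \<and> 0 \<in> W"
  then obtain \<epsilon> where \<epsilon>: "\<epsilon> > 0" "ball 0 \<epsilon> \<subseteq> W" using open_contains_ball by blast
  \<comment> \<open>The radius decreases along the orbits, so an orbit that starts in this ball
    stays in \<open>W\<close> and in the domain of \<open>\<eta>\<close>.\<close>
  define V where "V = ball (0 :: real \<times> real) (min \<epsilon> \<rho>)"
  have "\<exists>x \<theta>. x 0 = q \<and> integral_curve (spiral_field (- 1) \<eta>) {0..} x \<and> x ` {0..} \<subseteq> W - {0} \<and>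
      (x \<longlongrightarrow> 0) at_top \<and> angle_along {0..} x 0 \<theta> \<and> filterlim (\<lambda>t. \<bar>\<theta> t\<bar>) at_top at_top"
    if q: "q \<in> V - {0}" for q
  proof -
    define r where "r t = norm q * exp (- t)" for t :: real
    have r0: "norm q > 0" "norm q < \<epsilon>" "norm q < \<rho>" using q by (auto simp: V_def)
    have rpos: "r t > 0" for t using r0 by (simp add: r_def)
    have rle: "r t \<le> norm q" if "t \<ge> 0" for t
      using mult_left_mono[of "exp (- t)" 1 "norm q"] that r0 by (simp add: r_def)
    have normr: "norm (r t * cos a, r t * sin a) = r t" for t a
      by (rule norm_polar) (use rpos[of t] in simp)
    have in\<Omega>: "(r t * cos a, r t * sin a) \<in> ball 0 \<rho> - {0}" if "t \<ge> 0" for t a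
      using normr[of t a] rpos[of t] rle[OF that] r0
      by (metis Diff_iff dist_0_norm le_less_trans less_irrefl mem_ball norm_zero singletonD)
    obtain \<theta>0 where \<theta>0: "q = (norm q * cos \<theta>0, norm q * sin \<theta>0)" by (rule polar_exists)
    \<comment> \<open>The angular speed as a function of time and angle, with the known radius
      \<open>r t\<close> inserted.\<close>
    define G where "G t a = \<eta> (r t * cos a, r t * sin a)" for t a
    have "\<exists>\<theta>. \<theta> 0 = \<theta>0 \<and> (\<forall>t\<ge>0. (\<theta> has_real_derivative G t (\<theta> t)) (at t within {0..}))"
    proof (rule picard_global)
      show "continuous_on ({0..} \<times> UNIV) (\<lambda>p. G (fst p) (snd p))"
        unfolding G_def
        by (rule continuous_on_compose2[OF smooth_on_continuous_on[OF \<eta>]])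
          (use in\<Omega> in \<open>auto intro!: continuous_intros simp: r_def\<close>)
      show "\<bar>G t a\<bar> \<le> M" if "0 \<le> t" for t a
        unfolding G_def by (rule hi[OF in\<Omega>[OF that]])
      fix T :: real assume "T \<ge> 0"
      \<comment> \<open>Up to time \<open>T\<close> the radius stays between \<open>r T\<close> and
        \<open>norm q\<close>, an annulus away from the origin.\<close>
      obtain L where L: "\<forall>r\<in>{r T..norm q}. \<forall>x y. \<bar>\<eta> (r * cos x, r * sin x) - \<eta> (r * cos y, r * sin y)\<bar> \<le> L * \<bar>x - y\<bar>"
        using lipschitz_along_circles[OF \<eta> rpos r0(3)] by blast
      have "r t \<in> {r T..norm q}" if "t \<in> {0..T}" for t
        using that rle r0 by (auto simp: r_def)
      then show "\<exists>L. \<forall>t\<in>{0..T}. \<forall>x y. \<bar>G t x - G t y\<bar> \<le> L * \<bar>x - y\<bar>"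
        unfolding G_def using L by blast
    qed
    then obtain \<theta> where \<theta>: "\<theta> 0 = \<theta>0" "\<And>t. t \<ge> 0 \<Longrightarrow> (\<theta> has_real_derivative G t (\<theta> t)) (at t within {0..})"
      by blast
    define x where "x t = (r t * cos (\<theta> t), r t * sin (\<theta> t))" for t
    have x\<Omega>: "x t \<in> ball 0 \<rho> - {0}" if "t \<ge> 0" for t unfolding x_def by (rule in\<Omega>[OF that])
    have normx: "norm (x t) = r t" for t unfolding x_def by (rule normr)
    have rd: "(r has_real_derivative - r t) (at t within {0..})" for t
      unfolding r_def by (auto intro!: derivative_eq_intros)
    have "integral_curve (spiral_field (- 1) \<eta>) {0..} x"
      unfolding integral_curve_def
    proof
      fix t :: real assume "t \<in> {0..}"
      then have "((\<lambda>t. r t * cos (\<theta> t)) has_real_derivative - r t * cos (\<theta> t) - G t (\<theta> t) * (r t * sin (\<theta> t))) (at t within {0..})"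
        "((\<lambda>t. r t * sin (\<theta> t)) has_real_derivative - r t * sin (\<theta> t) + G t (\<theta> t) * (r t * cos (\<theta> t))) (at t within {0..})"
        by (auto intro!: derivative_eq_intros rd \<theta>(2))
      from has_vector_derivative_Pair[OF this[unfolded has_real_derivative_iff_has_vector_derivative]]
      show "(x has_vector_derivative spiral_field (- 1) \<eta> (x t)) (at t within {0..})"
        by (simp add: x_def[abs_def] spiral_field_def G_def)
    qed
    moreover have "x 0 = q" using \<theta>(1) \<theta>0 by (simp add: x_def r_def)
    moreover have "x ` {0..} \<subseteq> W - {0}"
    proof
      fix y assume "y \<in> x ` {0..}"
      then obtain t where t: "t \<ge> 0" "y = x t" by auto
      then have "norm y < \<epsilon>" using normx[of t] rle[of t] r0 by simp
      then show "y \<in> W - {0}" using x\<Omega>[of t] t \<epsilon>(2) by auto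
    qed
    moreover have "(x \<longlongrightarrow> 0) at_top"
    proof (rule tendsto_norm_zero_cancel)
      have "filterlim (\<lambda>t::real. - t) at_bot at_top" by (rule filterlim_uminus_at_bot_at_top)
      then have "((\<lambda>t::real. exp (- t)) \<longlongrightarrow> 0) at_top" by (rule filterlim_compose[OF exp_at_bot])
      then have "((\<lambda>t. norm q * exp (- t)) \<longlongrightarrow> norm q * 0) at_top" by (intro tendsto_intros)
      then show "((\<lambda>t. norm (x t)) \<longlongrightarrow> 0) at_top" unfolding normx r_def by simp
    qed
    moreover have "angle_along {0..} x 0 \<theta>"
    proof -
      have "continuous_on {0..} \<theta>"
        by (rule has_real_derivative_imp_continuous_on[of _ _ "\<lambda>t. G t (\<theta> t)"]) (simp add: \<theta>(2))
      then show ?thesis unfolding angle_along_def normx diff_zero by (simp add: x_def)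
    qed
    moreover have "filterlim (\<lambda>t. \<bar>\<theta> t\<bar>) at_top at_top"
    proof (rule filterlim_at_top_mono)
      show "filterlim (\<lambda>t. s * \<theta> t) at_top at_top"
        by (rule linear_growth_filterlim[OF \<theta>(2) _ m]) (auto simp: G_def intro!: lo in\<Omega>)
      have "s * a \<le> \<bar>a\<bar>" for a using abs_ge_self[of "s * a"] s by (simp add: abs_mult)
      then show "\<forall>\<^sub>F t in at_top. s * \<theta> t \<le> \<bar>\<theta> t\<bar>" by simp
    qed
    ultimately show ?thesis by blast
  qed
  moreover have "open V" "0 \<in> V" "V \<subseteq> W" using \<epsilon> \<rho> by (auto simp: V_def)
  ultimately show "\<exists>V. open V \<and> 0 \<in> V \<and> V \<subseteq> W \<and>
      (\<forall>q\<in>V - {0}. \<exists>x \<theta>. x 0 = q \<and> integral_curve (spiral_field (- 1) \<eta>) {0..} x \<and> x ` {0..} \<subseteq> W - {0} \<and>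
        (x \<longlongrightarrow> 0) at_top \<and> angle_along {0..} x 0 \<theta> \<and> filterlim (\<lambda>t. \<bar>\<theta> t\<bar>) at_top at_top)"
    by blast
qed

section \<open>Reduction to spiralling fields\<close>

text \<open>By the mean value theorem a derivative without zeros on an interval excludes repeated
  values, so \<open>inv_into I \<phi>\<close> is a true inverse.\<close>

lemma has_real_derivative_inv_into:
  fixes \<phi> :: "real \<Rightarrow> real"
  assumes I: "open I" "is_interval I"
    and der: "\<And>t. t \<in> I \<Longrightarrow> (\<phi> has_real_derivative \<phi>' t) (at t)" and nz: "\<And>t. t \<in> I \<Longrightarrow> \<phi>' t \<noteq> 0"
  shows "inj_on \<phi> I"
    and "t \<in> I \<Longrightarrow> (inv_into I \<phi> has_real_derivative inverse (\<phi>' t)) (at (\<phi> t))"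
proof -
  have ne: "\<phi> a \<noteq> \<phi> b" if "a \<in> I" "b \<in> I" "a < b" for a b
  proof
    assume "\<phi> a = \<phi> b"
    have ab: "z \<in> I" if "a \<le> z" "z \<le> b" for z
      using I(2) \<open>a \<in> I\<close> \<open>b \<in> I\<close> that unfolding is_interval_1 by blast
    have "\<exists>z. a < z \<and> z < b \<and> \<phi> b - \<phi> a = (b - a) * \<phi>' z"
      by (rule MVT2[OF that(3) der[OF ab]])
    then obtain z where z: "a < z" "z < b" "\<phi> b - \<phi> a = (b - a) * \<phi>' z" by blast
    have "\<phi>' z \<noteq> 0" by (rule nz[OF ab]) (use z in auto)
    then show False using z(3) \<open>\<phi> a = \<phi> b\<close> that(3) by simp
  qed
  show inj: "inj_on \<phi> I" unfolding inj_on_def using ne by (metis linorder_neqE)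
  assume t: "t \<in> I"
  have "continuous_on I \<phi>" using der by (meson DERIV_isCont continuous_at_imp_continuous_on)
  then have "(inv_into I \<phi> has_derivative (*) (inverse (\<phi>' t))) (at (\<phi> t))"
    using der[OF t] nz[OF t] inv_into_f_f[OF inj]
    by (intro has_derivative_inverse_strong[OF I(1) t, of \<phi> _ "(*) (\<phi>' t)"])
      (auto simp: has_field_derivative_def fun_eq_iff)
  then show "(inv_into I \<phi> has_real_derivative inverse (\<phi>' t)) (at (\<phi> t))"
    by (simp add: has_field_derivative_def)
qed

text \<open>If \<open>c' = \<lambda> Y\<close> for \<open>Y = spiral_field \<sigma> \<eta>\<close>, then \<open>\<sigma> ln \<bar>c\<bar>\<close> has derivative \<open>\<lambda>\<close>,
  so it is the time along the orbit.\<close>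

lemma orbit_arc_spiral_field_iff:
  assumes \<sigma>: "\<sigma> * \<sigma> = 1" and I: "open I" "is_interval I" and nz: "\<And>t. t \<in> I \<Longrightarrow> c t \<noteq> 0"
  shows "orbit_arc (spiral_field \<sigma> \<eta>) I c \<longleftrightarrow>
    (\<exists>l. continuous_on I l \<and> (\<forall>t\<in>I. (c has_vector_derivative l t *\<^sub>R spiral_field \<sigma> \<eta> (c t)) (at t) \<and> l t \<noteq> 0))"
    (is "?L \<longleftrightarrow> ?R")
proof
  assume ?L
  then obtain \<phi> \<phi>' x where *: "continuous_on I \<phi>'"
      "\<And>t. t \<in> I \<Longrightarrow> (\<phi> has_vector_derivative \<phi>' t) (at t) \<and> \<phi>' t \<noteq> 0"
      "integral_curve (spiral_field \<sigma> \<eta>) (\<phi> ` I) x" "\<And>t. t \<in> I \<Longrightarrow> c t = x (\<phi> t)"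
    unfolding orbit_arc_def by blast
  have "(c has_vector_derivative \<phi>' t *\<^sub>R spiral_field \<sigma> \<eta> (c t)) (at t)" if t: "t \<in> I" for t
  proof (rule has_vector_derivative_transform_within_open[OF _ I(1) t])
    have "(x \<circ> \<phi> has_vector_derivative \<phi>' t *\<^sub>R spiral_field \<sigma> \<eta> (x (\<phi> t))) (at t within I)"
      using * t by (intro vector_diff_chain_within) (auto simp: integral_curve_def intro: has_vector_derivative_at_within)
    then show "(x \<circ> \<phi> has_vector_derivative \<phi>' t *\<^sub>R spiral_field \<sigma> \<eta> (c t)) (at t)"
      using *(4)[OF t] at_within_open[OF t I(1)] by simp
  qed (use *(4) in auto)
  then show ?R using * by blast
next
  assume ?R
  then obtain l where l: "continuous_on I l"
      "\<And>t. t \<in> I \<Longrightarrow> (c has_vector_derivative l t *\<^sub>R spiral_field \<sigma> \<eta> (c t)) (at t)" "\<And>t. t \<in> I \<Longrightarrow> l t \<noteq> 0"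
    by blast
  \<comment> \<open>This is \<open>\<sigma> ln (norm (c t))\<close>, with half the logarithm of the
    squared norm in place of a square root. Its derivative is
    \<open>\<sigma> * \<sigma> * l t\<close>, hence \<open>l t\<close>.\<close>
  define \<phi> where "\<phi> t = \<sigma> * (ln ((fst (c t))\<^sup>2 + (snd (c t))\<^sup>2) / 2)" for t
  have \<phi>: "(\<phi> has_real_derivative l t) (at t)" if t: "t \<in> I" for t
  proof -
    define a b where "a = fst (c t)" and "b = snd (c t)"
    have pos: "a\<^sup>2 + b\<^sup>2 > 0"
      using norm_Pair_squared[of "c t"] nz[OF t] unfolding a_def b_def by (metis zero_less_norm_iff zero_less_power)
    have d: "((\<lambda>t. fst (c t)) has_real_derivative l t * (\<sigma> * a - \<eta> (c t) * b)) (at t)"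
      "((\<lambda>t. snd (c t)) has_real_derivative l t * (\<sigma> * b + \<eta> (c t) * a)) (at t)"
      using has_vector_derivative_fst_snd[OF l(2)[OF t]] by (simp_all add: spiral_field_def a_def b_def)
    have "((\<lambda>t. (fst (c t))\<^sup>2 + (snd (c t))\<^sup>2) has_real_derivative 2 * (l t * \<sigma>) * (a\<^sup>2 + b\<^sup>2)) (at t)"
      by (auto intro!: derivative_eq_intros d simp: a_def[symmetric] b_def[symmetric] power2_eq_square algebra_simps)
    from DERIV_ln_divide[OF pos] this
    have "((\<lambda>t. ln ((fst (c t))\<^sup>2 + (snd (c t))\<^sup>2)) has_real_derivative (1 / (a\<^sup>2 + b\<^sup>2)) * (2 * (l t * \<sigma>) * (a\<^sup>2 + b\<^sup>2))) (at t)"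
      unfolding a_def b_def by (rule DERIV_chain2)
    note ln = this
    have "((\<lambda>t. ln ((fst (c t))\<^sup>2 + (snd (c t))\<^sup>2)) has_real_derivative 2 * (l t * \<sigma>)) (at t)"
    proof -
      have "1 / S * (2 * k * S) = 2 * k" if "S > 0" for S k :: real using that by simp
      from ln[unfolded this[OF pos]] show ?thesis .
    qed
    from DERIV_cmult[OF DERIV_cdivide[OF this, of 2], of \<sigma>]
    show ?thesis using \<sigma> by (simp add: \<phi>_def[abs_def] mult.left_commute[of \<sigma>])
  qed
  note inv = has_real_derivative_inv_into[OF I \<phi> l(3)]
  define x where "x = c \<circ> inv_into I \<phi>"
  have inv_f: "inv_into I \<phi> (\<phi> t) = t" if "t \<in> I" for t using inv_into_f_f[OF inv(1) that] .
  have "(x has_vector_derivative spiral_field \<sigma> \<eta> (x (\<phi> t))) (at (\<phi> t))" if t: "t \<in> I" for t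
  proof -
    have "(inv_into I \<phi> has_vector_derivative inverse (l t)) (at (\<phi> t))"
      using inv(2)[OF _ _ t] by (simp add: has_real_derivative_iff_has_vector_derivative)
    moreover have "(c has_vector_derivative l t *\<^sub>R spiral_field \<sigma> \<eta> (c t)) (at (inv_into I \<phi> (\<phi> t)))"
      using l(2)[OF t] by (simp add: inv_f t)
    ultimately have "(x has_vector_derivative inverse (l t) *\<^sub>R l t *\<^sub>R spiral_field \<sigma> \<eta> (c t)) (at (\<phi> t))"
      unfolding x_def by (rule vector_diff_chain_at)
    then show ?thesis using l(3)[OF t] by (simp add: x_def inv_f t)
  qed
  then have "integral_curve (spiral_field \<sigma> \<eta>) (\<phi> ` I) x"
    by (auto simp: integral_curve_def intro: has_vector_derivative_at_within)
  moreover have "\<forall>t\<in>I. c t = x (\<phi> t)" by (simp add: x_def inv_f)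
  ultimately show ?L
    unfolding orbit_arc_def using l(1,3) \<phi>[unfolded has_real_derivative_iff_has_vector_derivative]
    by - (rule exI[of _ \<phi>], rule exI[of _ l], rule exI[of _ x], simp)
qed

text \<open>The extra order of the remainder absorbs its constant: \<open>C * norm p\<close> is at
  most \<open>\<epsilon>\<close> once \<open>norm p < \<epsilon> / C\<close>.\<close>

lemma eventually_leading_bound:
  assumes "leading n f f0" "\<epsilon> > 0"
  shows "\<forall>\<^sub>F p in nhds 0. \<bar>f p - f0 p\<bar> \<le> \<epsilon> * norm p ^ n"
proof -
  obtain C where C: "C > 0" "\<forall>\<^sub>F p in nhds 0. norm (f p - f0 p) \<le> C * norm (norm p ^ Suc n)"
    using assms(1) unfolding leading_def by (auto elim!: landau_o.bigE)
  have "\<forall>\<^sub>F p :: real \<times> real in nhds 0. norm p < \<epsilon> / C"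
    using eventually_nhds_ball[of "\<epsilon> / C" "0 :: real \<times> real"] C assms(2) by simp
  with C(2) show ?thesis
  proof eventually_elim
    case (elim p)
    have "\<bar>f p - f0 p\<bar> \<le> (C * norm p) * norm p ^ n" using elim by (simp add: mult_ac)
    also have "\<dots> \<le> \<epsilon> * norm p ^ n"
      using elim C by (intro mult_right_mono) (auto simp: field_simps)
    finally show ?case .
  qed
qed

section \<open>The two roots of the form and the regularity of the fields they define\<close>

lemma quadratic_form_factorization:
  fixes a b c s x y :: real
  assumes "c \<noteq> 0" "s * s = b * b - a * c"
  shows "a * (x * x) + 2 * b * (x * y) + c * (y * y) = c * ((y + (b + s) / c * x) * (y - (s - b) / c * x))"
proof -
  have "c * ((y + (b + s) / c * x) * (y - (s - b) / c * x)) = c * (y * y) + 2 * b * (x * y) + (b * b - s * s) / c * (x * x)"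
    using assms(1) by (simp add: field_simps)
  also have "(b * b - s * s) / c = a" using assms by (simp add: field_simps)
  finally show ?thesis by simp
qed

text \<open>Continuity at the origin follows from a bound on \<open>\<eta>\<close> alone, because
  \<open>\<eta>\<close> is multiplied by coordinates that tend to 0.\<close>

lemma continuous_on_spiral_field:
  assumes \<eta>: "continuous_on (ball 0 \<rho> - {0}) \<eta>" and hi: "\<And>p. p \<in> ball 0 \<rho> - {0} \<Longrightarrow> \<bar>\<eta> p\<bar> \<le> M"
  shows "continuous_on (ball 0 \<rho>) (spiral_field \<sigma> \<eta>)"
proof -
  have "isCont (spiral_field \<sigma> \<eta>) p" if p: "p \<in> ball 0 \<rho>" for p
  proof (cases "p = 0")
    case False
    have "continuous_on (ball 0 \<rho> - {0}) (spiral_field \<sigma> \<eta>)"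
      unfolding spiral_field_def[abs_def] by (intro continuous_intros \<eta>)
    moreover have "open (ball 0 \<rho> - {0 :: real \<times> real})" by auto
    ultimately show ?thesis
      using p False continuous_on_eq_continuous_at by blast
  next
    case True
    have "(spiral_field \<sigma> \<eta> \<longlongrightarrow> 0) (at 0)"
    proof (rule Lim_null_comparison)
      have "((\<lambda>p :: real \<times> real. (2 * \<bar>\<sigma>\<bar> + 2 * M) * norm p) \<longlongrightarrow> (2 * \<bar>\<sigma>\<bar> + 2 * M) * norm (0 :: real \<times> real)) (at 0)"
        by (intro tendsto_intros)
      then show "((\<lambda>p :: real \<times> real. (2 * \<bar>\<sigma>\<bar> + 2 * M) * norm p) \<longlongrightarrow> 0) (at 0)" by simp
      have "norm (spiral_field \<sigma> \<eta> q) \<le> (2 * \<bar>\<sigma>\<bar> + 2 * M) * norm q" if q: "q \<in> ball 0 \<rho> - {0}" for q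
      proof -
        have n: "\<bar>fst q\<bar> \<le> norm q" "\<bar>snd q\<bar> \<le> norm q"
          using norm_fst_le[of "fst q" "snd q"] norm_snd_le[of "snd q" "fst q"] by simp_all
        have M: "M \<ge> 0" using hi[OF q] by simp
        have "norm (spiral_field \<sigma> \<eta> q) \<le> \<bar>\<sigma> * fst q - \<eta> q * snd q\<bar> + \<bar>\<sigma> * snd q + \<eta> q * fst q\<bar>"
          unfolding spiral_field_def using norm_Pair_le by (metis real_norm_def)
        also have "\<dots> \<le> (\<bar>\<sigma>\<bar> * \<bar>fst q\<bar> + \<bar>\<eta> q\<bar> * \<bar>snd q\<bar>) + (\<bar>\<sigma>\<bar> * \<bar>snd q\<bar> + \<bar>\<eta> q\<bar> * \<bar>fst q\<bar>)"
          unfolding abs_mult[symmetric] by (intro add_mono abs_triangle_ineq4 abs_triangle_ineq)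
        also have "\<dots> \<le> (\<bar>\<sigma>\<bar> * norm q + M * norm q) + (\<bar>\<sigma>\<bar> * norm q + M * norm q)"
          using n hi[OF q] M by (intro add_mono mult_mono) auto
        finally show ?thesis by (simp add: algebra_simps)
      qed
      moreover have "\<rho> > 0" using p by (auto intro: le_less_trans[OF norm_ge_zero])
      ultimately show "\<forall>\<^sub>F q in at 0. norm (spiral_field \<sigma> \<eta> q) \<le> (2 * \<bar>\<sigma>\<bar> + 2 * M) * norm q"
        unfolding eventually_at by (intro exI[of _ \<rho>]) auto
    qed
    moreover have "spiral_field \<sigma> \<eta> 0 = 0" by (simp add: spiral_field_def zero_prod_def)
    ultimately show ?thesis using True by (simp add: isCont_def)
  qed
  then show ?thesis by (rule continuous_at_imp_continuous_on[rule_format])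
qed

lemma smooth_on_spiral_field:
  assumes "open U" "smooth_on U \<eta>"
  shows "smooth_on U (spiral_field \<sigma> \<eta>)"
  unfolding spiral_field_def[abs_def] by (intro smooth_intros assms)

lemma angular_velocity_spiral_field:
  assumes "p \<noteq> 0"
  shows "angular_velocity (spiral_field \<sigma> \<eta>) p = \<eta> p"
proof -
  have "fst p * (\<sigma> * snd p + \<eta> p * fst p) - snd p * (\<sigma> * fst p - \<eta> p * snd p) = \<eta> p * (norm p)\<^sup>2"
    unfolding norm_Pair_squared by (simp add: power2_eq_square algebra_simps)
  then show ?thesis using assms by (simp add: angular_velocity_def spiral_field_def)
qed

text \<open>In the model case \<open>a = - 3 m\<close>, \<open>b = 0\<close>, \<open>c = 4 m\<close>
  one has \<open>s = sqrt 12 * m\<close>, and both roots equal \<open>sqrt 3 / 2\<close>. The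
  tolerance \<open>m / 10\<close> keeps \<open>s\<close> between \<open>3 m\<close> and
  \<open>4 m\<close>, and hence the roots between \<open>1 / 2\<close> and \<open>2\<close>.\<close>

lemma root_bounds:
  fixes a b c m :: real
  assumes m: "m > 0" and a: "\<bar>a + 3 * m\<bar> \<le> m / 10" and b: "\<bar>b\<bar> \<le> m / 10" and c: "\<bar>c - 4 * m\<bar> \<le> m / 10"
  defines "s \<equiv> sqrt (b * b - a * c)"
  shows "b * b - a * c > 0" "c > 0"
    and "1 / 2 \<le> (b + s) / c" "(b + s) / c \<le> 2" "1 / 2 \<le> (s - b) / c" "(s - b) / c \<le> 2"
proof -
  have c1: "39 / 10 * m \<le> c" "c \<le> 41 / 10 * m" and a1: "29 / 10 * m \<le> - a" "- a \<le> 31 / 10 * m"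
    and b1: "b \<le> m / 10" "- b \<le> m / 10"
    using a b c unfolding abs_le_iff by auto
  show c0: "c > 0" using c1 m by linarith
  have ac: "(29 / 10 * m) * (39 / 10 * m) \<le> (- a) * c" "(- a) * c \<le> (31 / 10 * m) * (41 / 10 * m)"
    using a1 c1 m by (intro mult_mono; linarith)+
  have bb: "b * b \<le> (m / 10) * (m / 10)"
    using mult_mono[OF b b] m by (simp flip: abs_mult)
  have mm: "m * m > 0" using m by simp
  have d: "9 * (m * m) \<le> b * b - a * c" "b * b - a * c \<le> 16 * (m * m)"
  proof -
    \<comment> \<open>\<open>1131 = 29 * 39\<close> and \<open>1271 = 31 * 41\<close>, from the
      extreme values of \<open>- a\<close> and \<open>c\<close>.\<close>
    have "1131 / 100 * (m * m) \<le> - (a * c)" "- (a * c) \<le> 1271 / 100 * (m * m)" "b * b \<le> 1 / 100 * (m * m)"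
      using ac bb by simp_all
    then show "9 * (m * m) \<le> b * b - a * c" "b * b - a * c \<le> 16 * (m * m)"
      using mm zero_le_square[of b] by linarith+
  qed
  then show "b * b - a * c > 0" using mm by linarith
  have "sqrt (9 * (m * m)) \<le> s" "s \<le> sqrt (16 * (m * m))"
    unfolding s_def using d by (auto intro: real_sqrt_le_mono)
  moreover have "sqrt (9 * (m * m)) = 3 * m" "sqrt (16 * (m * m)) = 4 * m"
    using m by (auto intro!: real_sqrt_unique simp: power2_eq_square)
  ultimately have s: "3 * m \<le> s" "s \<le> 4 * m" by simp_all
  show "1 / 2 \<le> (b + s) / c" "(b + s) / c \<le> 2" "1 / 2 \<le> (s - b) / c" "(s - b) / c \<le> 2"
    using c0 s b1 c1 m by (simp_all add: field_simps)
qed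

text \<open>Coefficients of the quadratic form of the extended equation in the frame formed by the radial
  vector \<open>(u, v)\<close> and its rotation \<open>(- v, u)\<close>.\<close>

definition radial_coeff where
  "radial_coeff A B C p = A p * (fst p * fst p) + 2 * (B p * (fst p * snd p)) + C p * (snd p * snd p)"

definition mixed_coeff where
  "mixed_coeff A B C p = (C p - A p) * (fst p * snd p) + B p * (fst p * fst p - snd p * snd p)"

definition angular_coeff where
  "angular_coeff A B C p = A p * (snd p * snd p) - 2 * (B p * (fst p * snd p)) + C p * (fst p * fst p)"

text \<open>With \<open>P = p\<close> and \<open>P'\<close> its rotation, \<open>norm p ^ 2\<close>
  times \<open>w\<close> equals \<open>x P + y P'\<close>. Inserting this into a form homogeneous of
  degree two produces the factor \<open>norm p ^ 4\<close>.\<close>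

lemma quadratic_form_in_radial_frame:
  fixes A B C :: "real \<times> real \<Rightarrow> real" and w p :: "real \<times> real"
  defines "x \<equiv> fst p * fst w + snd p * snd w" and "y \<equiv> fst p * snd w - snd p * fst w"
  shows "(A p * (fst w)\<^sup>2 + 2 * B p * fst w * snd w + C p * (snd w)\<^sup>2) * (fst p * fst p + snd p * snd p)\<^sup>2 =
    radial_coeff A B C p * (x * x) + 2 * mixed_coeff A B C p * (x * y) + angular_coeff A B C p * (y * y)"
  unfolding x_def y_def radial_coeff_def mixed_coeff_def angular_coeff_def
  by (simp add: power2_eq_square algebra_simps)

text \<open>The change of frame has determinant \<open>norm p ^ 2\<close>, and the discriminant is
  multiplied by the square of the determinant.\<close>

lemma discriminant_in_radial_frame:
  fixes A B C :: "real \<times> real \<Rightarrow> real"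
  shows "mixed_coeff A B C p * mixed_coeff A B C p - radial_coeff A B C p * angular_coeff A B C p =
    (B p * B p - A p * C p) * (fst p * fst p + snd p * snd p)\<^sup>2"
  unfolding radial_coeff_def mixed_coeff_def angular_coeff_def
  by (simp add: power2_eq_square algebra_simps)

lemma radial_frame_components:
  fixes p w :: "real \<times> real"
  defines "x \<equiv> fst p * fst w + snd p * snd w" and "y \<equiv> fst p * snd w - snd p * fst w"
  shows "(fst p * fst p + snd p * snd p) * fst w = fst p * x - snd p * y"
    "(fst p * fst p + snd p * snd p) * snd w = snd p * x + fst p * y"
  unfolding x_def y_def by (simp_all add: algebra_simps)

section \<open>Asymptotic lines as orbit arcs of one of the two fields\<close>

text \<open>At each time the velocity lies on one of two lines; the point is that the choice cannot
  change along the curve. The slope \<open>y / x\<close> in the radial frame is continuous and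
  equals either \<open>- \<eta>1 < 0\<close> or \<open>\<eta>2 > 0\<close>, so on an interval it
  keeps its sign.\<close>

lemma affine_asymptotic_line_iff:
  fixes h :: "real \<times> real \<Rightarrow> real"
  assumes factor: "\<And>p w. p \<in> \<Omega> \<Longrightarrow>
      coeff_A h p * (fst w)\<^sup>2 + 2 * coeff_B h p * fst w * snd w + coeff_C h p * (snd w)\<^sup>2 = 0 \<longleftrightarrow>
      (let x = fst p * fst w + snd p * snd w; y = fst p * snd w - snd p * fst w in y = - \<eta>1 p * x \<or> y = \<eta>2 p * x)"
    and pos: "\<And>p. p \<in> \<Omega> \<Longrightarrow> \<eta>1 p > 0" "\<And>p. p \<in> \<Omega> \<Longrightarrow> \<eta>2 p > 0"
    and cont: "continuous_on \<Omega> \<eta>1" "continuous_on \<Omega> \<eta>2" and nz: "0 \<notin> \<Omega>"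
    and I: "open I" "is_interval I" and c: "c ` I \<subseteq> \<Omega>"
  shows "affine_asymptotic_line h I c \<longleftrightarrow>
    orbit_arc (spiral_field (- 1) \<eta>1) I c \<or> orbit_arc (spiral_field 1 \<eta>2) I c"
proof
  define n where "n p = fst p * fst p + snd p * snd p" for p :: "real \<times> real"
  have n: "n p > 0" if "p \<in> \<Omega>" for p
    using that nz norm_Pair_squared[of p] unfolding n_def power2_eq_square
    by (metis mult_pos_pos zero_less_norm_iff)
  have c\<Omega>: "c t \<in> \<Omega>" if "t \<in> I" for t using c that by auto
  then have cnz: "c t \<noteq> 0" if "t \<in> I" for t using nz that by metis
  have orb: "orbit_arc (spiral_field \<sigma> \<eta>) I c \<longleftrightarrow>
      (\<exists>l. continuous_on I l \<and> (\<forall>t\<in>I. (c has_vector_derivative l t *\<^sub>R spiral_field \<sigma> \<eta> (c t)) (at t) \<and> l t \<noteq> 0))"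
    if "\<sigma> * \<sigma> = 1" for \<sigma> \<eta>
    by (rule orbit_arc_spiral_field_iff[OF that I cnz])
  {
    assume "affine_asymptotic_line h I c"
    then obtain c' where c': "continuous_on I c'" "\<And>t. t \<in> I \<Longrightarrow> (c has_vector_derivative c' t) (at t)"
      "\<And>t. t \<in> I \<Longrightarrow> c' t \<noteq> 0"
      "\<And>t. t \<in> I \<Longrightarrow> coeff_A h (c t) * (fst (c' t))\<^sup>2 + 2 * coeff_B h (c t) * fst (c' t) * snd (c' t) + coeff_C h (c t) * (snd (c' t))\<^sup>2 = 0"
      unfolding affine_asymptotic_line_def by blast
    define x where "x t = fst (c t) * fst (c' t) + snd (c t) * snd (c' t)" for t
    define y where "y t = fst (c t) * snd (c' t) - snd (c t) * fst (c' t)" for t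
    have cc: "continuous_on I c"
      using c'(2) by (meson continuous_at_imp_continuous_on has_vector_derivative_continuous)
    have xy: "continuous_on I x" "continuous_on I y"
      unfolding x_def[abs_def] y_def[abs_def] by (intro continuous_intros cc c'(1))+
    have nc: "continuous_on I (\<lambda>t. n (c t))" unfolding n_def by (intro continuous_intros cc)
    have alt: "y t = - \<eta>1 (c t) * x t \<or> y t = \<eta>2 (c t) * x t" if "t \<in> I" for t
      using c'(4)[OF that] factor[OF c\<Omega>[OF that], of "c' t"] by (simp add: x_def y_def Let_def)
    have comp: "n (c t) * fst (c' t) = fst (c t) * x t - snd (c t) * y t"
      "n (c t) * snd (c' t) = snd (c t) * x t + fst (c t) * y t" for t
      unfolding n_def x_def y_def by (rule radial_frame_components)+
    \<comment> \<open>An asymptotic direction is never purely angular: \<open>x = 0\<close> would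
      force \<open>y = 0\<close> and thus a zero velocity.\<close>
    have x0: "x t \<noteq> 0" if t: "t \<in> I" for t
    proof
      assume "x t = 0"
      then have "y t = 0" using alt[OF t] by auto
      then have "fst (c' t) = 0" "snd (c' t) = 0" using comp[of t] \<open>x t = 0\<close> n[OF c\<Omega>[OF t]] by auto
      then show False using c'(3)[OF t] by (simp add: prod_eq_iff)
    qed
    have g: "continuous_on I (\<lambda>t. y t / x t)" using x0 by (intro continuous_intros xy) auto
    have g_alt: "y t / x t = - \<eta>1 (c t) \<or> y t / x t = \<eta>2 (c t)" if "t \<in> I" for t
      using alt[OF that] x0[OF that] by auto
    have "connected ((\<lambda>t. y t / x t) ` I)"
      by (rule connected_continuous_image[OF g]) (use I(2) is_interval_connected_1 in blast)
    then have intv: "is_interval ((\<lambda>t. y t / x t) ` I)" by (simp only: is_interval_connected_1)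
    have g0: "y t / x t \<noteq> 0" if "t \<in> I" for t
      using g_alt[OF that] pos[OF c\<Omega>[OF that]] by auto
    have sgn: "\<not> (y t1 / x t1 < 0 \<and> y t2 / x t2 > 0)" if t: "t1 \<in> I" "t2 \<in> I" for t1 t2
    proof
      assume *: "y t1 / x t1 < 0 \<and> y t2 / x t2 > 0"
      have "0 \<in> (\<lambda>t. y t / x t) ` I"
        by (rule mem_is_interval_1_I[OF intv imageI[OF t(1)] imageI[OF t(2)]])
          (simp_all only: * less_imp_le)
      then obtain t where "t \<in> I" "0 = y t / x t" by (rule imageE)
      then show False using g0 by metis
    qed
    consider (one) "\<forall>t\<in>I. y t = - \<eta>1 (c t) * x t" | (two) "\<forall>t\<in>I. y t = \<eta>2 (c t) * x t"
    proof (cases "\<exists>t\<in>I. y t / x t > 0")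
      case True
      then have "y t = \<eta>2 (c t) * x t" if "t \<in> I" for t
      proof -
        obtain t' where "t' \<in> I" "y t' / x t' > 0" using True by blast
        then have "\<not> y t / x t < 0" using sgn[OF that] by blast
        moreover have "y t / x t < 0" if "y t / x t = - \<eta>1 (c t)" unfolding that using pos(1)[OF c\<Omega>[OF \<open>t \<in> I\<close>]] by simp
        ultimately have "y t / x t = \<eta>2 (c t)" using g_alt[OF that] by blast
        then show ?thesis using x0[OF that] by (simp add: field_simps)
      qed
      then show ?thesis using that(2) by blast
    next
      case False
      then have "y t = - \<eta>1 (c t) * x t" if "t \<in> I" for t
      proof -
        have "\<not> y t / x t > 0" using False that by blast
        then have "y t / x t = - \<eta>1 (c t)" using g_alt[OF that] pos(2)[OF c\<Omega>[OF that]] by metis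
        then show ?thesis using x0[OF that] by (simp add: field_simps)
      qed
      then show ?thesis using that(1) by blast
    qed
    then show "orbit_arc (spiral_field (- 1) \<eta>1) I c \<or> orbit_arc (spiral_field 1 \<eta>2) I c"
    proof cases
      case one
      \<comment> \<open>If \<open>c' = l Y1\<close>, the radial component gives
        \<open>x = - l n\<close>, which determines the factor \<open>l\<close>. For
        \<open>Y2\<close> the sign is reversed.\<close>
      have "continuous_on I (\<lambda>t. - x t / n (c t))"
        using n[OF c\<Omega>] by (intro continuous_intros xy nc) (metis less_irrefl)
      moreover have "c' t = (- x t / n (c t)) *\<^sub>R spiral_field (- 1) \<eta>1 (c t)" if t: "t \<in> I" for t
        using comp[of t] n[OF c\<Omega>[OF t]] one[rule_format, OF t]
        by (simp add: prod_eq_iff spiral_field_def field_simps)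
      moreover have "- x t / n (c t) \<noteq> 0" if t: "t \<in> I" for t
        using x0[OF t] n[OF c\<Omega>[OF t]] by simp
      ultimately have "orbit_arc (spiral_field (- 1) \<eta>1) I c"
        using c'(2) by (subst orb) (auto intro!: exI[of _ "\<lambda>t. - x t / n (c t)"])
      then show ?thesis ..
    next
      case two
      have "continuous_on I (\<lambda>t. x t / n (c t))"
        using n[OF c\<Omega>] by (intro continuous_intros xy nc) (metis less_irrefl)
      moreover have "c' t = (x t / n (c t)) *\<^sub>R spiral_field 1 \<eta>2 (c t)" if t: "t \<in> I" for t
        using comp[of t] n[OF c\<Omega>[OF t]] two[rule_format, OF t]
        by (simp add: prod_eq_iff spiral_field_def field_simps)
      moreover have "x t / n (c t) \<noteq> 0" if t: "t \<in> I" for t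
        using x0[OF t] n[OF c\<Omega>[OF t]] by simp
      ultimately have "orbit_arc (spiral_field 1 \<eta>2) I c"
        using c'(2) by (subst orb) (auto intro!: exI[of _ "\<lambda>t. x t / n (c t)"])
      then show ?thesis ..
    qed
  }
  \<comment> \<open>Both fields are treated at once: \<open>spiral_field \<sigma> \<eta>\<close> has
    slope \<open>\<eta> / \<sigma> = \<eta> * \<sigma>\<close> in the radial frame, and the
    assumption says that this is \<open>- \<eta>1\<close> or \<open>\<eta>2\<close>.\<close>
  have conv: "affine_asymptotic_line h I c"
    if \<sigma>: "\<sigma> * \<sigma> = 1" and \<eta>c: "continuous_on \<Omega> \<eta>" and \<eta>: "\<And>p. p \<in> \<Omega> \<Longrightarrow> \<eta> p = - \<eta>1 p * \<sigma> \<or> \<eta> p = \<eta>2 p * \<sigma>"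
      and arc: "orbit_arc (spiral_field \<sigma> \<eta>) I c" for \<sigma> \<eta>
  proof -
    obtain l where l: "continuous_on I l"
      "\<And>t. t \<in> I \<Longrightarrow> (c has_vector_derivative l t *\<^sub>R spiral_field \<sigma> \<eta> (c t)) (at t)" "\<And>t. t \<in> I \<Longrightarrow> l t \<noteq> 0"
      using orb[OF \<sigma>, THEN iffD1, OF arc] by blast
    have cc: "continuous_on I c"
      using l(2) by (meson continuous_at_imp_continuous_on has_vector_derivative_continuous)
    have "continuous_on I (\<lambda>t. \<eta> (c t))"
      using continuous_on_compose2[OF \<eta>c cc c] .
    then have cont': "continuous_on I (\<lambda>t. l t *\<^sub>R spiral_field \<sigma> \<eta> (c t))"
      unfolding spiral_field_def by (intro continuous_intros l(1) cc)
    have fr: "fst p * fst (l *\<^sub>R spiral_field \<sigma> \<eta> p) + snd p * snd (l *\<^sub>R spiral_field \<sigma> \<eta> p) = l * \<sigma> * n p"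
      "fst p * snd (l *\<^sub>R spiral_field \<sigma> \<eta> p) - snd p * fst (l *\<^sub>R spiral_field \<sigma> \<eta> p) = l * \<eta> p * n p" for l p
      by (simp_all add: spiral_field_def n_def algebra_simps)
    have "l t *\<^sub>R spiral_field \<sigma> \<eta> (c t) \<noteq> 0" if t: "t \<in> I" for t
    proof
      assume z: "l t *\<^sub>R spiral_field \<sigma> \<eta> (c t) = 0"
      have "l t * \<sigma> * n (c t) = 0" using fr(1)[of "c t" "l t"] unfolding z by simp
      then show False using l(3)[OF t] n[OF c\<Omega>[OF t]] \<sigma> by auto
    qed
    moreover have "coeff_A h (c t) * (fst (l t *\<^sub>R spiral_field \<sigma> \<eta> (c t)))\<^sup>2 +
        2 * coeff_B h (c t) * fst (l t *\<^sub>R spiral_field \<sigma> \<eta> (c t)) * snd (l t *\<^sub>R spiral_field \<sigma> \<eta> (c t)) +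
        coeff_C h (c t) * (snd (l t *\<^sub>R spiral_field \<sigma> \<eta> (c t)))\<^sup>2 = 0" if t: "t \<in> I" for t
      unfolding factor[OF c\<Omega>[OF t]] fr Let_def using \<eta>[OF c\<Omega>[OF t]] by (auto simp: mult_ac)
    ultimately show ?thesis
      unfolding affine_asymptotic_line_def using cont' l(2)
      by (intro exI[of _ "\<lambda>t. l t *\<^sub>R spiral_field \<sigma> \<eta> (c t)"]) blast
  qed
  assume "orbit_arc (spiral_field (- 1) \<eta>1) I c \<or> orbit_arc (spiral_field 1 \<eta>2) I c"
  then show "affine_asymptotic_line h I c"
    using conv[of "- 1" \<eta>1] conv[of 1 \<eta>2] cont by auto
qed

text \<open>The leading quadratic form is \<open>k (- 3 x^2 + 4 y^2)\<close>, where \<open>x\<close>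
  is the dot product and \<open>y\<close> the cross product of \<open>p\<close> with the direction.
  It is therefore diagonal in the radial frame, and since the frame vectors have length
  \<open>norm p\<close>, its coefficients acquire the factor \<open>norm p ^ 4\<close>.\<close>

lemma leading_radial_frame:
  fixes A B C :: "real \<times> real \<Rightarrow> real"
  assumes "leading 2 A (\<lambda>p. k * (- 3 * fst p ^ 2 + 4 * snd p ^ 2))"
    and "leading 2 B (\<lambda>p. k * (- 7 * fst p * snd p))"
    and "leading 2 C (\<lambda>p. k * (4 * fst p ^ 2 - 3 * snd p ^ 2))"
  shows "leading 4 (radial_coeff A B C) (\<lambda>p. - 3 * (k * norm p ^ 4))"
    and "leading 4 (mixed_coeff A B C) (\<lambda>p. 0)"
    and "leading 4 (angular_coeff A B C) (\<lambda>p. 4 * (k * norm p ^ 4))"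
proof -
  have n: "norm p ^ 4 = (fst p * fst p + snd p * snd p) * (fst p * fst p + snd p * snd p)" for p :: "real \<times> real"
    using norm_Pair_squared[of p] by (simp add: power2_eq_square eval_nat_numeral mult.assoc)
  have four: "(2::nat) + (1 + 1) = 4" by simp
  have "leading (2 + (1 + 1)) (radial_coeff A B C) (\<lambda>p. k * (- 3 * fst p ^ 2 + 4 * snd p ^ 2) * (fst p * fst p)
      + 2 * (k * (- 7 * fst p * snd p) * (fst p * snd p)) + k * (4 * fst p ^ 2 - 3 * snd p ^ 2) * (snd p * snd p))"
    unfolding radial_coeff_def[abs_def] by (intro leading_add leading_cmult leading_mult assms leading_fst leading_snd)
  then show "leading 4 (radial_coeff A B C) (\<lambda>p. - 3 * (k * norm p ^ 4))"
    unfolding four by (rule leading_cong) (simp add: fun_eq_iff n power2_eq_square algebra_simps)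
  have "leading (2 + (1 + 1)) (mixed_coeff A B C)
     (\<lambda>p. (k * (4 * fst p ^ 2 - 3 * snd p ^ 2) - k * (- 3 * fst p ^ 2 + 4 * snd p ^ 2)) * (fst p * snd p)
      + k * (- 7 * fst p * snd p) * (fst p * fst p - snd p * snd p))"
    unfolding mixed_coeff_def[abs_def] by (intro leading_add leading_diff leading_mult assms leading_fst leading_snd)
  then show "leading 4 (mixed_coeff A B C) (\<lambda>p. 0)"
    unfolding four by (rule leading_cong) (simp add: fun_eq_iff power2_eq_square algebra_simps)
  have "leading (2 + (1 + 1)) (angular_coeff A B C) (\<lambda>p. k * (- 3 * fst p ^ 2 + 4 * snd p ^ 2) * (snd p * snd p)
      - 2 * (k * (- 7 * fst p * snd p) * (fst p * snd p)) + k * (4 * fst p ^ 2 - 3 * snd p ^ 2) * (fst p * fst p))"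
    unfolding angular_coeff_def[abs_def] by (intro leading_add leading_diff leading_cmult leading_mult assms leading_fst leading_snd)
  then show "leading 4 (angular_coeff A B C) (\<lambda>p. 4 * (k * norm p ^ 4))"
    unfolding four by (rule leading_cong) (simp add: fun_eq_iff n power2_eq_square algebra_simps)
qed

lemma leading_cubic:
  assumes "isCont h 0" "(\<lambda>(u, v). h (u, v) - (u ^ 3 - 3 * u * v ^ 2)) \<in> O[at (0, 0)](\<lambda>p. norm p ^ 4)"
  shows "leading 3 h (\<lambda>p. fst p ^ 3 - 3 * fst p * snd p ^ 2)"
proof -
  have "(\<lambda>p. h p - (fst p ^ 3 - 3 * fst p * snd p ^ 2)) \<in> O[at 0](\<lambda>p. norm p ^ 4)"
    using assms(2) by (simp add: case_prod_beta' zero_prod_def)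
  moreover have "isCont (\<lambda>p. h p - (fst p ^ 3 - 3 * fst p * snd p ^ 2)) 0"
    by (intro continuous_intros assms(1))
  ultimately have "vanishing 4 (\<lambda>p. h p - (fst p ^ 3 - 3 * fst p * snd p ^ 2))"
    by (rule vanishingI_at[rotated])
  moreover have "leading (1 + (1 + 1)) (\<lambda>p. fst p * (fst p * fst p) - 3 * (fst p * (snd p * snd p))) (\<lambda>p. fst p * (fst p * fst p) - 3 * (fst p * (snd p * snd p)))"
    by (intro leading_intros)
  then have "vanishing 3 (\<lambda>p. fst p ^ 3 - 3 * fst p * snd p ^ 2)"
    by (simp add: leading_def eval_nat_numeral mult.assoc)
  ultimately show ?thesis by (simp add: leading_def)
qed

section \<open>The two foci from estimates of the coefficients, and the theorem\<close>

text \<open>The geometry of the surface enters only through smoothness of the coefficients and the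
  three estimates, which are those of \<open>root_bounds\<close> with
  \<open>m = k * norm p ^ 4\<close>. The common sense of rotation is \<open>s = 1\<close>, because
  both \<open>\<eta>1\<close> and \<open>\<eta>2\<close> are positive.\<close>

lemma foci_of_coefficient_bounds:
  fixes h :: "real \<times> real \<Rightarrow> real" and \<rho> k :: real
  assumes \<rho>: "\<rho> > 0" and k: "k > 0"
    and sm: "smooth_on (ball 0 \<rho>) (coeff_A h)" "smooth_on (ball 0 \<rho>) (coeff_B h)" "smooth_on (ball 0 \<rho>) (coeff_C h)"
    and bounds: "\<And>p. norm p < \<rho> \<Longrightarrow> \<bar>radial_coeff (coeff_A h) (coeff_B h) (coeff_C h) p + 3 * (k * norm p ^ 4)\<bar> \<le> k * norm p ^ 4 / 10"
      "\<And>p. norm p < \<rho> \<Longrightarrow> \<bar>mixed_coeff (coeff_A h) (coeff_B h) (coeff_C h) p\<bar> \<le> k * norm p ^ 4 / 10"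
      "\<And>p. norm p < \<rho> \<Longrightarrow> \<bar>angular_coeff (coeff_A h) (coeff_B h) (coeff_C h) p - 4 * (k * norm p ^ 4)\<bar> \<le> k * norm p ^ 4 / 10"
  defines "U \<equiv> ball (0 :: real \<times> real) \<rho>"
  shows "(\<forall>p \<in> U - {(0, 0)}. discr h p \<noteq> 0) \<and>
    (\<exists>Y1 Y2. continuous_on U Y1 \<and> smooth_on (U - {(0, 0)}) Y1 \<and>
      continuous_on U Y2 \<and> smooth_on (U - {(0, 0)}) Y2 \<and>
      (\<forall>p \<in> U - {(0, 0)}. fst (Y1 p) * snd (Y2 p) - snd (Y1 p) * fst (Y2 p) \<noteq> 0) \<and>
      (\<forall>I c. open I \<and> is_interval I \<and> I \<noteq> {} \<and> c ` I \<subseteq> U - {(0, 0)} \<longrightarrow>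
         (affine_asymptotic_line h I c \<longleftrightarrow> orbit_arc Y1 I c \<or> orbit_arc Y2 I c)) \<and>
      stable_topological_focus Y1 (0, 0) \<and>
      unstable_topological_focus Y2 (0, 0) \<and>
      (\<exists>s \<in> {- 1, 1}.
         (\<forall>p \<in> U - {(0, 0)}. s * angular_velocity Y1 p > 0 \<and> s * angular_velocity Y2 p > 0) \<and>
         spirals_in_with_sense s U Y1 \<and>
         spirals_in_with_sense (- s) U (\<lambda>p. - Y2 p)))"
proof -
  define \<Omega> where "\<Omega> = ball (0 :: real \<times> real) \<rho> - {0}"
  have op: "open \<Omega>" by (auto simp: \<Omega>_def)
  define a where "a = radial_coeff (coeff_A h) (coeff_B h) (coeff_C h)"
  define b where "b = mixed_coeff (coeff_A h) (coeff_B h) (coeff_C h)"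
  define c where "c = angular_coeff (coeff_A h) (coeff_B h) (coeff_C h)"
  define s where "s p = sqrt (b p * b p - a p * c p)" for p
  define \<eta>1 where "\<eta>1 p = (b p + s p) / c p" for p
  define \<eta>2 where "\<eta>2 p = (s p - b p) / c p" for p
  have n: "fst p * fst p + snd p * snd p > 0" if "p \<in> \<Omega>" for p
    using that norm_Pair_squared[of p] unfolding \<Omega>_def power2_eq_square
    by (metis DiffD2 mult_pos_pos singleton_iff zero_less_norm_iff)
  have rb: "b p * b p - a p * c p > 0" "c p > 0" "1 / 2 \<le> \<eta>1 p" "\<eta>1 p \<le> 2" "1 / 2 \<le> \<eta>2 p" "\<eta>2 p \<le> 2"
    if "p \<in> \<Omega>" for p
  proof -
    have p: "norm p < \<rho>" "k * norm p ^ 4 > 0" using that k by (auto simp: \<Omega>_def)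
    show "b p * b p - a p * c p > 0" "c p > 0" "1 / 2 \<le> \<eta>1 p" "\<eta>1 p \<le> 2" "1 / 2 \<le> \<eta>2 p" "\<eta>2 p \<le> 2"
      unfolding \<eta>1_def \<eta>2_def s_def
      using root_bounds[OF p(2) bounds(1-3)[OF p(1)]] by (simp_all add: a_def b_def c_def)
  qed
  have sm': "smooth_on \<Omega> (coeff_A h)" "smooth_on \<Omega> (coeff_B h)" "smooth_on \<Omega> (coeff_C h)"
    using sm[THEN smooth_on_subset[of _ _ \<Omega>]] by (auto simp: \<Omega>_def)
  have smabc: "smooth_on \<Omega> a" "smooth_on \<Omega> b" "smooth_on \<Omega> c"
    unfolding a_def b_def c_def radial_coeff_def[abs_def] mixed_coeff_def[abs_def] angular_coeff_def[abs_def]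
    by (intro smooth_intros op sm')+
  have sms: "smooth_on \<Omega> s"
    unfolding s_def[abs_def] by (intro smooth_intros op smabc rb)
  have c0: "c p \<noteq> 0" if "p \<in> \<Omega>" for p using rb(2)[OF that] by simp
  have sm\<eta>: "smooth_on \<Omega> \<eta>1" "smooth_on \<Omega> \<eta>2"
    unfolding \<eta>1_def[abs_def] \<eta>2_def[abs_def] by (intro smooth_intros op smabc sms c0; assumption)+
  note cont\<eta> = sm\<eta>[THEN smooth_on_continuous_on]
  have sm\<eta>2': "smooth_on \<Omega> (\<lambda>p. - \<eta>2 p)" by (intro smooth_intros op sm\<eta>)
  have factor: "coeff_A h p * (fst w)\<^sup>2 + 2 * coeff_B h p * fst w * snd w + coeff_C h p * (snd w)\<^sup>2 = 0 \<longleftrightarrow>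
      (let x = fst p * fst w + snd p * snd w; y = fst p * snd w - snd p * fst w in y = - \<eta>1 p * x \<or> y = \<eta>2 p * x)"
    if p: "p \<in> \<Omega>" for p w
  proof -
    define x where "x = fst p * fst w + snd p * snd w"
    define y where "y = fst p * snd w - snd p * fst w"
    have s2: "s p * s p = b p * b p - a p * c p"
      using rb(1)[OF p] by (simp add: s_def)
    have "(coeff_A h p * (fst w)\<^sup>2 + 2 * coeff_B h p * fst w * snd w + coeff_C h p * (snd w)\<^sup>2) * (fst p * fst p + snd p * snd p)\<^sup>2 =
        c p * ((y + \<eta>1 p * x) * (y - \<eta>2 p * x))"
      unfolding quadratic_form_in_radial_frame a_def[symmetric] b_def[symmetric] c_def[symmetric]
        x_def[symmetric] y_def[symmetric] \<eta>1_def \<eta>2_def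
      by (rule quadratic_form_factorization[OF c0[OF p] s2])
    moreover have "(fst p * fst p + snd p * snd p)\<^sup>2 \<noteq> 0" using n[OF p] by (metis less_irrefl power_not_zero)
    ultimately have "coeff_A h p * (fst w)\<^sup>2 + 2 * coeff_B h p * fst w * snd w + coeff_C h p * (snd w)\<^sup>2 = 0 \<longleftrightarrow>
        (y + \<eta>1 p * x) * (y - \<eta>2 p * x) = 0"
      using c0[OF p] by (metis mult_eq_0_iff)
    also have "\<dots> \<longleftrightarrow> y = - \<eta>1 p * x \<or> y = \<eta>2 p * x" by (auto simp: eq_neg_iff_add_eq_0)
    finally show ?thesis by (simp add: x_def y_def Let_def)
  qed
  have pos: "\<eta>1 p > 0" "\<eta>2 p > 0" if "p \<in> \<Omega>" for p using rb[OF that] by linarith+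
  have abs\<eta>: "\<bar>\<eta>1 p\<bar> \<le> 2" "\<bar>\<eta>2 p\<bar> \<le> 2" "\<bar>- \<eta>2 p\<bar> \<le> 2" if "p \<in> \<Omega>" for p
    using rb[OF that] by (auto simp: abs_le_iff)
  define Y1 where "Y1 = spiral_field (- 1) \<eta>1"
  define Y2 where "Y2 = spiral_field 1 \<eta>2"
  \<comment> \<open>Reversing time in \<open>Y2\<close> makes it contract and turns its angular
    speed into \<open>- \<eta>2\<close>. So fields that turn in the same sense spiral into the
    origin in opposite senses.\<close>
  have mY2: "(\<lambda>p. - Y2 p) = spiral_field (- 1) (\<lambda>p. - \<eta>2 p)"
    by (auto simp: Y2_def spiral_field_def fun_eq_iff)
  have U\<Omega>: "U - {0} = \<Omega>" by (simp add: U_def \<Omega>_def)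
  have "discr h p \<noteq> 0" if p: "p \<in> \<Omega>" for p
  proof
    assume "discr h p = 0"
    then have "coeff_B h p * coeff_B h p - coeff_A h p * coeff_C h p = 0"
      by (simp add: discr_def power2_eq_square)
    then show False
      using rb(1)[OF p] discriminant_in_radial_frame[of "coeff_A h" "coeff_B h" "coeff_C h" p]
      by (simp add: a_def b_def c_def)
  qed
  moreover have "continuous_on U Y1" "continuous_on U Y2"
    unfolding U_def Y1_def Y2_def
    by (rule continuous_on_spiral_field[where M = 2]; use cont\<eta> abs\<eta> in \<open>simp add: \<Omega>_def\<close>)+
  moreover have "smooth_on \<Omega> Y1" "smooth_on \<Omega> Y2"
    unfolding Y1_def Y2_def by (intro smooth_on_spiral_field op sm\<eta>)+
  moreover have "fst (Y1 p) * snd (Y2 p) - snd (Y1 p) * fst (Y2 p) \<noteq> 0" if p: "p \<in> \<Omega>" for p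
  proof -
    have "fst (Y1 p) * snd (Y2 p) - snd (Y1 p) * fst (Y2 p) = - ((\<eta>1 p + \<eta>2 p) * (fst p * fst p + snd p * snd p))"
      by (simp add: Y1_def Y2_def spiral_field_def algebra_simps)
    moreover have "(\<eta>1 p + \<eta>2 p) * (fst p * fst p + snd p * snd p) > 0"
      using add_pos_pos[OF pos[OF p]] n[OF p] by (rule mult_pos_pos)
    ultimately show ?thesis by linarith
  qed
  moreover have "affine_asymptotic_line h I c \<longleftrightarrow> orbit_arc Y1 I c \<or> orbit_arc Y2 I c"
    if "open I" "is_interval I" "c ` I \<subseteq> \<Omega>" for I c
    unfolding Y1_def Y2_def
    by (rule affine_asymptotic_line_iff[OF factor pos cont\<eta> _ that]) (auto simp: \<Omega>_def)
  moreover have "stable_topological_focus Y1 0"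
    unfolding Y1_def
    by (rule stable_topological_focus_spiral_field[OF \<rho>, folded \<Omega>_def, where s = 1 and m = "1 / 2" and M = 2])
      (use sm\<eta> rb abs\<eta> in auto)
  moreover have "unstable_topological_focus Y2 0"
    unfolding unstable_topological_focus_def mY2
    by (rule stable_topological_focus_spiral_field[OF \<rho>, folded \<Omega>_def, where s = "- 1" and m = "1 / 2" and M = 2])
      (use sm\<eta>2' rb abs\<eta> in auto)
  moreover have "angular_velocity Y1 p > 0" "angular_velocity Y2 p > 0" if p: "p \<in> \<Omega>" for p
    using pos[OF p] p by (simp_all add: Y1_def Y2_def \<Omega>_def angular_velocity_spiral_field)
  moreover have "spirals_in_with_sense 1 U Y1"
    unfolding Y1_def
    by (rule spirals_in_with_sense_spiral_field[where m = "1 / 2"]) (use rb U\<Omega> in auto)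
  moreover have "spirals_in_with_sense (- 1) U (\<lambda>p. - Y2 p)"
    unfolding mY2
    by (rule spirals_in_with_sense_spiral_field[where m = "1 / 2"]) (use rb U\<Omega> in auto)
  ultimately show ?thesis
    unfolding zero_prod_def[symmetric] U\<Omega>
    by - (rule conjI, blast, rule exI[of _ Y1], rule exI[of _ Y2], simp)
qed

theorem theorem5p7:
  fixes h :: "real \<times> real \<Rightarrow> real" and W :: "(real \<times> real) set"
  assumes "open W" and "(0, 0) \<in> W" and "smooth_on W h"
    and "flat_umbilic h (0, 0)"
    and "(\<lambda>(u, v). h (u, v) - (u ^ 3 - 3 * u * v ^ 2)) \<in> O[at (0, 0)](\<lambda>p. norm p ^ 4)"
  shows "(\<exists>U. open U \<and> (0, 0) \<in> U \<and> U \<subseteq> W \<and> {p \<in> U. discr h p = 0} = {(0, 0)}) \<and>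
    (\<exists>U Y1 Y2. open U \<and> (0, 0) \<in> U \<and> U \<subseteq> W \<and>
      continuous_on U Y1 \<and> smooth_on (U - {(0, 0)}) Y1 \<and>
      continuous_on U Y2 \<and> smooth_on (U - {(0, 0)}) Y2 \<and>
      (\<forall>p \<in> U - {(0, 0)}. fst (Y1 p) * snd (Y2 p) - snd (Y1 p) * fst (Y2 p) \<noteq> 0) \<and>
      (\<forall>I c. open I \<and> is_interval I \<and> I \<noteq> {} \<and> c ` I \<subseteq> U - {(0, 0)} \<longrightarrow>
         (affine_asymptotic_line h I c \<longleftrightarrow> orbit_arc Y1 I c \<or> orbit_arc Y2 I c)) \<and>
      stable_topological_focus Y1 (0, 0) \<and>
      unstable_topological_focus Y2 (0, 0) \<and>
      (\<exists>s \<in> {- 1, 1}.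
         (\<forall>p \<in> U - {(0, 0)}. s * angular_velocity Y1 p > 0 \<and> s * angular_velocity Y2 p > 0) \<and>
         spirals_in_with_sense s U Y1 \<and>
         spirals_in_with_sense (- s) U (\<lambda>p. - Y2 p)))"
proof -
  have W: "open W" "0 \<in> W" and h: "smooth_on W h" using assms by (simp_all add: zero_prod_def)
  have cubic: "leading 3 h (\<lambda>p. fst p ^ 3 - 3 * fst p * snd p ^ 2)"
    by (rule leading_cubic[OF smooth_on_isCont[OF h W] assms(5)])
  note lead = leading_affine_polys[OF W h cubic]
  note lead' = leading_radial_frame[OF lead(2-4)]
  have "\<forall>\<^sub>F p in nhds 0. p \<in> W \<and> \<bar>hess_det h p - - 36 * (fst p ^ 2 + snd p ^ 2)\<bar> \<le> 1 * norm p ^ 2 \<and>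
      \<bar>poly_A h p - 5184 * (- 3 * fst p ^ 2 + 4 * snd p ^ 2)\<bar> \<le> 1 * norm p ^ 2 \<and>
      \<bar>poly_B h p - 5184 * (- 7 * fst p * snd p)\<bar> \<le> 1 * norm p ^ 2 \<and>
      \<bar>radial_coeff (poly_A h) (poly_B h) (poly_C h) p - - 3 * (5184 * norm p ^ 4)\<bar> \<le> 5184 / 10 * norm p ^ 4 \<and>
      \<bar>mixed_coeff (poly_A h) (poly_B h) (poly_C h) p - 0\<bar> \<le> 5184 / 10 * norm p ^ 4 \<and>
      \<bar>angular_coeff (poly_A h) (poly_B h) (poly_C h) p - 4 * (5184 * norm p ^ 4)\<bar> \<le> 5184 / 10 * norm p ^ 4"
    by (intro eventually_conj eventually_leading_bound lead lead' eventually_nhds_in_open W) simp_all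
  \<comment> \<open>The tolerance 1 for \<open>hess_det h\<close> gives
    \<open>D \<le> - 35 * norm p ^ 2\<close>. The bounds for \<open>poly_A\<close> and
    \<open>poly_B\<close> serve at \<open>p = 0\<close>, where they force both values to be 0. The
    tolerance \<open>5184 / 10\<close> is the \<open>m / 10\<close> of
    \<open>root_bounds\<close>.\<close>
  then obtain \<rho> where \<rho>: "\<rho> > 0" and bd: "\<And>p. norm p < \<rho> \<Longrightarrow> p \<in> W"
      "\<And>p. norm p < \<rho> \<Longrightarrow> \<bar>hess_det h p - - 36 * (fst p ^ 2 + snd p ^ 2)\<bar> \<le> 1 * norm p ^ 2"
      "\<And>p. norm p < \<rho> \<Longrightarrow> \<bar>poly_A h p - 5184 * (- 3 * fst p ^ 2 + 4 * snd p ^ 2)\<bar> \<le> 1 * norm p ^ 2"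
      "\<And>p. norm p < \<rho> \<Longrightarrow> \<bar>poly_B h p - 5184 * (- 7 * fst p * snd p)\<bar> \<le> 1 * norm p ^ 2"
      "\<And>p. norm p < \<rho> \<Longrightarrow> \<bar>radial_coeff (poly_A h) (poly_B h) (poly_C h) p - - 3 * (5184 * norm p ^ 4)\<bar> \<le> 5184 / 10 * norm p ^ 4"
      "\<And>p. norm p < \<rho> \<Longrightarrow> \<bar>mixed_coeff (poly_A h) (poly_B h) (poly_C h) p\<bar> \<le> 5184 / 10 * norm p ^ 4"
      "\<And>p. norm p < \<rho> \<Longrightarrow> \<bar>angular_coeff (poly_A h) (poly_B h) (poly_C h) p - 4 * (5184 * norm p ^ 4)\<bar> \<le> 5184 / 10 * norm p ^ 4"
    unfolding eventually_nhds_metric dist_norm diff_zero by blast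
  let ?U = "ball (0 :: real \<times> real) \<rho>"
  have U: "open ?U" "0 \<in> ?U" "?U \<subseteq> W" using \<rho> bd(1) by auto
  have neg: "hess_det h p < 0" if "p \<in> ?U - {0}" for p
  proof -
    have "norm p ^ 2 > 0" "norm p < \<rho>" using that by auto
    then show ?thesis using bd(2)[of p] unfolding norm_Pair_squared by (simp add: abs_le_iff)
  qed
  have zero: "hess_det h 0 = 0" "poly_A h 0 = 0" "poly_B h 0 = 0"
    using bd(2-4)[of 0] \<rho> by simp_all
  have op: "open (?U - {0})" by auto
  have h\<Omega>: "smooth_on (?U - {0}) h" using smooth_on_subset[OF h] U(3) by blast
  note coef = affine_coefficients[OF op h\<Omega> neg]
  note smP = smooth_on_affine_polys[OF W(1) h]
  have eq: "coeff_A h p = poly_A h p" "coeff_B h p = poly_B h p" "coeff_C h p = poly_C h p" if "p \<in> ?U" for p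
  proof -
    have p: "norm p < \<rho>" using that by simp
    have nz: "hess_det h q \<noteq> 0" if "q \<noteq> 0" "norm q < \<rho>" for q using neg[of q] that by auto
    show "coeff_A h p = poly_A h p"
      unfolding coeff_A_def by (rule ext16_eq[OF \<rho> p smooth_on_isCont[OF smP(1) W] nz coef(1) zero(1)]) auto
    show "coeff_B h p = poly_B h p"
      unfolding coeff_B_def by (rule ext16_eq[OF \<rho> p smooth_on_isCont[OF smP(2) W] nz coef(2) zero(1)]) auto
    show "coeff_C h p = poly_C h p"
      unfolding coeff_C_def by (rule ext16_eq[OF \<rho> p smooth_on_isCont[OF smP(3) W] nz coef(3) zero(1)]) auto
  qed
  have smc: "smooth_on ?U (coeff_A h)" "smooth_on ?U (coeff_B h)" "smooth_on ?U (coeff_C h)"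
    using smooth_on_cong[OF U(1) eq(1)[symmetric] smooth_on_subset[OF smP(1) U(3)]]
      smooth_on_cong[OF U(1) eq(2)[symmetric] smooth_on_subset[OF smP(2) U(3)]]
      smooth_on_cong[OF U(1) eq(3)[symmetric] smooth_on_subset[OF smP(3) U(3)]] by auto
  have fr: "radial_coeff (coeff_A h) (coeff_B h) (coeff_C h) p = radial_coeff (poly_A h) (poly_B h) (poly_C h) p"
    "mixed_coeff (coeff_A h) (coeff_B h) (coeff_C h) p = mixed_coeff (poly_A h) (poly_B h) (poly_C h) p"
    "angular_coeff (coeff_A h) (coeff_B h) (coeff_C h) p = angular_coeff (poly_A h) (poly_B h) (poly_C h) p"
    if "norm p < \<rho>" for p
    using eq[of p] that by (simp_all add: radial_coeff_def mixed_coeff_def angular_coeff_def)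
  have main: "(\<forall>p \<in> ?U - {(0, 0)}. discr h p \<noteq> 0) \<and>
    (\<exists>Y1 Y2. continuous_on ?U Y1 \<and> smooth_on (?U - {(0, 0)}) Y1 \<and>
      continuous_on ?U Y2 \<and> smooth_on (?U - {(0, 0)}) Y2 \<and>
      (\<forall>p \<in> ?U - {(0, 0)}. fst (Y1 p) * snd (Y2 p) - snd (Y1 p) * fst (Y2 p) \<noteq> 0) \<and>
      (\<forall>I c. open I \<and> is_interval I \<and> I \<noteq> {} \<and> c ` I \<subseteq> ?U - {(0, 0)} \<longrightarrow>
         (affine_asymptotic_line h I c \<longleftrightarrow> orbit_arc Y1 I c \<or> orbit_arc Y2 I c)) \<and>
      stable_topological_focus Y1 (0, 0) \<and>
      unstable_topological_focus Y2 (0, 0) \<and>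
      (\<exists>s \<in> {- 1, 1}.
         (\<forall>p \<in> ?U - {(0, 0)}. s * angular_velocity Y1 p > 0 \<and> s * angular_velocity Y2 p > 0) \<and>
         spirals_in_with_sense s ?U Y1 \<and>
         spirals_in_with_sense (- s) ?U (\<lambda>p. - Y2 p)))"
    by (rule foci_of_coefficient_bounds[OF \<rho> _ smc, of 5184]) (use bd(5-7) fr in simp_all)
  \<comment> \<open>\<open>A\<close> and \<open>B\<close> vanish at the origin, hence so does
    \<open>B^2 - A C\<close>; elsewhere in the disc the discriminant is nonzero by
    \<open>main\<close>.\<close>
  have "discr h 0 = 0"
    using eq[OF U(2)] zero by (simp add: discr_def)
  then have "{p \<in> ?U. discr h p = 0} = {(0, 0)}"
    using main U(2) by (auto simp: zero_prod_def)
  with main U show ?thesis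
    unfolding zero_prod_def by blast
qed

end
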